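(* Let $p\ge 5$ be a prime and let $a,b,c\in\mathbb{F}_p^{\times}$. Put $A=2$ if all of $a,b,c$ are distinct and $A=1$ if exactly two of $a,b,c$ are equal. (1) If $a+b+c=0$ and $ab+bc+ca\neq 0$, then $${_{2}G}_{2}\left[\begin{array}{cc}\frac13,&\frac23\\ 0,&\frac12\end{array}\Big|\ -\frac{4(ab+bc+ca)^3}{27a^2b^2c^2}\right]=A.$$ (2) If $ab+bc+ca=0$ and $a+b+c\neq 0$, then $${_{2}G}_{2}\left[\begin{array}{cc}\frac13,&\frac23\\ 0,&\frac12\end{array}\Big|\ -\frac{4(a+b+c)^3}{27abc}\right]=A.$$
   Context: McCarthy's $p$-adic hypergeometric series: $\Gamma_p:\mathbb{Z}_p\to\mathbb{Z}_p^\times$ is the $p$-adic gamma function, i.e. the unique continuous function with $\Gamma_p(0)=1$ and $\Gamma_p(n)=(-1)^n\prod_{0<j<n,\,p\nmid j}j$ for positive integers $n$. $\omega:\mathbb{F}_p^\times\to\mathbb{Z}_p^\times$ is the Teichmüller character ($\omega(a)$ is the $(p-1)$-th root of unity with $\omega(a)\equiv a \pmod p$) and $\overline{\omega}$ its inverse; all characters, including the trivial one $\overline\omega^0$, are extended to $\mathbb{F}_p$ by the value $0$ at $0$. $\lfloor x\rfloor$ is the floor and $\langle x\rangle=x-\lfloor x\rfloor$ the fractional part of $x\in\mathbb{Q}$. For an odd prime $p$, $t\in\mathbb{F}_p$, $n\ge 1$ and $a_i,b_i\in\mathbb{Q}\cap\mathbb{Z}_p$ ($1\le i\le n$), $${_nG}_n\left[\begin{array}{cccc}a_1,&a_2,&\ldots,&a_n\\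 b_1,&b_2,&\ldots,&b_n\end{array}\Big|\ t\right]:=\frac{-1}{p-1}\sum_{j=0}^{p-2}(-1)^{jn}\,\overline{\omega}^j(t)\prod_{i=1}^n(-p)^{-\lfloor\langle a_i\rangle-\frac{j}{p-1}\rfloor-\lfloor\langle -b_i\rangle+\frac{j}{p-1}\rfloor}\frac{\Gamma_p(\langle a_i-\frac{j}{p-1}\rangle)}{\Gamma_p(\langle a_i\rangle)}\frac{\Gamma_p(\langle -b_i+\frac{j}{p-1}\rangle)}{\Gamma_p(\langle -b_i\rangle)}.$$ *)

theory Defs
  imports
    Complex_Main
    "HOL-Computational_Algebra.Fraction_Field"
    "Berlekamp_Zassenhaus.Finite_Field"
begin

section \<open>The ring of \<open>p\<close>-adic integers\<close>

text \<open>
  The prime is \<open>p = CARD('p)\<close> for a type \<open>'p\<close> of class \<^class>\<open>prime_card\<close>, so that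
  \<open>'p mod_ring\<close> is the field with \<open>p\<close> elements. The \<open>p\<close>-adic integers are the inverse limit
  of the rings of integers modulo \<open>p ^ n\<close>; the defining equation also forces the \<open>n\<close>-th
  component to lie in \<open>{0..<p ^ n}\<close>.
\<close>

typedef (overloaded) 'p padic_int =
  "{x :: nat \<Rightarrow> int. \<forall>n. x n = x (Suc n) mod int CARD('p::prime_card) ^ n}"
  morphisms padic_residue Abs_padic_int
  by (rule exI[of _ "\<lambda>_. 0"]) simp

setup_lifting type_definition_padic_int

lemma mod_power_Suc_mod: "(k mod q ^ Suc n) mod q ^ n = k mod (q ^ n :: int)"
  by (rule mod_mod_cancel) simp

lemma
  fixes x y x' y' q :: int
  assumes "x = x' mod q ^ n" and "y = y' mod q ^ n"
  shows mod_add_lift: "(x + y) mod q ^ n = (x' + y') mod q ^ Suc n mod q ^ n"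
    and mod_diff_lift: "(x - y) mod q ^ n = (x' - y') mod q ^ Suc n mod q ^ n"
    and mod_mult_lift: "(x * y) mod q ^ n = (x' * y') mod q ^ Suc n mod q ^ n"
  unfolding assms mod_power_Suc_mod by (rule mod_add_eq mod_diff_eq mod_mult_eq)+

lemma padic_residue_mod_Suc:
  "padic_residue (x :: 'p::prime_card padic_int) (Suc n) mod int CARD('p) ^ n = padic_residue x n"
  by (rule padic_residue[of x, unfolded mem_Collect_eq, rule_format, symmetric])

lemma padic_residue_mod_le:
  fixes x :: "'p::prime_card padic_int"
  assumes "m \<le> n"
  shows "padic_residue x n mod int CARD('p) ^ m = padic_residue x m"
  using assms
proof (induction n rule: dec_induct)
  case base
  show ?case
    by (metis mod_mod_trivial padic_residue_mod_Suc)
next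
  case (step n)
  have "int CARD('p) ^ m dvd int CARD('p) ^ n"
    using step.hyps by (simp add: le_imp_power_dvd)
  hence "padic_residue x (Suc n) mod int CARD('p) ^ m
      = (padic_residue x (Suc n) mod int CARD('p) ^ n) mod int CARD('p) ^ m"
    by (simp add: mod_mod_cancel)
  thus ?case
    using step.IH by (simp add: padic_residue_mod_Suc)
qed

lemma padic_int_eqI: "(\<And>n. padic_residue x n = padic_residue y n) \<Longrightarrow> x = y"
  by (metis ext padic_residue_inject)

instantiation padic_int :: (prime_card) comm_ring_1
begin

lift_definition zero_padic_int :: "'a padic_int" is "\<lambda>_. 0"
  by simp

lift_definition one_padic_int :: "'a padic_int" is "\<lambda>n. 1 mod int CARD('a) ^ n"
  by (intro allI mod_power_Suc_mod[symmetric])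

lift_definition plus_padic_int :: "'a padic_int \<Rightarrow> 'a padic_int \<Rightarrow> 'a padic_int"
  is "\<lambda>x y n. (x n + y n) mod int CARD('a) ^ n"
  subgoal premises h by (rule mod_add_lift; rule h) done

lift_definition minus_padic_int :: "'a padic_int \<Rightarrow> 'a padic_int \<Rightarrow> 'a padic_int"
  is "\<lambda>x y n. (x n - y n) mod int CARD('a) ^ n"
  subgoal premises h by (rule mod_diff_lift; rule h) done

lift_definition uminus_padic_int :: "'a padic_int \<Rightarrow> 'a padic_int"
  is "\<lambda>x n. (- x n) mod int CARD('a) ^ n"
  subgoal premises h by (rule mod_diff_lift[of 0 0, unfolded diff_0], simp, rule h) done

lift_definition times_padic_int :: "'a padic_int \<Rightarrow> 'a padic_int \<Rightarrow> 'a padic_int"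
  is "\<lambda>x y n. (x n * y n) mod int CARD('a) ^ n"
  subgoal premises h by (rule mod_mult_lift; rule h) done

instance
proof
  fix x y z :: "'a padic_int"
  note [simp] = zero_padic_int.rep_eq one_padic_int.rep_eq plus_padic_int.rep_eq
    minus_padic_int.rep_eq uminus_padic_int.rep_eq times_padic_int.rep_eq
    padic_residue_mod_le[OF order_refl]
  show "x * y * z = x * (y * z)"
    by (rule padic_int_eqI) (simp add: mod_simps ac_simps)
  show "x * y = y * x"
    by (rule padic_int_eqI) (simp add: ac_simps)
  show "1 * x = x"
    by (rule padic_int_eqI) (simp add: mod_simps)
  show "x + y + z = x + (y + z)"
    by (rule padic_int_eqI) (simp add: mod_simps ac_simps)
  show "x + y = y + x"
    by (rule padic_int_eqI) (simp add: ac_simps)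
  show "0 + x = x"
    by (rule padic_int_eqI) simp
  show "- x + x = 0"
    by (rule padic_int_eqI) (simp add: mod_simps)
  show "x - y = x + - y"
    by (rule padic_int_eqI) (simp add: mod_simps)
  show "(x + y) * z = x * z + y * z"
    by (rule padic_int_eqI) (simp add: mod_simps distrib_right)
  have "padic_residue (0 :: 'a padic_int) 1 \<noteq> padic_residue 1 1"
    using nontriv[where 'a = 'a] by simp
  thus "(0 :: 'a padic_int) \<noteq> 1"
    by metis
qed

end

lemma prime_power_dvd_mult_split:
  fixes p a b :: int
  assumes "prime p" "p ^ (m + n) dvd a * b"
  shows "p ^ m dvd a \<or> p ^ n dvd b"
proof (rule ccontr)
  assume "\<not> (p ^ m dvd a \<or> p ^ n dvd b)"
  hence nd: "\<not> p ^ m dvd a" "\<not> p ^ n dvd b" by auto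
  hence nz: "a \<noteq> 0" "b \<noteq> 0" by auto
  have nu: "\<not> is_unit p" using assms(1) not_prime_unit by blast
  have "multiplicity p a < m" "multiplicity p b < n"
    using nd nz nu by (meson multiplicity_dvd' not_less)+
  moreover have "multiplicity p (a * b) = multiplicity p a + multiplicity p b"
    by (rule prime_elem_multiplicity_mult_distrib[OF prime_imp_prime_elem[OF assms(1)] nz])
  moreover have "m + n \<le> multiplicity p (a * b)"
    using assms nz nu by (simp add: multiplicity_geI)
  ultimately show False by linarith
qed

instance padic_int :: (prime_card) idom
proof
  fix x y :: "'a padic_int"
  let ?p = "int CARD('a)"
  assume "x \<noteq> 0" "y \<noteq> 0"
  then obtain m n where mn: "padic_residue x m \<noteq> 0" "padic_residue y n \<noteq> 0"
    by (metis padic_int_eqI zero_padic_int.rep_eq)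
  have "\<not> ?p ^ m dvd padic_residue x (m + n)" "\<not> ?p ^ n dvd padic_residue y (m + n)"
    using mn padic_residue_mod_le[of m "m + n" x] padic_residue_mod_le[of n "m + n" y]
    by (auto simp: dvd_eq_mod_eq_0)
  hence "\<not> ?p ^ (m + n) dvd padic_residue x (m + n) * padic_residue y (m + n)"
    using prime_power_dvd_mult_split[of ?p] prime_card[where 'a = 'a] by auto
  hence "padic_residue (x * y) (m + n) \<noteq> 0"
    by (simp add: times_padic_int.rep_eq dvd_eq_mod_eq_0)
  thus "x * y \<noteq> 0"
    by (metis zero_padic_int.rep_eq)
qed

text \<open>
  The \<open>p\<close>-adic metric: since the zeroth component carries no information, the valuation
  of \<open>x - y\<close> for \<open>x \<noteq> y\<close> is the least \<open>n\<close> such that \<open>x\<close> and \<open>y\<close> differ modulo \<open>p ^ (n + 1)\<close>.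
\<close>

instantiation padic_int :: (prime_card) metric_space
begin

definition dist_padic_int :: "'a padic_int \<Rightarrow> 'a padic_int \<Rightarrow> real" where
  "dist_padic_int x y = (if x = y then 0 else
     1 / real CARD('a) ^ (LEAST n. padic_residue x (Suc n) \<noteq> padic_residue y (Suc n)))"

definition uniformity_padic_int :: "('a padic_int \<times> 'a padic_int) filter" where
  "uniformity_padic_int = (INF e\<in>{0 <..}. principal {(x, y). dist x y < e})"

definition open_padic_int :: "'a padic_int set \<Rightarrow> bool" where
  "open_padic_int U \<longleftrightarrow> (\<forall>x\<in>U. eventually (\<lambda>(x', y). x' = x \<longrightarrow> y \<in> U) uniformity)"

instance
proof
  fix x y z :: "'a padic_int"
  let ?d = "\<lambda>x y n. padic_residue x (Suc n) \<noteq> padic_residue (y :: 'a padic_int) (Suc n)"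
  let ?v = "\<lambda>x y :: 'a padic_int. LEAST n. ?d x y n"
  have ex: "\<exists>n. ?d x y n" if ne: "x \<noteq> y" for x y :: "'a padic_int"
  proof (rule ccontr)
    assume eq: "\<not> ?thesis"
    have "padic_residue x n = padic_residue y n" for n
      using eq padic_residue_mod_Suc[of x n] padic_residue_mod_Suc[of y n] by auto
    thus False
      using ne by (metis padic_int_eqI)
  qed
  have p1: "1 < real CARD('a)"
    using nontriv[where 'a = 'a] by simp
  show "dist x y = 0 \<longleftrightarrow> x = y"
    using p1 by (simp add: dist_padic_int_def)
  show "dist x y \<le> dist x z + dist y z"
  proof (cases "x = y \<or> x = z \<or> y = z")
    case True
    thus ?thesis using p1 by (auto simp: dist_padic_int_def neq_commute)
  next
    case False
    have d: "?d x y (?v x y)"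
      using ex[of x y] False by (metis (mono_tags, lifting) LeastI_ex)
    hence "?d x z (?v x y) \<or> ?d y z (?v x y)"
      by metis
    hence "?v x z \<le> ?v x y \<or> ?v y z \<le> ?v x y"
      by (metis (mono_tags, lifting) Least_le)
    hence "1 / real CARD('a) ^ ?v x y \<le> 1 / real CARD('a) ^ ?v x z \<or>
           1 / real CARD('a) ^ ?v x y \<le> 1 / real CARD('a) ^ ?v y z"
      using p1 by (auto intro!: divide_left_mono power_increasing)
    moreover have "0 \<le> 1 / real CARD('a) ^ ?v x z" "0 \<le> 1 / real CARD('a) ^ ?v y z"
      by simp_all
    ultimately have "1 / real CARD('a) ^ ?v x y
        \<le> 1 / real CARD('a) ^ ?v x z + 1 / real CARD('a) ^ ?v y z"
      by linarith
    thus ?thesis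
      using False by (simp add: dist_padic_int_def)
  qed
qed (rule uniformity_padic_int_def open_padic_int_def)+

end

section \<open>The \<open>p\<close>-adic gamma function and the Teichmueller character\<close>

definition padic_Gamma :: "'p::prime_card padic_int \<Rightarrow> 'p padic_int" where
  "padic_Gamma = (THE f. (\<forall>x. f x dvd 1) \<and> continuous_on UNIV f \<and> f 0 = 1 \<and>
     (\<forall>n>0. f (of_nat n) = (-1) ^ n * (\<Prod>j | 0 < j \<and> j < n \<and> \<not> CARD('p) dvd j. of_nat j)))"

text \<open>Only meaningful for \<open>a \<noteq> 0\<close>.\<close>

definition teichmueller :: "'p::prime_card mod_ring \<Rightarrow> 'p padic_int" where
  "teichmueller a = (THE z. z ^ (CARD('p) - 1) = 1 \<and>
     of_nat CARD('p) dvd z - of_int (to_int_mod_ring a))"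

section \<open>McCarthy's hypergeometric series\<close>

text \<open>The field of \<open>p\<close>-adic numbers is the fraction field of the \<open>p\<close>-adic integers.\<close>

type_synonym 'p padic = "'p padic_int fract"

definition padic_of_int :: "'p::prime_card padic_int \<Rightarrow> 'p padic" where
  "padic_of_int x = Fract x 1"

text \<open>The inclusion into the \<open>p\<close>-adic integers of the rationals with denominator prime to \<open>p\<close>.\<close>

definition padic_int_of_rat :: "rat \<Rightarrow> 'p::prime_card padic_int" where
  "padic_int_of_rat r =
     (THE x. of_int (snd (quotient_of r)) * x = of_int (fst (quotient_of r)))"

definition Gamma_rat :: "rat \<Rightarrow> 'p::prime_card padic" where
  "Gamma_rat r = padic_of_int (padic_Gamma (padic_int_of_rat r))"

text \<open>
  The \<open>j\<close>-th power of the inverse Teichmueller character, extended by \<open>0\<close> at \<open>0\<close>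
  also for \<open>j = 0\<close>.
\<close>

definition teichmueller_bar_power :: "nat \<Rightarrow> 'p::prime_card mod_ring \<Rightarrow> 'p padic" where
  "teichmueller_bar_power j t =
     (if t = 0 then 0 else inverse (padic_of_int (teichmueller t)) ^ j)"

text \<open>
  The parameters \<open>a\<^sub>1, \<dots>, a\<^sub>n\<close> and \<open>b\<^sub>1, \<dots>, b\<^sub>n\<close> are given as two lists of the same length,
  with list positions counted from \<open>0\<close>.
\<close>

definition hypergeometric_G :: "rat list \<Rightarrow> rat list \<Rightarrow> 'p::prime_card mod_ring \<Rightarrow> 'p padic" where
  "hypergeometric_G a b t =
     - 1 / (of_nat CARD('p) - 1) *
     (\<Sum>j = 0..CARD('p) - 2.
        (let n = length a; q = of_nat j / (of_nat CARD('p) - 1) :: rat in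
          (-1) ^ (j * n) * teichmueller_bar_power j t *
          (\<Prod>i<n.
             (- of_nat CARD('p)) powi (- \<lfloor>frac (a ! i) - q\<rfloor> - \<lfloor>frac (- (b ! i)) + q\<rfloor>) *
             (Gamma_rat (frac (a ! i - q)) / Gamma_rat (frac (a ! i))) *
             (Gamma_rat (frac (- (b ! i) + q)) / Gamma_rat (frac (- (b ! i)))))))"

end

theory Submission
  imports Defs "HOL-Number_Theory.Number_Theory" "HOL-Computational_Algebra.Formal_Power_Series"
begin

text \<open>
  Write \<open>\<tau>\<close> for the Teichmueller lift. Fourier inversion over the characters \<open>\<tau> ^ j\<close> expresses the number of
  \<open>w\<close> with \<open>w\<^sup>3 - w\<^sup>2 = u\<close> through the Jacobi sums of \<open>\<tau> ^ (-2j)\<close> and \<open>\<tau> ^ (-j)\<close>, and \<open>a\<close>, \<open>b\<close>, \<open>c\<close> can be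
  rescaled to the roots of such an equation. The terms of the hypergeometric series are these Jacobi sums: the
  multiplication formula for the gamma function at \<open>2\<close> and \<open>3\<close> leaves the values at multiples of \<open>1 / (p - 1)\<close>
  only, and these are Gauss sums up to elementary factors (Gross and Koblitz). To avoid adjoining \<open>\<pi>\<close> with
  \<open>\<pi> ^ (p - 1) = -p\<close>, the Gauss sum of \<open>\<tau> ^ (-a)\<close> is replaced by
  \<open>\<gamma> a = (\<Sum>k. h (a + (p - 1) k) (-p) ^ k)\<close>, where \<open>exp (z + z\<^sup>p / p) = (\<Sum>n. h n z ^ n)\<close>. Additivity of the
  additive character becomes the functional equation of \<open>exp\<close>, and a trace formula of Dwork together with his
  expansion \<open>\<Gamma>\<^sub>p (p X - a) = (\<Sum>l. p ^ l h (a + p l) X (X + 1) \<dots> (X + l - 1))\<close> identifies \<open>(1 - p) \<gamma> a\<close> with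
  \<open>\<Gamma>\<^sub>p (a / (p - 1))\<close>.
\<close>

section \<open>Divisibility and completeness in the \<open>p\<close>-adic integers\<close>

text \<open>The main obstacle is convergence. Put \<open>l = n div p\<close>. The denominator
  \<open>n!\<close> of \<open>h n\<close> contains \<open>p ^ l\<close> and the
  \<open>p\<close>-part of \<open>l!\<close>. A factor \<open>p ^ l\<close> in front compensates the
  first; the second has exponent at most \<open>l / 4\<close> since p \<ge> 5, and it is outweighed
  by about \<open>l / 2\<close> factors \<open>p\<close> in the numerator
  \<open>torsion_count p n\<close>. The surplus of about \<open>l / 4\<close> is the rate at which
  Dwork's series converge, hence the recurring \<open>div 4\<close>.

  The floors in the definition of the hypergeometric series produce exactly this factor.\<close>

abbreviation padic_p :: "'p::prime_card padic_int" where
  "padic_p \<equiv> of_nat CARD('p)"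

lemma CARD_gt_1 [simp]: "1 < CARD('p::prime_card)" "0 < CARD('p::prime_card)"
  using prime_gt_1_nat[OF prime_card[where 'a = 'p]] by simp_all

lemma CARD_eq_SucE:
  obtains q where "CARD('p::prime_card) = Suc q"
  using CARD_gt_1(2)[where 'p = 'p] gr0_implies_Suc by blast

lemma padic_residue_of_nat:
  "padic_residue (of_nat k :: 'p::prime_card padic_int) n = int k mod int CARD('p) ^ n"
  by (induction k)
    (simp_all add: zero_padic_int.rep_eq one_padic_int.rep_eq plus_padic_int.rep_eq mod_simps)

lemma padic_residue_of_int:
  "padic_residue (of_int k :: 'p::prime_card padic_int) n = k mod int CARD('p) ^ n"
proof (cases k)
  case (nonneg m)
  then show ?thesis by (simp add: padic_residue_of_nat)
next
  case (neg m)
  have "of_int k = - (of_nat (Suc m) :: 'p padic_int)"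
    by (simp add: neg)
  then show ?thesis
    by (simp only: uminus_padic_int.rep_eq padic_residue_of_nat neg mod_simps)
qed

lemma padic_residue_mod_self [simp]:
  "padic_residue (x :: 'p::prime_card padic_int) n mod int CARD('p) ^ n = padic_residue x n"
  by (rule padic_residue_mod_le) simp

lemma padic_residue_bounds:
  fixes x :: "'p::prime_card padic_int"
  shows "0 \<le> padic_residue x n" and "padic_residue x n < int CARD('p) ^ n"
  using pos_mod_bound[of "int CARD('p) ^ n" "padic_residue x n"]
    pos_mod_sign[of "int CARD('p) ^ n" "padic_residue x n"] by simp_all

lemma padic_p_power_dvd_iff:
  fixes x :: "'p::prime_card padic_int"
  shows "padic_p ^ n dvd x \<longleftrightarrow> padic_residue x n = 0"
proof
  assume "padic_p ^ n dvd x"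
  then obtain y where x: "x = of_nat (CARD('p) ^ n) * y"
    by (auto simp: dvd_def)
  show "padic_residue x n = 0"
    unfolding x times_padic_int.rep_eq padic_residue_of_nat by simp
next
  assume 0: "padic_residue x n = 0"
  let ?q = "int CARD('p)"
  have dvd: "?q ^ n dvd padic_residue x (m + n)" for m
    using padic_residue_mod_le[of n "m + n" x] 0 by (simp add: dvd_eq_mod_eq_0)
  \<comment> \<open>Division by \<open>p ^ n\<close> shifts the tower of residues: the quotient
    modulo \<open>p ^ m\<close> is read off from \<open>x\<close> modulo
    \<open>p ^ (m + n)\<close>.\<close>
  define f where "f = (\<lambda>m. padic_residue x (m + n) div ?q ^ n)"
  have "f m = f (Suc m) mod ?q ^ m" for m
  proof -
    have "f m = (padic_residue x (Suc (m + n)) mod (?q ^ n * ?q ^ m)) div ?q ^ n"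
      using padic_residue_mod_Suc[of x "m + n"] by (simp add: f_def power_add mult.commute)
    also have "\<dots> = f (Suc m) mod ?q ^ m"
      by (subst zmod_zmult2_eq) (simp_all add: f_def)
    finally show ?thesis .
  qed
  then have res: "padic_residue (Abs_padic_int f :: 'p padic_int) = f"
    by (intro Abs_padic_int_inverse CollectI allI)
  have "padic_p ^ n * Abs_padic_int f = x"
  proof (rule padic_int_eqI)
    fix m
    have "padic_residue (of_nat (CARD('p) ^ n) * Abs_padic_int f :: 'p padic_int) m
        = (?q ^ n * f m) mod ?q ^ m"
      unfolding times_padic_int.rep_eq padic_residue_of_nat res by (simp add: mod_simps)
    also have "\<dots> = padic_residue x (m + n) mod ?q ^ m"
      using dvd by (simp add: f_def)
    also have "\<dots> = padic_residue x m"
      by (rule padic_residue_mod_le) simp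
    finally show "padic_residue (padic_p ^ n * Abs_padic_int f :: 'p padic_int) m = padic_residue x m"
      by simp
  qed
  then show "padic_p ^ n dvd x"
    by (metis dvd_triv_left)
qed

lemma padic_p_power_dvd_diff_iff:
  fixes x y :: "'p::prime_card padic_int"
  shows "padic_p ^ n dvd x - y \<longleftrightarrow> padic_residue x n = padic_residue y n"
proof -
  have "padic_residue (x - y) n = 0 \<longleftrightarrow> padic_residue x n mod int CARD('p) ^ n = padic_residue y n mod int CARD('p) ^ n"
    unfolding minus_padic_int.rep_eq by (metis dvd_eq_mod_eq_0 mod_eq_dvd_iff)
  then show ?thesis
    by (simp add: padic_p_power_dvd_iff)
qed

lemma padic_int_eqI_dvd:
  fixes x y :: "'p::prime_card padic_int"
  assumes "\<And>n. padic_p ^ n dvd x - y"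
  shows "x = y"
  using assms unfolding padic_p_power_dvd_diff_iff by (rule padic_int_eqI)

lemma padic_approx_nat:
  fixes x :: "'p::prime_card padic_int"
  obtains k where "padic_p ^ n dvd x - of_nat k"
proof
  show "padic_p ^ n dvd x - of_nat (nat (padic_residue x n))"
    unfolding padic_p_power_dvd_diff_iff padic_residue_of_nat
    by (simp add: padic_residue_bounds)
qed

text \<open>The hypothesis makes the diagonal \<open>padic_residue (s n) n\<close> a compatible
  tower, so the diagonal itself is the limit. The explicit rate \<open>p ^ n\<close> is what later
  estimates provide.\<close>

lemma padic_complete:
  fixes s :: "nat \<Rightarrow> 'p::prime_card padic_int"
  assumes "\<And>n. padic_p ^ n dvd s (Suc n) - s n"
  obtains x where "\<And>n. padic_p ^ n dvd x - s n"
proof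
  have "padic_residue (s n) n = padic_residue (s (Suc n)) (Suc n) mod int CARD('p) ^ n" for n
    using assms[of n] by (simp add: padic_p_power_dvd_diff_iff padic_residue_mod_Suc)
  then have "padic_residue (Abs_padic_int (\<lambda>n. padic_residue (s n) n) :: 'p padic_int)
      = (\<lambda>n. padic_residue (s n) n)"
    by (intro Abs_padic_int_inverse CollectI allI)
  then show "padic_p ^ n dvd Abs_padic_int (\<lambda>n. padic_residue (s n) n) - s n" for n
    by (simp add: padic_p_power_dvd_diff_iff)
qed

lemma padic_p_dvd_of_int_iff:
  "(padic_p :: 'p::prime_card padic_int) ^ n dvd of_int k \<longleftrightarrow> int CARD('p) ^ n dvd k"
  by (simp add: padic_p_power_dvd_iff padic_residue_of_int dvd_eq_mod_eq_0)

lemma padic_p_dvd_of_nat_iff: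
  "(padic_p :: 'p::prime_card padic_int) dvd of_nat k \<longleftrightarrow> CARD('p) dvd k"
  using padic_p_dvd_of_int_iff[of 1 "int k", where 'p = 'p] by simp

instance padic_int :: (prime_card) ring_char_0
proof
  show "inj (of_nat :: nat \<Rightarrow> 'a padic_int)"
  proof (rule injI)
    fix m n :: nat
    assume "(of_nat m :: 'a padic_int) = of_nat n"
    then have eq: "int m mod int CARD('a) ^ k = int n mod int CARD('a) ^ k" for k
      by (metis padic_residue_of_nat)
    define k where "k = m + n"
    have "m + n < CARD('a) ^ k"
      unfolding k_def by (rule power_gt_expt) (use CARD_gt_1[where 'p = 'a] in simp)
    then have "m mod CARD('a) ^ k = m" "n mod CARD('a) ^ k = n"
      by simp_all
    then show "m = n"
      using eq[of k] by (metis of_nat_mod of_nat_power of_nat_eq_iff)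
  qed
qed

text \<open>The formal exponential series and the divisions by factorials live in a field of
  characteristic 0.\<close>

instance fract :: ("{idom, ring_char_0}") field_char_0
proof
  show "inj (of_nat :: nat \<Rightarrow> 'a fract)"
    by (rule injI) (simp add: of_nat_fract eq_fract)
qed

lemma padic_p_nonzero [simp]: "(padic_p :: 'p::prime_card padic_int) \<noteq> 0"
  by simp

lemma prime_elem_padic_p: "prime_elem (padic_p :: 'p::prime_card padic_int)"
proof (rule prime_elemI)
  show "\<not> (padic_p :: 'p padic_int) dvd 1"
    using padic_p_dvd_of_nat_iff[of 1, where 'p = 'p] CARD_gt_1[where 'p = 'p] by simp
  fix a b :: "'p padic_int"
  assume "padic_p dvd a * b"
  then have "int CARD('p) dvd padic_residue a 1 * padic_residue b 1"
    using padic_p_power_dvd_iff[of 1 "a * b"] by (simp add: times_padic_int.rep_eq dvd_eq_mod_eq_0)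
  then have "int CARD('p) dvd padic_residue a 1 \<or> int CARD('p) dvd padic_residue b 1"
    using prime_dvd_mult_iff[OF prime_card_int[where 'a = 'p]] by blast
  moreover have "padic_p dvd c" if "int CARD('p) dvd padic_residue c 1" for c :: "'p padic_int"
  proof -
    have "padic_residue c 1 = 0"
      using that padic_residue_bounds[of c 1] by (auto dest: zdvd_imp_le)
    then show ?thesis
      using padic_p_power_dvd_iff[of 1 c] by simp
  qed
  ultimately show "padic_p dvd a \<or> padic_p dvd b"
    by blast
qed simp

lemma padic_p_power_dvd_cancel:
  fixes x y :: "'p::prime_card padic_int"
  assumes "\<not> padic_p dvd x" and "padic_p ^ n dvd x * y"
  shows "padic_p ^ n dvd y"
  using assms(2)
proof (induction n arbitrary: y)
  case (Suc n)
  then have "padic_p dvd x * y"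
    by (metis dvd_mult_left power_Suc)
  then obtain z where z: "y = padic_p * z"
    using assms(1) prime_elem_dvd_multD[OF prime_elem_padic_p] by blast
  have "padic_p * padic_p ^ n dvd padic_p * (x * z)"
    using Suc.prems unfolding z by (simp only: power_Suc mult.left_commute)
  then have "padic_p ^ n dvd x * z"
    by (simp only: dvd_mult_cancel_left padic_p_nonzero simp_thms)
  then have "padic_p ^ n dvd z"
    by (rule Suc.IH)
  then show ?case
    unfolding z power_Suc by (rule mult_dvd_mono[OF dvd_refl])
qed simp

text \<open>Inverses modulo each power of \<open>p\<close> come from coprimality of integers; they
  converge because \<open>x\<close> can be cancelled from the congruences between them.\<close>

lemma padic_unit_iff:
  fixes x :: "'p::prime_card padic_int"
  shows "x dvd 1 \<longleftrightarrow> \<not> padic_p dvd x"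
proof
  assume "x dvd 1"
  then show "\<not> padic_p dvd x"
    using prime_elem_padic_p prime_elem_not_unit dvd_trans by blast
next
  assume x: "\<not> padic_p dvd x"
  have "\<exists>y. padic_p ^ n dvd x * y - 1" for n
  proof -
    have "\<not> int CARD('p) dvd padic_residue x n" if "n > 0"
    proof
      assume "int CARD('p) dvd padic_residue x n"
      then have "padic_residue x 1 = 0"
        using padic_residue_mod_le[of 1 n x] that by (simp add: dvd_eq_mod_eq_0)
      then show False
        using x padic_p_power_dvd_iff[of 1 x] by simp
    qed
    then have "coprime (padic_residue x n) (int CARD('p) ^ n)"
      using prime_imp_coprime[OF prime_card_int[where 'a = 'p]]
      by (cases "n = 0") (auto simp: coprime_commute)
    then obtain k where "[padic_residue x n * k = 1] (mod int CARD('p) ^ n)"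
      using cong_solve_coprime_int by blast
    then have "padic_residue (x * of_int k) n = padic_residue (1 :: 'p padic_int) n"
      by (simp add: times_padic_int.rep_eq one_padic_int.rep_eq padic_residue_of_int cong_def mod_simps)
    then show ?thesis
      using padic_p_power_dvd_diff_iff by blast
  qed
  then obtain s where s: "padic_p ^ n dvd x * s n - 1" for n
    by metis
  have "padic_p ^ n dvd s (Suc n) - s n" for n
  proof (rule padic_p_power_dvd_cancel[OF x])
    have "padic_p ^ n dvd x * s (Suc n) - 1"
      using s[of "Suc n"] by (metis dvd_mult_right power_Suc)
    then have "padic_p ^ n dvd (x * s (Suc n) - 1) - (x * s n - 1)"
      using s dvd_diff by blast
    then show "padic_p ^ n dvd x * (s (Suc n) - s n)"
      by (simp add: algebra_simps)
  qed
  then obtain y where y: "\<And>n. padic_p ^ n dvd y - s n"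
    using padic_complete by blast
  have "x * y = 1"
  proof (rule padic_int_eqI_dvd)
    fix n
    have "padic_p ^ n dvd x * (y - s n) + (x * s n - 1)"
      using y s by (intro dvd_add dvd_mult)
    then show "padic_p ^ n dvd x * y - 1"
      by (simp add: algebra_simps)
  qed
  then show "x dvd 1"
    by (metis dvd_triv_left)
qed

section \<open>The metric and continuity in terms of divisibility\<close>

lemma padic_dist_less_iff:
  fixes x y :: "'p::prime_card padic_int"
  shows "dist x y < 1 / real CARD('p) ^ n \<longleftrightarrow> padic_p ^ Suc n dvd x - y"
proof (cases "x = y")
  case True
  then show ?thesis
    by (simp add: dist_padic_int_def)
next
  case False
  let ?P = "\<lambda>n. padic_residue x (Suc n) \<noteq> padic_residue y (Suc n)"
  have mono: "padic_residue x m = padic_residue y m"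
    if "padic_residue x k = padic_residue y k" "m \<le> k" for m k
    using that by (metis padic_residue_mod_le)
  have ex: "\<exists>n. ?P n"
  proof (rule ccontr)
    assume "\<not> (\<exists>n. ?P n)"
    then have "padic_residue x n = padic_residue y n" for n
      using mono[of "Suc n" n] by simp
    then show False
      using False padic_int_eqI by blast
  qed
  have p1: "1 < real CARD('p)"
    using CARD_gt_1[where 'p = 'p] by linarith
  \<comment> \<open>All nonzero distances are powers of \<open>1 / p\<close>, so strict inequality
    forces one further power of \<open>p\<close>: this is the shift from \<open>n\<close> to
    \<open>Suc n\<close>.\<close>
  have "dist x y < 1 / real CARD('p) ^ n \<longleftrightarrow> n < (LEAST n. ?P n)"
    using False p1 by (simp add: dist_padic_int_def field_simps)
  also have "\<dots> \<longleftrightarrow> \<not> ?P n"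
    using not_less_Least[of n ?P] LeastI_ex[OF ex] mono[of "Suc n" "Suc (LEAST n. ?P n)"]
    by (meson Suc_le_mono linorder_not_less)
  finally show ?thesis
    by (simp add: padic_p_power_dvd_diff_iff del: power_Suc)
qed

text \<open>Translates the topology in the definition of \<open>padic_Gamma\<close> into
  congruences, the form in which all estimates below are made.\<close>

lemma padic_continuous_iff:
  fixes f :: "'p::prime_card padic_int \<Rightarrow> 'p padic_int"
  shows "continuous_on UNIV f \<longleftrightarrow>
    (\<forall>x N. \<exists>M. \<forall>y. padic_p ^ M dvd y - x \<longrightarrow> padic_p ^ N dvd f y - f x)"
proof -
  have p1: "1 < real CARD('p)"
    using CARD_gt_1[where 'p = 'p] by linarith
  have small: "\<exists>n. 1 / real CARD('p) ^ n < e" if "e > 0" for e :: real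
    using real_arch_pow_inv[OF that, of "1 / real CARD('p)"] p1 by (simp add: power_one_over)
  have eps_delta: "continuous_on UNIV f \<longleftrightarrow>
      (\<forall>x\<in>UNIV. \<forall>e>0. \<exists>d>0. \<forall>y\<in>UNIV. dist y x < d \<longrightarrow> dist (f y) (f x) < e)"
  proof -
    have key: "(\<forall>y\<in>UNIV. y \<noteq> x \<and> dist y x < d \<longrightarrow> dist (f y) (f x) < e)
        = (\<forall>y\<in>UNIV. dist y x < d \<longrightarrow> dist (f y) (f x) < e)"
      if "e > 0" for x and d e :: real
    proof -
      have "dist (f x) (f x) < e"
        using that by simp
      then show ?thesis
        by (intro ball_cong refl) auto
    qed
    have "(\<exists>d>0. \<forall>y\<in>UNIV. y \<noteq> x \<and> dist y x < d \<longrightarrow> dist (f y) (f x) < e)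
        = (\<exists>d>0. \<forall>y\<in>UNIV. dist y x < d \<longrightarrow> dist (f y) (f x) < e)"
      if "e > 0" for x e
      by (simp only: key[OF that])
    then show ?thesis
      unfolding continuous_on_def tendsto_iff eventually_at by simp
  qed
  show ?thesis
    unfolding eps_delta
  proof (intro iffI ballI allI impI)
    fix x :: "'p padic_int" and N
    assume c: "\<forall>x\<in>UNIV. \<forall>e>0. \<exists>d>0. \<forall>x'\<in>UNIV. dist x' x < d \<longrightarrow> dist (f x') (f x) < e"
    have "1 / real CARD('p) ^ N > 0"
      using p1 by simp
    then obtain d where d: "d > 0" "\<And>y. dist y x < d \<Longrightarrow> dist (f y) (f x) < 1 / real CARD('p) ^ N"
      using c by blast
    obtain M where M: "1 / real CARD('p) ^ M < d"
      using small d(1) by blast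
    have "padic_p ^ N dvd f y - f x" if "padic_p ^ Suc M dvd y - x" for y
    proof -
      have "padic_p ^ Suc N dvd f y - f x"
        using that d(2) M padic_dist_less_iff[of y x M] padic_dist_less_iff[of "f y" "f x" N] by simp
      then show ?thesis
        by (metis dvd_mult_right power_Suc)
    qed
    then show "\<exists>M. \<forall>y. padic_p ^ M dvd y - x \<longrightarrow> padic_p ^ N dvd f y - f x"
      by blast
  next
    fix x :: "'p padic_int" and e :: real
    assume c: "\<forall>x N. \<exists>M. \<forall>y. padic_p ^ M dvd y - x \<longrightarrow> padic_p ^ N dvd f y - f x" and "e > 0"
    obtain N where N: "1 / real CARD('p) ^ N < e"
      using small \<open>e > 0\<close> by blast
    obtain M where M: "\<And>y. padic_p ^ M dvd y - x \<Longrightarrow> padic_p ^ Suc N dvd f y - f x"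
      using c by blast
    have "dist (f y) (f x) < e" if "dist y x < 1 / real CARD('p) ^ M" for y
    proof -
      have "padic_p ^ M dvd y - x"
        using that padic_dist_less_iff[of y x M] by (metis dvd_mult_right power_Suc)
      then show ?thesis
        using M[of y] N padic_dist_less_iff[of "f y" "f x" N] by simp
    qed
    then show "\<exists>d>0. \<forall>x'\<in>UNIV. dist x' x < d \<longrightarrow> dist (f x') (f x) < e"
      using p1 by (intro exI[of _ "1 / real CARD('p) ^ M"]) simp
  qed
qed

section \<open>Convergent sums of \<open>p\<close>-adic numbers\<close>

lemma padic_of_int_0 [simp]: "padic_of_int 0 = 0"
  and padic_of_int_1 [simp]: "padic_of_int 1 = 1"
  and padic_of_int_add: "padic_of_int (x + y) = padic_of_int x + padic_of_int y"
  and padic_of_int_diff: "padic_of_int (x - y) = padic_of_int x - padic_of_int y"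
  and padic_of_int_minus: "padic_of_int (- x) = - padic_of_int x"
  and padic_of_int_mult: "padic_of_int (x * y) = padic_of_int x * padic_of_int y"
  and padic_of_int_eq_iff [simp]: "padic_of_int x = padic_of_int y \<longleftrightarrow> x = y"
  by (simp_all add: padic_of_int_def Zero_fract_def One_fract_def eq_fract)

lemma padic_of_int_power: "padic_of_int (x ^ n) = padic_of_int x ^ n"
  by (induction n) (simp_all add: padic_of_int_mult)

lemma padic_of_int_sum: "padic_of_int (sum f A) = (\<Sum>i\<in>A. padic_of_int (f i))"
  by (induction A rule: infinite_finite_induct) (simp_all add: padic_of_int_add)

lemma padic_of_int_prod: "padic_of_int (prod f A) = (\<Prod>i\<in>A. padic_of_int (f i))"
  by (induction A rule: infinite_finite_induct) (simp_all add: padic_of_int_mult)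

lemma padic_of_int_of_nat [simp]: "padic_of_int (of_nat n) = of_nat n"
  by (induction n) (simp_all add: padic_of_int_add)

lemma padic_of_int_of_int [simp]: "padic_of_int (of_int k) = of_int k"
  by (cases k) (simp_all add: padic_of_int_minus padic_of_int_diff)

lemma padic_of_int_eq_0_iff [simp]: "padic_of_int x = 0 \<longleftrightarrow> x = 0"
  using padic_of_int_eq_iff[of x 0] by simp

lemma padic_of_int_pochhammer: "padic_of_int (pochhammer x n) = pochhammer (padic_of_int x) n"
  by (simp add: pochhammer_prod padic_of_int_prod padic_of_int_add)

text \<open>Valuation at least \<open>n\<close>, as a predicate, so that 0 needs no separate
  treatment.\<close>

definition vint :: "nat \<Rightarrow> 'p::prime_card padic \<Rightarrow> bool" where
  "vint n x \<longleftrightarrow> (\<exists>y. x = padic_of_int (padic_p ^ n * y))"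

lemma vint_of_int_iff: "vint n (padic_of_int x) \<longleftrightarrow> padic_p ^ n dvd x"
  by (auto simp: vint_def dvd_def)

lemma vint_zero_iff: "vint 0 x \<longleftrightarrow> (\<exists>y. x = padic_of_int y)"
  by (simp add: vint_def)

lemma vint_padic_of_int [simp]: "vint 0 (padic_of_int x)"
  by (auto simp: vint_zero_iff)

lemma vint_0 [simp]: "vint n 0"
  using vint_of_int_iff[of n 0] by simp

lemma vint_1 [simp]: "vint 0 1"
  using vint_padic_of_int[of 1] by simp

lemma vint_of_nat [simp]: "vint 0 (of_nat k)"
  using vint_padic_of_int[of "of_nat k"] by simp

lemma vint_add: "vint n x \<Longrightarrow> vint n y \<Longrightarrow> vint n (x + y)"
  unfolding vint_def by (metis distrib_left padic_of_int_add)

lemma vint_minus: "vint n x \<Longrightarrow> vint n (- x)"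
  unfolding vint_def by (metis mult_minus_right padic_of_int_minus)

lemma vint_diff: "vint n x \<Longrightarrow> vint n y \<Longrightarrow> vint n (x - y)"
  using vint_add[of n x "- y"] vint_minus[of n y] by simp

lemma vint_mult: "vint m x \<Longrightarrow> vint n y \<Longrightarrow> vint (m + n) (x * y)"
proof -
  assume "vint m x" "vint n y"
  then obtain a b where "x = padic_of_int (padic_p ^ m * a)" "y = padic_of_int (padic_p ^ n * b)"
    unfolding vint_def by blast
  then have "x * y = padic_of_int (padic_p ^ (m + n) * (a * b))"
    by (simp add: padic_of_int_mult power_add ac_simps)
  then show ?thesis
    unfolding vint_def by blast
qed

lemma vint_mult_right: "vint 0 c \<Longrightarrow> vint n x \<Longrightarrow> vint n (c * x)"
  using vint_mult[of 0 c n x] by simp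

lemma vint_mult_left: "vint n x \<Longrightarrow> vint 0 c \<Longrightarrow> vint n (x * c)"
  using vint_mult[of n x 0 c] by simp

lemma vint_mono: "vint n x \<Longrightarrow> m \<le> n \<Longrightarrow> vint m x"
  unfolding vint_def by (auto simp: le_iff_add power_add mult.assoc)

lemma vint_sum: "(\<And>i. i \<in> A \<Longrightarrow> vint n (f i)) \<Longrightarrow> vint n (sum f A)"
  by (induction A rule: infinite_finite_induct) (auto intro: vint_add)

lemma vint_power: "vint 0 x \<Longrightarrow> vint 0 (x ^ n)"
  by (induction n) (auto intro: vint_mult_right)

lemma vint_prime_power: "vint n (of_nat CARD('p) ^ n :: 'p::prime_card padic)"
  using vint_of_int_iff[of n "padic_p ^ n :: 'p padic_int"]
  by (simp add: padic_of_int_power)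

lemma vint_eq_0: "(\<And>n. vint n x) \<Longrightarrow> x = 0"
proof -
  assume v: "\<And>n. vint n x"
  from v[of 0] obtain y where x: "x = padic_of_int y"
    unfolding vint_zero_iff by blast
  have "y = 0"
    by (rule padic_int_eqI_dvd) (use v in \<open>simp add: x vint_of_int_iff\<close>)
  then show ?thesis
    by (simp add: x)
qed

lemma vint_eqI: "(\<And>n. vint n (x - y)) \<Longrightarrow> x = y"
  using vint_eq_0[of "x - y"] by simp

lemma vint_inverse_unit:
  assumes "\<not> padic_p dvd x"
  shows "vint 0 (inverse (padic_of_int x))"
proof -
  obtain y where "1 = x * y"
    using assms by (metis dvdE padic_unit_iff)
  then have "padic_of_int x * padic_of_int y = 1"
    by (metis padic_of_int_1 padic_of_int_mult)
  then have "inverse (padic_of_int x) = padic_of_int y"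
    by (rule inverse_unique)
  then show ?thesis
    by simp
qed

lemma vint_divide_of_nat:
  fixes x :: "'p::prime_card padic"
  assumes "vint n x" and "\<not> CARD('p) dvd k"
  shows "vint n (x / of_nat k)"
  using vint_mult_left[OF assms(1) vint_inverse_unit[of "of_nat k"]] assms(2)
  by (simp add: padic_p_dvd_of_nat_iff divide_inverse)

text \<open>Unordered convergence over an arbitrary index set: modulo each \<open>p ^ n\<close> only
  finitely many terms count. Sums over pairs and triples can then be regrouped without an
  enumeration.\<close>

definition has_psum :: "('i \<Rightarrow> 'p::prime_card padic) \<Rightarrow> 'i set \<Rightarrow> 'p padic \<Rightarrow> bool" where
  "has_psum f I s \<longleftrightarrow>
    (\<forall>n. \<exists>F. finite F \<and> F \<subseteq> I \<and> (\<forall>i\<in>I - F. vint n (f i)) \<and> vint n (s - sum f F))"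

lemma has_psumE:
  assumes "has_psum f I s"
  obtains F where "finite F" "F \<subseteq> I" "\<And>i. i \<in> I - F \<Longrightarrow> vint n (f i)" "vint n (s - sum f F)"
proof -
  obtain F where F: "finite F \<and> F \<subseteq> I \<and> (\<forall>i\<in>I - F. vint n (f i)) \<and> vint n (s - sum f F)"
    using spec[OF assms[unfolded has_psum_def], of n] ..
  show thesis
    by (rule that[of F]) (use F in simp_all)
qed

text \<open>By the ultrametric inequality every finite set that contains all terms outside
  \<open>p ^ n\<close> approximates as well as the set supplied by the definition: the two partial
  sums differ only by terms in \<open>p ^ n\<close>.\<close>

lemma has_psum_vint_diff:
  assumes "has_psum f I s" "finite G" "G \<subseteq> I" "\<And>i. i \<in> I - G \<Longrightarrow> vint n (f i)"
  shows "vint n (s - sum f G)"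
proof -
  obtain F where F: "finite F" "F \<subseteq> I" "\<And>i. i \<in> I - F \<Longrightarrow> vint n (f i)" "vint n (s - sum f F)"
    using assms(1) by (rule has_psumE[where n = n]) blast
  have eq: "sum f F - sum f G = sum f (F - G) - sum f (G - F)"
    using sum.Int_Diff[OF F(1), of f G] sum.Int_Diff[OF assms(2), of f F]
    by (simp add: Int_commute)
  have "vint n (sum f F - sum f G)"
    unfolding eq using F(2,3) assms(3,4) by (intro vint_diff vint_sum) auto
  then have "vint n ((s - sum f F) + (sum f F - sum f G))"
    by (rule vint_add[OF F(4)])
  then show ?thesis
    by simp
qed

lemma has_psum_unique:
  assumes "has_psum f I s" "has_psum f I t"
  shows "s = t"
proof (rule vint_eqI)
  fix n
  obtain F where F: "finite F" "F \<subseteq> I" "\<And>i. i \<in> I - F \<Longrightarrow> vint n (f i)" "vint n (s - sum f F)"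
    using assms(1) by (rule has_psumE[where n = n]) blast
  have "vint n (t - sum f F)"
    using has_psum_vint_diff[OF assms(2) F(1-3)] .
  then have "vint n ((s - sum f F) - (t - sum f F))"
    by (rule vint_diff[OF F(4)])
  then show "vint n (s - t)"
    by simp
qed

text \<open>In a nonarchimedean setting terms tending to 0 are enough. Integrality places the
  partial sums in the ring of integers, where \<open>padic_complete\<close> applies.\<close>

lemma has_psum_exists:
  assumes int: "\<And>i. i \<in> I \<Longrightarrow> vint 0 (f i)" and null: "\<And>n. finite {i \<in> I. \<not> vint n (f i)}"
  shows "\<exists>s. has_psum f I s"
proof -
  define F where "F n = {i \<in> I. \<not> vint n (f i)}" for n
  have "\<exists>t. padic_of_int t = sum f (F n)" for n
  proof -
    have "vint 0 (sum f (F n))"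
      by (rule vint_sum) (simp add: F_def int)
    then show ?thesis
      unfolding vint_zero_iff by metis
  qed
  then obtain t where t: "padic_of_int (t n) = sum f (F n)" for n
    by metis
  have "padic_p ^ n dvd t (Suc n) - t n" for n
  proof -
    have sub: "F n \<subseteq> F (Suc n)"
    proof
      fix i
      assume "i \<in> F n"
      then show "i \<in> F (Suc n)"
        unfolding F_def using vint_mono[of "Suc n" "f i" n] by auto
    qed
    have "sum f (F (Suc n)) - sum f (F n) = sum f (F (Suc n) - F n)"
      by (rule sum_diff[symmetric]) (use sub null in \<open>simp_all add: F_def\<close>)
    also have "vint n \<dots>"
      by (intro vint_sum) (auto simp: F_def)
    finally have "vint n (padic_of_int (t (Suc n) - t n))"
      unfolding padic_of_int_diff t .
    then show ?thesis
      unfolding vint_of_int_iff .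
  qed
  then obtain x where x: "\<And>n. padic_p ^ n dvd x - t n"
    using padic_complete by blast
  have "has_psum f I (padic_of_int x)"
    unfolding has_psum_def
  proof
    fix n
    have "vint n (padic_of_int (x - t n))"
      unfolding vint_of_int_iff by (rule x)
    then have "vint n (padic_of_int x - sum f (F n))"
      unfolding padic_of_int_diff t .
    moreover have "finite (F n)"
      unfolding F_def by (rule null)
    moreover have "F n \<subseteq> I" "\<forall>i\<in>I - F n. vint n (f i)"
      unfolding F_def by blast+
    ultimately show "\<exists>F. finite F \<and> F \<subseteq> I \<and> (\<forall>i\<in>I - F. vint n (f i)) \<and> vint n (padic_of_int x - sum f F)"
      by (intro exI[of _ "F n"] conjI)
  qed
  then show ?thesis ..
qed

lemma has_psum_cong:
  assumes "\<And>i. i \<in> I \<Longrightarrow> f i = g i"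
  shows "has_psum f I s \<longleftrightarrow> has_psum g I s"
proof -
  have "finite F \<and> F \<subseteq> I \<and> (\<forall>i\<in>I - F. vint n (f i)) \<and> vint n (s - sum f F) \<longleftrightarrow>
      finite F \<and> F \<subseteq> I \<and> (\<forall>i\<in>I - F. vint n (g i)) \<and> vint n (s - sum g F)" for F n
  proof (cases "F \<subseteq> I")
    case True
    then have "sum f F = sum g F"
      using assms by (intro sum.cong) auto
    then show ?thesis
      using assms by simp
  qed simp
  then show ?thesis
    unfolding has_psum_def by simp
qed

lemma has_psum_finite: "finite I \<Longrightarrow> has_psum f I (sum f I)"
  unfolding has_psum_def by (intro allI exI[of _ I]) simp

lemma has_psum_vint:
  assumes "has_psum f I s" "\<And>i. i \<in> I \<Longrightarrow> vint n (f i)"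
  shows "vint n s"
  using has_psum_vint_diff[OF assms(1), of "{}" n] assms(2) by simp

lemma has_psum_add:
  assumes "has_psum f I s" "has_psum g I t"
  shows "has_psum (\<lambda>i. f i + g i) I (s + t)"
  unfolding has_psum_def
proof
  fix n
  obtain F where F: "finite F" "F \<subseteq> I" "\<And>i. i \<in> I - F \<Longrightarrow> vint n (f i)"
    using assms(1) by (rule has_psumE[where n = n]) blast
  obtain G where G: "finite G" "G \<subseteq> I" "\<And>i. i \<in> I - G \<Longrightarrow> vint n (g i)"
    using assms(2) by (rule has_psumE[where n = n]) blast
  have "vint n (s - sum f (F \<union> G))" "vint n (t - sum g (F \<union> G))"
    by (rule has_psum_vint_diff[OF assms(1)] has_psum_vint_diff[OF assms(2)]; use F G in auto)+
  then have "vint n ((s - sum f (F \<union> G)) + (t - sum g (F \<union> G)))"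
    by (rule vint_add)
  then have "vint n (s + t - (\<Sum>i\<in>F \<union> G. f i + g i))"
    by (simp add: sum.distrib algebra_simps)
  then show "\<exists>F. finite F \<and> F \<subseteq> I \<and> (\<forall>i\<in>I - F. vint n (f i + g i)) \<and>
      vint n (s + t - (\<Sum>i\<in>F. f i + g i))"
    using F G by (intro exI[of _ "F \<union> G"]) (auto intro: vint_add)
qed

lemma has_psum_cmult:
  assumes "has_psum f I s" "vint 0 c"
  shows "has_psum (\<lambda>i. c * f i) I (c * s)"
  unfolding has_psum_def
proof
  fix n
  obtain F where F: "finite F" "F \<subseteq> I" "\<And>i. i \<in> I - F \<Longrightarrow> vint n (f i)" "vint n (s - sum f F)"
    using assms(1) by (rule has_psumE[where n = n]) blast
  have "vint n (c * (s - sum f F))"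
    by (rule vint_mult_right[OF assms(2) F(4)])
  then have "vint n (c * s - (\<Sum>i\<in>F. c * f i))"
    by (simp add: right_diff_distrib sum_distrib_left)
  then show "\<exists>F. finite F \<and> F \<subseteq> I \<and> (\<forall>i\<in>I - F. vint n (c * f i)) \<and> vint n (c * s - (\<Sum>i\<in>F. c * f i))"
    using F assms(2) by (intro exI[of _ F]) (auto intro: vint_mult_right)
qed

lemma has_psum_diff:
  fixes f g :: "'i \<Rightarrow> 'p::prime_card padic"
  assumes "has_psum f I s" "has_psum g I t"
  shows "has_psum (\<lambda>i. f i - g i) I (s - t)"
proof -
  have "vint 0 (- 1 :: 'p padic)"
    using vint_minus[OF vint_1] .
  then have "has_psum (\<lambda>i. f i + - 1 * g i) I (s + - 1 * t)"
    by (intro has_psum_add has_psum_cmult assms)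
  then show ?thesis
    by simp
qed

lemma has_psum_sum:
  assumes "\<And>k. k \<in> K \<Longrightarrow> has_psum (f k) I (s k)"
  shows "has_psum (\<lambda>i. \<Sum>k\<in>K. f k i) I (\<Sum>k\<in>K. s k)"
  using assms
proof (induction K rule: infinite_finite_induct)
  case (insert k K)
  then show ?case
    by (simp add: has_psum_add)
qed (auto simp: has_psum_def intro!: exI[of _ "{}"])

section \<open>Reindexing, double sums and products\<close>

lemma has_psum_reindexI:
  assumes s: "has_psum (\<lambda>j. f (h j)) J s" and h: "bij_betw h J I"
  shows "has_psum f I s"
  unfolding has_psum_def
proof
  fix n
  obtain F where F: "finite F" "F \<subseteq> J" "\<And>j. j \<in> J - F \<Longrightarrow> vint n (f (h j))"
    "vint n (s - (\<Sum>j\<in>F. f (h j)))"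
    using s by (rule has_psumE[where n = n]) blast
  have "inj_on h F"
    using h F(2) by (meson bij_betw_def inj_on_subset)
  then have "vint n (s - sum f (h ` F))"
    using F(4) by (simp add: sum.reindex)
  moreover have "vint n (f i)" if "i \<in> I - h ` F" for i
    using that F(3) h unfolding bij_betw_def by blast
  moreover have "h ` F \<subseteq> I"
    using F(2) h unfolding bij_betw_def by blast
  ultimately show "\<exists>F. finite F \<and> F \<subseteq> I \<and> (\<forall>i\<in>I - F. vint n (f i)) \<and> vint n (s - sum f F)"
    using F(1) by blast
qed

lemma has_psum_reindex:
  assumes "bij_betw h J I"
  shows "has_psum (\<lambda>j. f (h j)) J s \<longleftrightarrow> has_psum f I s"
proof
  assume "has_psum f I s"
  then have "has_psum (\<lambda>i. f (h (the_inv_into J h i))) I s"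
    by (rule has_psum_cong[THEN iffD1, rotated]) (use assms in \<open>simp add: f_the_inv_into_f_bij_betw\<close>)
  then show "has_psum (\<lambda>j. f (h j)) J s"
    by (rule has_psum_reindexI[where f = "\<lambda>j. f (h j)"]) (rule bij_betw_the_inv_into[OF assms])
qed (rule has_psum_reindexI[OF _ assms])

lemma has_psum_neutral:
  assumes "I \<subseteq> J" "\<And>j. j \<in> J - I \<Longrightarrow> f j = 0"
  shows "has_psum f I s \<longleftrightarrow> has_psum f J s"
proof
  assume s: "has_psum f I s"
  show "has_psum f J s"
    unfolding has_psum_def
  proof
    fix n
    obtain F where F: "finite F" "F \<subseteq> I" "\<And>i. i \<in> I - F \<Longrightarrow> vint n (f i)" "vint n (s - sum f F)"
      using s by (rule has_psumE[where n = n]) blast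
    have "vint n (f j)" if "j \<in> J - F" for j
      using that F(3) assms(2) by (cases "j \<in> I") auto
    then show "\<exists>F. finite F \<and> F \<subseteq> J \<and> (\<forall>i\<in>J - F. vint n (f i)) \<and> vint n (s - sum f F)"
      using F assms(1) by blast
  qed
next
  assume s: "has_psum f J s"
  show "has_psum f I s"
    unfolding has_psum_def
  proof
    fix n
    obtain F where F: "finite F" "F \<subseteq> J" "\<And>j. j \<in> J - F \<Longrightarrow> vint n (f j)" "vint n (s - sum f F)"
      using s by (rule has_psumE[where n = n]) blast
    have "sum f F = sum f (F \<inter> I)"
      using F(1,2) assms(2) by (intro sum.mono_neutral_right) auto
    then show "\<exists>F. finite F \<and> F \<subseteq> I \<and> (\<forall>i\<in>I - F. vint n (f i)) \<and> vint n (s - sum f F)"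
      using F assms(1) by (intro exI[of _ "F \<inter> I"]) auto
  qed
qed

text \<open>The half of Fubini that passes from a joint sum to an iterated one. An interchange of
  summations is obtained by fibring the same joint sum in two ways, its existence coming from
  \<open>has_psum_exists\<close>.\<close>

lemma has_psum_SigmaD:
  assumes s: "has_psum (\<lambda>(i, j). f i j) (Sigma I J) s"
    and g: "\<And>i. i \<in> I \<Longrightarrow> has_psum (f i) (J i) (g i)"
  shows "has_psum g I s"
  unfolding has_psum_def
proof
  fix n
  obtain F where F: "finite F" "F \<subseteq> Sigma I J"
    "\<And>q. q \<in> Sigma I J - F \<Longrightarrow> vint n ((\<lambda>(i, j). f i j) q)"
    "vint n (s - (\<Sum>(i, j)\<in>F. f i j))"
    using s by (rule has_psumE[where n = n]) blast
  let ?G = "fst ` F"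
  let ?S = "\<lambda>i. {j. (i, j) \<in> F}"
  have fin: "finite (?S i)" for i
    by (rule finite_subset[of _ "snd ` F"]) (use F(1) in force)+
  have F_eq: "F = Sigma ?G ?S"
    by force
  have "(\<Sum>(i, j)\<in>F. f i j) = (\<Sum>i\<in>?G. \<Sum>j\<in>?S i. f i j)"
    by (subst F_eq, subst sum.Sigma) (use F(1) fin in auto)
  moreover have d: "vint n (g i - (\<Sum>j\<in>?S i. f i j))" if "i \<in> I" for i
    by (rule has_psum_vint_diff[OF g[OF that] fin]) (use F(2,3) that in auto)
  then have "vint n (\<Sum>i\<in>?G. g i - (\<Sum>j\<in>?S i. f i j))"
    using F(2) by (intro vint_sum) auto
  then have "vint n ((s - (\<Sum>(i, j)\<in>F. f i j)) - (\<Sum>i\<in>?G. g i - (\<Sum>j\<in>?S i. f i j)))"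
    using F(4) by (rule vint_diff[rotated])
  ultimately have "vint n (s - sum g ?G)"
    by (simp add: sum_subtractf)
  moreover have "vint n (g i)" if "i \<in> I - ?G" for i
  proof -
    have "?S i = {}"
      using that by (auto simp: image_iff)
    then show ?thesis
      using d[of i] that by simp
  qed
  moreover have "?G \<subseteq> I"
    using F(2) by auto
  ultimately show "\<exists>F. finite F \<and> F \<subseteq> I \<and> (\<forall>i\<in>I - F. vint n (g i)) \<and> vint n (s - sum g F)"
    using F(1) by blast
qed

lemma has_psum_mult:
  assumes "has_psum f I s" "has_psum g J t"
    and f: "\<And>i. i \<in> I \<Longrightarrow> vint 0 (f i)" and g: "\<And>j. j \<in> J \<Longrightarrow> vint 0 (g j)"
  shows "has_psum (\<lambda>(i, j). f i * g j) (I \<times> J) (s * t)"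
  unfolding has_psum_def
proof
  fix n
  obtain F where F: "finite F" "F \<subseteq> I" "\<And>i. i \<in> I - F \<Longrightarrow> vint n (f i)" "vint n (s - sum f F)"
    using assms(1) by (rule has_psumE[where n = n]) blast
  obtain G where G: "finite G" "G \<subseteq> J" "\<And>i. i \<in> J - G \<Longrightarrow> vint n (g i)" "vint n (t - sum g G)"
    using assms(2) by (rule has_psumE[where n = n]) blast
  have "vint 0 s"
    using assms(1) f by (rule has_psum_vint)
  moreover have "vint 0 (sum g G)"
    using G(2) g by (intro vint_sum) auto
  ultimately have "vint n (s * (t - sum g G) + (s - sum f F) * sum g G)"
    using F(4) G(4) by (intro vint_add vint_mult_left vint_mult_right)
  then have "vint n (s * t - (\<Sum>(i, j)\<in>F \<times> G. f i * g j))"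
    by (simp add: sum_product sum.cartesian_product[symmetric] algebra_simps)
  moreover have "vint n ((\<lambda>(i, j). f i * g j) q)" if "q \<in> I \<times> J - F \<times> G" for q
    using that F(3) G(3) f g by (auto intro: vint_mult_left vint_mult_right)
  ultimately show "\<exists>H. finite H \<and> H \<subseteq> I \<times> J \<and> (\<forall>q\<in>I \<times> J - H. vint n ((\<lambda>(i, j). f i * g j) q)) \<and>
      vint n (s * t - (\<Sum>(i, j)\<in>H. f i * g j))"
    using F(1,2) G(1,2) by (intro exI[of _ "F \<times> G"]) auto
qed

text \<open>Dwork's series gain one factor \<open>p\<close> only every few terms; the divisor
  \<open>d\<close>, later 4, records this rate for terms and remainders alike.\<close>

lemma has_psum_natI:
  assumes "d > 0" "\<And>i. vint (i div d) (f i)" "\<And>n. vint (n div d) (s - sum f {..<n})"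
  shows "has_psum f UNIV s"
  unfolding has_psum_def
proof
  fix n
  have "vint n (f i)" if "i \<in> UNIV - {..<d * n}" for i
    using vint_mono[OF assms(2), of n i] that assms(1) by (simp add: less_eq_div_iff_mult_less_eq mult.commute)
  moreover have "vint n (s - sum f {..<d * n})"
    using assms(3)[of "d * n"] assms(1) by simp
  ultimately show "\<exists>F. finite F \<and> F \<subseteq> UNIV \<and> (\<forall>i\<in>UNIV - F. vint n (f i)) \<and> vint n (s - sum f F)"
    by (intro exI[of _ "{..<d * n}"]) simp
qed

lemma has_psum_natD:
  assumes "has_psum f UNIV s" "\<And>i. vint (i div d) (f i)"
  shows "vint (n div d) (s - sum f {..<n})"
  by (rule has_psum_vint_diff[OF assms(1)])
    (auto intro: vint_mono[OF assms(2)] simp: div_le_mono)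

lemma has_psum_nat_exists:
  assumes "d > 0" "\<And>i. vint (i div d) (f i)"
  shows "\<exists>s. has_psum f UNIV s"
proof (rule has_psum_exists)
  show "vint 0 (f i)" for i
    using vint_mono[OF assms(2)] by blast
  show "finite {i \<in> UNIV. \<not> vint n (f i)}" for n
  proof (rule finite_subset[of _ "{..<d * n}"])
    show "{i \<in> UNIV. \<not> vint n (f i)} \<subseteq> {..<d * n}"
    proof
      fix i
      assume "i \<in> {i \<in> UNIV. \<not> vint n (f i)}"
      then have "\<not> n \<le> i div d"
        using vint_mono[OF assms(2)] by blast
      then show "i \<in> {..<d * n}"
        using assms(1) by (simp add: less_eq_div_iff_mult_less_eq mult.commute)
    qed
  qed simp
qed

unbundle fps_syntax

section \<open>The coefficients of \<open>exp (z + z\<^sup>p / p)\<close>\<close>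

text \<open>
  The number of permutations \<open>\<sigma>\<close> of \<open>n\<close> points with \<open>\<sigma> ^ p = 1\<close>, that is, \<open>n!\<close> times the coefficient of \<open>z ^ n\<close>
  in \<open>exp (z + z\<^sup>p / p)\<close>. Its divisibility by powers of \<open>p\<close> bounds the denominators of these coefficients.
\<close>

fun torsion_count :: "nat \<Rightarrow> nat \<Rightarrow> nat" where
  "torsion_count p 0 = 1"
| "torsion_count p (Suc n) = torsion_count p n +
     (if 0 < p \<and> p \<le> Suc n then (\<Prod>k\<in>{Suc (Suc n - p)..n}. k) * torsion_count p (Suc n - p) else 0)"

declare torsion_count.simps(2) [simp del]

lemma torsion_count_rec:
  assumes "0 < p" "p \<le> n"
  shows "torsion_count p n =
    torsion_count p (n - 1) + (\<Prod>k\<in>{Suc (n - p)..n - 1}. k) * torsion_count p (n - p)"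
  using assms by (cases n) (auto simp: torsion_count.simps(2))

lemma torsion_count_small: "n < p \<Longrightarrow> torsion_count p n = 1"
  by (induction n) (auto simp: torsion_count.simps(2))

lemma prime_dvd_prod_window:
  fixes p n :: nat
  assumes "prime p" "p \<le> n" "\<not> p dvd n"
  shows "p dvd (\<Prod>k\<in>{Suc (n - p)..n - 1}. k)"
proof -
  have "n div p * p \<in> {Suc (n - p)..n - 1}"
  proof -
    have "n mod p < p"
      using prime_gt_0_nat[OF assms(1)] by simp
    moreover have "n mod p \<noteq> 0"
      using assms(3) by (simp add: mod_eq_0_iff_dvd)
    moreover have "n = n div p * p + n mod p"
      by simp
    ultimately have "Suc (n - p) \<le> n div p * p" "n div p * p \<le> n - 1"
      using assms(2) by linarith+
    then show ?thesis
      by simp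
  qed
  then have "n div p * p dvd (\<Prod>k\<in>{Suc (n - p)..n - 1}. k)"
    by (intro dvd_prod_eqI[of _ "n div p * p"]) auto
  then show ?thesis
    using dvd_mult_right by blast
qed

lemma prod_window_cong:
  fixes p l :: nat
  assumes "prime p"
  shows "[int (\<Prod>k\<in>{Suc (l * p)..l * p + (p - 1)}. k) = - 1] (mod int p)"
proof -
  have "(\<Prod>k\<in>{Suc (l * p)..l * p + (p - 1)}. k) = (\<Prod>k\<in>{1..p - 1}. k + l * p)"
    by (intro prod.reindex_bij_witness[of _ "\<lambda>k. k + l * p" "\<lambda>k. k - l * p"]) auto
  also have "[\<dots> = (\<Prod>k\<in>{1..p - 1}. k)] (mod p)"
    by (intro cong_prod) (simp add: cong_def)
  finally have "[(\<Prod>k\<in>{Suc (l * p)..l * p + (p - 1)}. k) = fact (p - 1)] (mod p)"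
    by (simp add: fact_prod)
  then have "[int (\<Prod>k\<in>{Suc (l * p)..l * p + (p - 1)}. k) = int (fact (p - 1))] (mod int p)"
    by (simp only: cong_int_iff)
  also have "[int (fact (p - 1)) = - 1] (mod int p)"
    using wilson_theorem[OF assms] by simp
  finally show ?thesis .
qed

text \<open>Inside the block of indices from \<open>l * p\<close> to \<open>l * p + p - 1\<close>
  each step of the recurrence adds a product of \<open>p - 1\<close> consecutive numbers that is
  divisible by \<open>p\<close>, times a value from the preceding block. So the value is constant
  along the block to the precision required in the next block.\<close>

lemma power_torsion_count_block:
  fixes p :: nat
  assumes p: "prime p" and IH: "\<And>m. m < Suc l * p \<Longrightarrow> p ^ ((m div p + 1) div 2) dvd torsion_count p m"
    and "a < p"
  shows "int p ^ ((l + 2) div 2) dvd int (torsion_count p (l * p + a)) - int (torsion_count p (l * p))"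
  using \<open>a < p\<close>
proof (induction a)
  case (Suc a)
  have p0: "0 < p"
    using p prime_gt_0_nat by blast
  show ?case
  proof (cases l)
    case 0
    then show ?thesis
      using Suc.prems torsion_count_small[of "Suc a" p] by simp
  next
    case (Suc l')
    let ?n = "l * p + Suc a"
    let ?P = "\<Prod>k\<in>{Suc (?n - p)..?n - 1}. k"
    have "\<not> p dvd ?n"
      using Suc.prems dvd_add_right_iff[of p "l * p" "Suc a"] by (auto dest: dvd_imp_le)
    then have 1: "p dvd ?P"
      using Suc by (intro prime_dvd_prod_window p) auto
    have np: "?n - p = l' * p + Suc a"
      using Suc by simp
    have "(?n - p) div p = l'"
      unfolding np using Suc.prems p0 div_mult_self3[of p l' "Suc a"] by simp
    moreover have "?n - p < Suc l * p"
      unfolding np using Suc.prems Suc by simp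
    ultimately have 2: "p ^ ((l' + 1) div 2) dvd torsion_count p (?n - p)"
      using IH[of "?n - p"] by simp
    have "p ^ Suc ((l' + 1) div 2) dvd ?P * torsion_count p (?n - p)"
      using mult_dvd_mono[OF 1 2] by simp
    moreover have "Suc ((l' + 1) div 2) = (l + 2) div 2"
      using Suc by simp
    ultimately have "int p ^ ((l + 2) div 2) dvd int (?P * torsion_count p (?n - p))"
      by (simp only: of_nat_dvd_iff flip: of_nat_power)
    moreover have "torsion_count p ?n = torsion_count p (l * p + a) + ?P * torsion_count p (?n - p)"
      using torsion_count_rec[of p ?n] p0 Suc by simp
    then have "int (torsion_count p ?n) - int (torsion_count p (l * p))
        = int (torsion_count p (l * p + a)) - int (torsion_count p (l * p)) + int (?P * torsion_count p (?n - p))"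
      by linarith
    ultimately show ?thesis
      using Suc.IH Suc.prems by (simp only: dvd_add Suc_lessD)
  qed
qed simp

text \<open>
  The case of \<open>n\<close> divisible by \<open>p\<close> uses Wilson's theorem: the recurrence multiplies
  \<open>torsion_count p (n - p)\<close> by \<open>1 + (p - 1)!\<close> modulo \<open>p\<close>.
\<close>

lemma power_dvd_torsion_count:
  fixes p n :: nat
  assumes p: "prime p"
  shows "p ^ ((n div p + 1) div 2) dvd torsion_count p n"
proof (induction n rule: less_induct)
  case (less n)
  have p0: "0 < p"
    using p prime_gt_0_nat by blast
  let ?P = "\<Prod>k\<in>{Suc (n - p)..n - 1}. k"
  consider "n < p" | "p \<le> n" "\<not> p dvd n" | "p \<le> n" "p dvd n"
    by linarith
  then show ?case
  proof cases
    case 1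
    then show ?thesis by simp
  next
    case 2
    have n0: "0 < n"
      using 2 p0 by simp
    have "(n - 1) div p = n div p"
      using 2(2) n0 div_Suc[of "n - 1" p] by (auto split: if_splits simp: dvd_eq_mod_eq_0)
    then have a: "p ^ ((n div p + 1) div 2) dvd torsion_count p (n - 1)"
      using less[of "n - 1"] n0 by simp
    have "p * p ^ (((n - p) div p + 1) div 2) dvd ?P * torsion_count p (n - p)"
      using 2 n0 p0 by (intro mult_dvd_mono prime_dvd_prod_window p less) auto
    then have "p ^ Suc (((n - p) div p + 1) div 2) dvd ?P * torsion_count p (n - p)"
      by simp
    moreover have "(n div p + 1) div 2 \<le> Suc (((n - p) div p + 1) div 2)"
      using le_div_geq[OF p0 2(1)] by simp
    ultimately have b: "p ^ ((n div p + 1) div 2) dvd ?P * torsion_count p (n - p)"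
      by (rule power_le_dvd)
    show ?thesis
      unfolding torsion_count_rec[OF p0 2(1)] using a b by (rule dvd_add)
  next
    case 3
    then obtain m where m: "n = m * p"
      by (metis dvdE mult.commute)
    with 3(1) p0 obtain l where l: "m = Suc l"
      by (cases m) auto
    have n1: "n - 1 = l * p + (p - 1)" and np: "n - p = l * p"
      using p0 by (simp_all add: m l)
    let ?q = "int p ^ ((l + 2) div 2)"
    have A: "?q dvd int (torsion_count p (n - 1)) - int (torsion_count p (l * p))"
      unfolding n1 using p0 less by (intro power_torsion_count_block p) (simp_all add: m l)
    have "int p dvd 1 + int ?P"
      using prod_window_cong[OF p, of l] by (simp only: np n1 cong_iff_dvd_diff) (simp add: add.commute)
    moreover have "p ^ ((l + 1) div 2) dvd torsion_count p (l * p)"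
      using less[of "l * p"] p0 by (simp add: m l)
    then have "int p ^ ((l + 1) div 2) dvd int (torsion_count p (l * p))"
      by (simp only: of_nat_dvd_iff flip: of_nat_power)
    ultimately have "int p ^ Suc ((l + 1) div 2) dvd (1 + int ?P) * int (torsion_count p (l * p))"
      unfolding power_Suc by (rule mult_dvd_mono)
    moreover have "(l + 2) div 2 \<le> Suc ((l + 1) div 2)"
      by simp
    ultimately have B: "?q dvd (1 + int ?P) * int (torsion_count p (l * p))"
      by (rule power_le_dvd)
    have "int (torsion_count p n) = int (torsion_count p (n - 1)) - int (torsion_count p (l * p))
        + (1 + int ?P) * int (torsion_count p (l * p))"
      unfolding torsion_count_rec[OF p0 3(1)] np by (simp add: algebra_simps)
    then have "?q dvd int (torsion_count p n)"
      using dvd_add[OF A B] by simp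
    then have "p ^ ((l + 2) div 2) dvd torsion_count p n"
      by (simp only: of_nat_dvd_iff flip: of_nat_power)
    moreover have "n div p + 1 = l + 2"
      using p0 by (simp add: m l)
    ultimately show ?thesis
      by simp
  qed
qed

section \<open>Powers of \<open>p\<close> in factorials\<close>

lemma fact_eq_prime_power_mult:
  fixes p n :: nat
  assumes "prime p"
  obtains u where "\<not> p dvd u" "fact n = p ^ (n div p) * fact (n div p) * u"
proof -
  have "\<exists>u. \<not> p dvd u \<and> fact n = p ^ (n div p) * fact (n div p) * u"
  proof (induction n)
    case 0
    have "\<not> p dvd 1"
      using assms not_prime_unit by blast
    then show ?case
      by (intro exI[of _ 1]) simp
  next
    case (Suc n)
    then obtain u where u: "\<not> p dvd u" "fact n = p ^ (n div p) * fact (n div p) * u"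
      by blast
    show ?case
    proof (cases "p dvd Suc n")
      case True
      then have d: "Suc n div p = Suc (n div p)"
        by (simp add: div_Suc dvd_eq_mod_eq_0)
      have e: "Suc n = p * Suc (n div p)"
        using dvd_mult_div_cancel[OF True] unfolding d by simp
      have "fact (Suc n) = p * Suc (n div p) * (p ^ (n div p) * fact (n div p) * u)"
        unfolding fact_Suc u(2) e[symmetric] by simp
      then have "fact (Suc n) = p ^ (Suc n div p) * fact (Suc n div p) * u"
        unfolding d by (simp add: algebra_simps)
      then show ?thesis
        using u(1) by blast
    next
      case False
      then have d: "Suc n div p = n div p"
        by (simp add: div_Suc dvd_eq_mod_eq_0)
      have "fact (Suc n) = p ^ (Suc n div p) * fact (Suc n div p) * (Suc n * u)"
        unfolding d using u(2) by (simp add: algebra_simps)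
      moreover have "\<not> p dvd Suc n * u"
        using u(1) False prime_dvd_mult_iff[OF assms] by blast
      ultimately show ?thesis
        by blast
    qed
  qed
  then show thesis
    using that by blast
qed

text \<open>Legendre's bound n / (p - 1) for the exponent of \<open>p\<close> in n!, weakened to n /
  4. The induction uses that the exponent for \<open>n\<close> is \<open>n div p\<close> plus the
  exponent for \<open>n div p\<close>, and 5 * (n div p) \<le> n.\<close>

lemma fact_eq_small_prime_power_mult:
  fixes p n :: nat
  assumes "prime p" "5 \<le> p"
  obtains u e where "\<not> p dvd u" "4 * e \<le> n" "fact n = p ^ e * u"
proof -
  have "\<exists>u e. \<not> p dvd u \<and> 4 * e \<le> n \<and> fact n = p ^ e * u"
  proof (induction n rule: less_induct)
    case (less n)
    show ?case
    proof (cases "n = 0")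
      case True
      have "\<not> p dvd 1"
        using assms not_prime_unit by blast
      then show ?thesis
        using True by (intro exI[of _ 1] exI[of _ 0]) simp
    next
      case False
      then have "n div p < n"
        using assms(2) by simp
      then obtain u e where u: "\<not> p dvd u" "4 * e \<le> n div p" "fact (n div p) = p ^ e * u"
        using less by blast
      obtain w where w: "\<not> p dvd w" "fact n = p ^ (n div p) * fact (n div p) * w"
        using fact_eq_prime_power_mult[OF assms(1)] by blast
      have "n div p * 5 \<le> n div p * p"
        using assms(2) by simp
      also have "\<dots> \<le> n"
        by (rule div_times_less_eq_dividend)
      finally have "4 * (n div p + e) \<le> n"
        using u(2) by simp
      moreover have "fact n = p ^ (n div p + e) * (u * w)"
        unfolding w(2) u(3) by (simp add: power_add)
      moreover have "\<not> p dvd u * w"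
        using u(1) w(1) prime_dvd_mult_iff[OF assms(1)] by blast
      ultimately show ?thesis
        by blast
    qed
  qed
  then show thesis
    using that by blast
qed

section \<open>The series exp (c (z + z^p / p)) and the size of its coefficients\<close>

definition dwork_fps :: "'p::prime_card padic \<Rightarrow> 'p padic fps" where
  "dwork_fps c = fps_exp c * (fps_exp (c / of_nat CARD('p)) oo fps_X ^ CARD('p))"

text \<open>For c = 1 and z = \<pi> x with \<pi>^(p - 1) = -p the series is exp (\<pi> (x - x^p)),
  Dwork's splitting function for the additive character. Multiplicativity in the parameter
  \<open>c\<close> is the substitute for the additivity of that character.\<close>

lemma dwork_fps_add:
  fixes c d :: "'p::prime_card padic"
  shows "dwork_fps (c + d) = dwork_fps c * dwork_fps d"
proof -
  have "(fps_X ^ CARD('p) :: 'p padic fps) $ 0 = 0"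
    by simp
  then show ?thesis
    by (simp add: dwork_fps_def fps_exp_add_mult add_divide_distrib fps_compose_mult_distrib ac_simps)
qed

lemma dwork_fps_0 [simp]: "dwork_fps 0 = 1"
  by (simp add: dwork_fps_def)

lemma dwork_fps_nth_0 [simp]: "dwork_fps c $ 0 = 1"
  by (simp add: dwork_fps_def)

lemma fps_nth_compose_X_power:
  assumes "0 < k"
  shows "(f oo fps_X ^ k) $ n = (if k dvd n then f $ (n div k) else 0)"
proof -
  have "(f oo fps_X ^ k) $ n = (\<Sum>i\<in>{0..n}. if n = k * i then f $ i else 0)"
    unfolding fps_compose_nth power_mult[symmetric] fps_X_power_nth by (intro sum.cong) auto
  also have "\<dots> = (\<Sum>i\<in>{0..n}. if i = n div k \<and> k dvd n then f $ i else 0)"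
    using assms by (intro sum.cong) auto
  also have "\<dots> = (if k dvd n then f $ (n div k) else 0)"
    by (cases "k dvd n") simp_all
  finally show ?thesis .
qed

lemma dwork_fps_nth:
  fixes c :: "'p::prime_card padic"
  shows "dwork_fps c $ n = (\<Sum>j\<le>n div CARD('p).
    c ^ (n - CARD('p) * j) / fact (n - CARD('p) * j) * ((c / of_nat CARD('p)) ^ j / fact j))"
proof -
  let ?p = "CARD('p)"
  have "dwork_fps c $ n = (\<Sum>i\<le>n. c ^ (n - i) / fact (n - i) *
      (if ?p dvd i then (c / of_nat ?p) ^ (i div ?p) / fact (i div ?p) else 0))"
    unfolding dwork_fps_def mult.commute[of "fps_exp c"] fps_mult_nth
    by (simp add: fps_nth_compose_X_power atLeast0AtMost mult.commute cong: if_cong)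
  also have "\<dots> = (\<Sum>i | i \<le> n \<and> ?p dvd i. c ^ (n - i) / fact (n - i) *
      ((c / of_nat ?p) ^ (i div ?p) / fact (i div ?p)))"
    by (rule sum.mono_neutral_cong_right) auto
  also have "\<dots> = (\<Sum>j\<le>n div ?p.
      c ^ (n - ?p * j) / fact (n - ?p * j) * ((c / of_nat ?p) ^ j / fact j))"
    by (rule sum.reindex_bij_witness[of _ "\<lambda>j. ?p * j" "\<lambda>i. i div ?p"])
      (auto simp: div_le_mono less_eq_div_iff_mult_less_eq mult.commute)
  finally show ?thesis .
qed

text \<open>The coefficients of the differential equation F' = c (1 + z^(p - 1)) F. This recurrence
  is the source of the functional equation of the gamma function and of the commutation rule in the
  trace formula.\<close>

lemma dwork_fps_rec:
  fixes c :: "'p::prime_card padic"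
  shows "of_nat (Suc n) * dwork_fps c $ Suc n =
    c * (dwork_fps c $ n + (if CARD('p) \<le> Suc n then dwork_fps c $ (Suc n - CARD('p)) else 0))"
proof -
  let ?p = "CARD('p)"
  have X0: "(fps_X ^ ?p :: 'p padic fps) $ 0 = 0"
    by simp
  obtain q where q: "?p = Suc q"
    by (rule CARD_eq_SucE)
  have "fps_deriv (fps_exp (c / of_nat ?p) oo fps_X ^ ?p)
      = (fps_const (c / of_nat ?p) * fps_exp (c / of_nat ?p) oo fps_X ^ ?p) * fps_deriv (fps_X ^ ?p)"
    by (simp add: fps_compose_deriv[OF X0])
  also have "\<dots> = fps_const (c / of_nat ?p) * (fps_exp (c / of_nat ?p) oo fps_X ^ ?p) *
      (fps_const (of_nat ?p) * fps_X ^ (?p - 1))"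
    by (simp add: fps_compose_mult_distrib[OF X0] fps_deriv_power)
  also have "\<dots> = (fps_const (c / of_nat ?p) * fps_const (of_nat ?p)) * fps_X ^ (?p - 1) *
      (fps_exp (c / of_nat ?p) oo fps_X ^ ?p)"
    by (simp only: ac_simps)
  also have "fps_const (c / of_nat ?p) * fps_const (of_nat ?p) = fps_const c"
    by simp
  finally have "fps_deriv (dwork_fps c) = fps_const c * (dwork_fps c + fps_X ^ (?p - 1) * dwork_fps c)"
    by (simp add: dwork_fps_def algebra_simps)
  then have "fps_deriv (dwork_fps c) $ n
      = (fps_const c * (dwork_fps c + fps_X ^ (?p - 1) * dwork_fps c)) $ n"
    by simp
  then show ?thesis
    by (simp add: fps_X_power_mult_nth q not_less Suc_le_eq del: of_nat_Suc)
qed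

text \<open>Since v^p = v, the exponent v (z + z^p / p) equals v z + (v z)^p / p, so the parameter
  \<open>v\<close> can be moved into the variable.\<close>

lemma dwork_fps_scale:
  fixes v :: "'p::prime_card padic"
  assumes v: "v ^ (CARD('p) - 1) = 1"
  shows "dwork_fps v $ n = v ^ n * dwork_fps 1 $ n"
proof (induction n rule: less_induct)
  case (less n)
  show ?case
  proof (cases n)
    case (Suc m)
    have *: "v * dwork_fps v $ (n - CARD('p)) = v ^ Suc m * dwork_fps 1 $ (n - CARD('p))" if "CARD('p) \<le> n"
    proof -
      have "Suc m = Suc (n - CARD('p)) + (CARD('p) - 1)"
        using that CARD_gt_1(2)[where 'p = 'p] Suc by linarith
      then have "v ^ Suc m = v ^ (Suc (n - CARD('p)) + (CARD('p) - 1))"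
        by (rule arg_cong)
      then have "v ^ Suc m = v * v ^ (n - CARD('p))"
        unfolding power_add v by simp
      moreover have "dwork_fps v $ (n - CARD('p)) = v ^ (n - CARD('p)) * dwork_fps 1 $ (n - CARD('p))"
        using that CARD_gt_1(2)[where 'p = 'p] by (intro less) linarith
      ultimately show ?thesis
        by (simp only: mult.assoc)
    qed
    have "of_nat (Suc m) * dwork_fps v $ Suc m
        = v * dwork_fps v $ m + (if CARD('p) \<le> n then v * dwork_fps v $ (n - CARD('p)) else 0)"
      unfolding dwork_fps_rec Suc distrib_left by simp
    also have "\<dots> = v ^ Suc m * dwork_fps 1 $ m
        + (if CARD('p) \<le> n then v ^ Suc m * dwork_fps 1 $ (n - CARD('p)) else 0)"
      using less[of m] * by (simp add: Suc)
    also have "\<dots> = v ^ Suc m * (of_nat (Suc m) * dwork_fps 1 $ Suc m)"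
      unfolding dwork_fps_rec Suc distrib_left by simp
    finally have "of_nat (Suc m) * dwork_fps v $ Suc m = of_nat (Suc m) * (v ^ Suc m * dwork_fps 1 $ Suc m)"
      by (simp only: ac_simps)
    then show ?thesis
      unfolding Suc mult_cancel_left using of_nat_neq_0 by blast
  qed simp
qed

lemma dwork_fps_1_nth:
  "dwork_fps (1 :: 'p::prime_card padic) $ n = of_nat (torsion_count CARD('p) n) / fact n"
proof (induction n rule: less_induct)
  case (less n)
  show ?case
  proof (cases n)
    case (Suc m)
    have *: "of_nat (\<Prod>k\<in>{Suc (n - CARD('p))..m}. k) * fact (n - CARD('p)) = (fact m :: 'p padic)"
      if "CARD('p) \<le> n"
    proof -
      have "(\<Prod>k\<in>{Suc (n - CARD('p))..m}. k) * fact (n - CARD('p)) = fact m"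
      proof -
        have "n - CARD('p) \<le> m"
          using that CARD_gt_1(2)[where 'p = 'p] Suc by linarith
        then show ?thesis
          using fact_eq_fact_times[of "n - CARD('p)" m] by (simp add: mult.commute)
      qed
      then have "(of_nat ((\<Prod>k\<in>{Suc (n - CARD('p))..m}. k) * fact (n - CARD('p))) :: 'p padic) = of_nat (fact m)"
        by (simp only:)
      then show ?thesis
        by (simp only: of_nat_mult of_nat_fact)
    qed
    have "of_nat (Suc m) * dwork_fps (1 :: 'p padic) $ Suc m
        = of_nat (torsion_count CARD('p) (Suc m)) / fact m"
    proof (cases "CARD('p) \<le> n")
      case True
      have eq: "1 / (fact (n - CARD('p)) :: 'p padic) = of_nat (\<Prod>k\<in>{Suc (n - CARD('p))..m}. k) / fact m"
        unfolding *[OF True, symmetric] by (simp del: of_nat_prod)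
      have "dwork_fps (1 :: 'p padic) $ (n - CARD('p))
          = of_nat (torsion_count CARD('p) (n - CARD('p))) * (1 / fact (n - CARD('p)))"
        using less[of "n - CARD('p)"] True CARD_gt_1(2)[where 'p = 'p] by simp
      also have "\<dots> = of_nat ((\<Prod>k\<in>{Suc (n - CARD('p))..m}. k) * torsion_count CARD('p) (n - CARD('p))) / fact m"
        unfolding eq of_nat_mult by simp
      finally have "of_nat (Suc m) * dwork_fps (1 :: 'p padic) $ Suc m = of_nat (torsion_count CARD('p) m) / fact m
          + of_nat ((\<Prod>k\<in>{Suc (n - CARD('p))..m}. k) * torsion_count CARD('p) (n - CARD('p))) / fact m"
        using less[of m] True unfolding dwork_fps_rec Suc by simp
      then show ?thesis
        using True unfolding Suc torsion_count.simps add_divide_distrib of_nat_add by simp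
    next
      case False
      then show ?thesis
        using less[of m] Suc unfolding dwork_fps_rec by (simp add: torsion_count.simps(2))
    qed
    then show ?thesis
      unfolding Suc fact_Suc by (simp add: field_simps del: of_nat_Suc)
  qed simp
qed

text \<open>With \<open>l = n div p\<close>, the factorial costs \<open>l + e\<close> factors
  \<open>p\<close>, where \<open>e \<le> l / 4\<close> comes from \<open>l!\<close>, and
  \<open>torsion_count\<close> returns \<open>(l + 1) div 2\<close>. The balance with
  \<open>p ^ i\<close> in front is at least \<open>i div 4\<close> because \<open>l \<le> i\<close>.
  The factorial alone would give no bound that implies convergence.\<close>

lemma vint_dwork_fps_1:
  assumes "5 \<le> CARD('p::prime_card)" and "n div CARD('p) \<le> i"
  shows "vint (i div 4) (of_nat CARD('p) ^ i * dwork_fps (1 :: 'p padic) $ n)"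
proof -
  let ?p = "CARD('p)"
  note p = prime_card[where 'a = 'p]
  define l where "l = n div ?p"
  obtain w where w: "torsion_count ?p n = ?p ^ ((l + 1) div 2) * w"
    using power_dvd_torsion_count[OF p, of n] by (auto simp: l_def dvd_def)
  obtain u where u: "\<not> ?p dvd u" "fact n = ?p ^ l * fact l * u"
    using fact_eq_prime_power_mult[OF p] unfolding l_def by blast
  obtain u' e where u': "\<not> ?p dvd u'" "4 * e \<le> l" "fact l = ?p ^ e * u'"
    using fact_eq_small_prime_power_mult[OF p assms(1)] by blast
  define d where "d = i - l + ((l + 1) div 2 - e)"
  have exps: "i + (l + 1) div 2 = l + e + d" "i div 4 \<le> d"
    using assms(2) u'(2) unfolding d_def l_def[symmetric] by linarith+
  have "fact n = ?p ^ (l + e) * (u * u')"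
    unfolding u(2) u'(3) by (simp add: power_add)
  then have "(of_nat (fact n) :: 'p padic) = of_nat (?p ^ (l + e) * (u * u'))"
    by (simp only:)
  then have "of_nat ?p ^ i * dwork_fps (1 :: 'p padic) $ n
      = of_nat ?p ^ (i + (l + 1) div 2) * of_nat w / (of_nat ?p ^ (l + e) * of_nat (u * u'))"
    unfolding dwork_fps_1_nth w by (simp add: power_add)
  also have "\<dots> = of_nat ?p ^ d * of_nat w / of_nat (u * u')"
    unfolding exps(1) by (simp add: power_add)
  also have "vint d \<dots>"
    using u(1) u'(1) prime_dvd_mult_iff[OF p]
    by (intro vint_divide_of_nat vint_mult_left vint_prime_power vint_of_nat) auto
  finally show ?thesis
    using exps(2) by (rule vint_mono)
qed

section \<open>Dwork's expansion of the gamma function\<close>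

abbreviation prime_padic :: "'p::prime_card padic" where
  "prime_padic \<equiv> of_nat CARD('p)"

abbreviation dwork_coeff :: "nat \<Rightarrow> 'p::prime_card padic" where
  "dwork_coeff n \<equiv> dwork_fps 1 $ n"

lemma dwork_coeff_rec:
  "of_nat n * (dwork_coeff n :: 'p::prime_card padic)
    = (if n = 0 then 0 else dwork_coeff (n - 1)) + (if CARD('p) \<le> n then dwork_coeff (n - CARD('p)) else 0)"
proof (cases n)
  case (Suc m)
  then show ?thesis
    using dwork_fps_rec[of m "1 :: 'p padic"] by (simp del: of_nat_Suc)
qed (use CARD_gt_1[where 'p = 'p] in simp)

definition dwork_gamma_term :: "nat \<Rightarrow> 'p::prime_card padic \<Rightarrow> nat \<Rightarrow> 'p padic" where
  "dwork_gamma_term a X l = prime_padic ^ l * dwork_coeff (a + CARD('p) * l) * pochhammer X l"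

lemma vint_pochhammer: "vint 0 x \<Longrightarrow> vint 0 (pochhammer x n)"
  by (auto simp: vint_zero_iff padic_of_int_pochhammer[symmetric])

text \<open>In the recurrence of the coefficients write \<open>a + p l\<close> as
  \<open>(a - p X) + p (X + l)\<close>. As
  \<open>(X + l) * pochhammer X l = pochhammer X (l + 1)\<close>, the second part telescopes against
  the terms \<open>h (a + p (l - 1))\<close>. In the limit this is the functional equation with
  factor -x at x = p X - a, where a > 0 means that x is a unit.\<close>

lemma dwork_gamma_term_telescope:
  fixes X :: "'p::prime_card padic"
  assumes "0 < a" "a < CARD('p)"
  shows "(\<Sum>l<n. dwork_gamma_term (a - 1) X l) = (of_nat a - prime_padic * X) * (\<Sum>l<n. dwork_gamma_term a X l)
    + (if n = 0 then 0 else prime_padic ^ n * dwork_coeff (a + CARD('p) * (n - 1)) * pochhammer X n)"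
proof (induction n)
  case (Suc n)
  let ?p = "CARD('p)" and ?c = "prime_padic ^ n * pochhammer X n" and ?h = "dwork_coeff (a + CARD('p) * n) :: 'p padic"
  define r :: "'p padic" where "r = (if n = 0 then 0 else dwork_coeff (a + ?p * (n - 1)))"
  have rec: "of_nat (a + ?p * n) * ?h = dwork_coeff (a - 1 + ?p * n) + r"
  proof -
    have "a + ?p * n - 1 = a - 1 + ?p * n"
      using assms by simp
    moreover have "?p \<le> a + ?p * n \<longleftrightarrow> n \<noteq> 0" "n \<noteq> 0 \<Longrightarrow> a + ?p * n - ?p = a + ?p * (n - 1)"
      using assms(2) by (cases n; simp)+
    ultimately show ?thesis
      using assms by (subst dwork_coeff_rec) (simp add: r_def)
  qed
  have "(\<Sum>l<Suc n. dwork_gamma_term (a - 1) X l)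
      = (of_nat a - prime_padic * X) * (\<Sum>l<n. dwork_gamma_term a X l) + ?c * (dwork_coeff (a - 1 + ?p * n) + r)"
    unfolding sum.lessThan_Suc Suc.IH by (simp add: dwork_gamma_term_def r_def algebra_simps)
  also have "\<dots> = (of_nat a - prime_padic * X) * (\<Sum>l<n. dwork_gamma_term a X l) + ?c * (of_nat (a + ?p * n) * ?h)"
    unfolding rec ..
  also have "\<dots> = (of_nat a - prime_padic * X) * (\<Sum>l<Suc n. dwork_gamma_term a X l)
      + prime_padic ^ Suc n * ?h * pochhammer X (Suc n)"
    by (simp add: dwork_gamma_term_def pochhammer_Suc algebra_simps)
  finally show ?case
    by simp
qed simp

text \<open>The step across a multiple of \<open>p\<close>: for x = p X one has x + 1 = p (X + 1) -
  (p - 1), so the digit jumps to \<open>p - 1\<close> and \<open>X\<close> increases. The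
  telescoping now rests on \<open>(l + 1) * pochhammer (X + 1) l\<close> being the difference of
  \<open>pochhammer (X + 1) (l + 1)\<close> and \<open>pochhammer X (l + 1)\<close>; in the limit
  the factor is -1.\<close>

lemma dwork_gamma_term_telescope_0:
  fixes X :: "'p::prime_card padic"
  shows "(\<Sum>l<n. dwork_gamma_term (CARD('p) - 1) (X + 1) l) = - (\<Sum>l<n. dwork_gamma_term 0 X l)
    + prime_padic ^ n * dwork_coeff (CARD('p) * n) * (pochhammer (X + 1) n - pochhammer X n)"
proof (induction n)
  case (Suc n)
  let ?p = "CARD('p)" and ?c = "prime_padic ^ n * pochhammer (X + 1) n"
  let ?h = "\<lambda>n. dwork_coeff (CARD('p) * n) :: 'p padic"
  have p0: "0 < ?p"
    by simp
  have "?p * Suc n - 1 = ?p - 1 + ?p * n"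
    using p0 by (simp only: mult_Suc_right)
  then have rec: "of_nat (?p * Suc n) * ?h (Suc n) = dwork_coeff (?p - 1 + ?p * n) + ?h n"
    by (subst dwork_coeff_rec) simp
  have poch: "of_nat (Suc n) * pochhammer (X + 1) n = pochhammer (X + 1) (Suc n) - pochhammer X (Suc n)"
    by (simp only: pochhammer_rec[of X] pochhammer_Suc[of "X + 1"]) (simp add: algebra_simps)
  have "dwork_gamma_term (?p - 1) (X + 1) n = ?c * (of_nat (?p * Suc n) * ?h (Suc n)) - ?c * ?h n"
    unfolding rec by (simp add: dwork_gamma_term_def algebra_simps)
  also have "?c * (of_nat (?p * Suc n) * ?h (Suc n))
      = prime_padic ^ Suc n * ?h (Suc n) * (of_nat (Suc n) * pochhammer (X + 1) n)"
    by (simp only: of_nat_mult power_Suc ac_simps)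
  finally have "dwork_gamma_term (?p - 1) (X + 1) n
      = prime_padic ^ Suc n * ?h (Suc n) * (pochhammer (X + 1) (Suc n) - pochhammer X (Suc n)) - ?c * ?h n"
    unfolding poch .
  moreover have "dwork_gamma_term 0 X n = prime_padic ^ n * ?h n * pochhammer X n"
    by (simp add: dwork_gamma_term_def)
  ultimately show ?case
    unfolding sum.lessThan_Suc Suc.IH by (simp add: algebra_simps del: power_Suc mult_Suc_right)
qed simp

lemma vint_dwork_coeff:
  assumes "5 \<le> CARD('p::prime_card)" and "n div CARD('p) \<le> i" and "vint 0 c"
  shows "vint (i div 4) (prime_padic ^ i * dwork_coeff n * (c :: 'p padic))"
  using assms by (intro vint_mult_left vint_dwork_fps_1)

lemma vint_dwork_gamma_term:
  assumes "5 \<le> CARD('p::prime_card)" and "a < CARD('p)" and "vint 0 X"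
  shows "vint (l div 4) (dwork_gamma_term a (X :: 'p padic) l)"
  unfolding dwork_gamma_term_def using assms
  by (intro vint_dwork_coeff vint_pochhammer) simp_all

lemma has_psum_dwork_gamma_term_pred:
  fixes X :: "'p::prime_card padic"
  assumes p5: "5 \<le> CARD('p)" and a: "0 < a" "a < CARD('p)" and X: "vint 0 X"
    and s: "has_psum (dwork_gamma_term a X) UNIV s"
  shows "has_psum (dwork_gamma_term (a - 1) X) UNIV ((of_nat a - prime_padic * X) * s)"
proof (rule has_psum_natI[of 4])
  let ?c = "of_nat a - prime_padic * X"
  show "vint (i div 4) (dwork_gamma_term (a - 1) X i)" for i
    using a by (intro vint_dwork_gamma_term p5 X) simp
  fix n
  define r where "r = (if n = 0 then 0 else prime_padic ^ n * dwork_coeff (a + CARD('p) * (n - 1)) * pochhammer X n)"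
  have "vint 0 ?c"
    by (intro vint_diff vint_mult_right X vint_of_nat)
  then have "vint (n div 4) (?c * (s - (\<Sum>l<n. dwork_gamma_term a X l)))"
    using vint_dwork_gamma_term[OF p5 a(2) X] by (intro vint_mult_right has_psum_natD[OF s])
  moreover have "vint (n div 4) r"
    using a(2) X p5 by (cases n) (auto simp: r_def simp del: power_Suc intro!: vint_dwork_coeff vint_pochhammer)
  ultimately have "vint (n div 4) (?c * (s - (\<Sum>l<n. dwork_gamma_term a X l)) - r)"
    by (rule vint_diff)
  also have "?c * (s - (\<Sum>l<n. dwork_gamma_term a X l)) - r
      = ?c * s - (\<Sum>l<n. dwork_gamma_term (a - 1) X l)"
    unfolding dwork_gamma_term_telescope[OF a] r_def[symmetric] by (simp add: algebra_simps)
  finally show "vint (n div 4) (?c * s - (\<Sum>l<n. dwork_gamma_term (a - 1) X l))" .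
qed simp

lemma has_psum_dwork_gamma_term_0:
  fixes X :: "'p::prime_card padic"
  assumes p5: "5 \<le> CARD('p)" and X: "vint 0 X"
    and s: "has_psum (dwork_gamma_term 0 X) UNIV s"
  shows "has_psum (dwork_gamma_term (CARD('p) - 1) (X + 1)) UNIV (- s)"
proof (rule has_psum_natI[of 4])
  have X1: "vint 0 (X + 1)"
    using X by (intro vint_add) simp_all
  show "vint (i div 4) (dwork_gamma_term (CARD('p) - 1) (X + 1) i)" for i
    by (intro vint_dwork_gamma_term p5 X1) simp
  fix n
  define r where "r = prime_padic ^ n * dwork_coeff (CARD('p) * n) * (pochhammer (X + 1) n - pochhammer X n)"
  have "vint (n div 4) (s - (\<Sum>l<n. dwork_gamma_term 0 X l))"
    by (intro has_psum_natD[OF s] vint_dwork_gamma_term p5 X) simp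
  moreover have "vint (n div 4) r"
    unfolding r_def by (intro vint_dwork_coeff p5 vint_diff vint_pochhammer X X1) simp
  ultimately have "vint (n div 4) (- (s - (\<Sum>l<n. dwork_gamma_term 0 X l)) - r)"
    by (rule vint_diff[OF vint_minus])
  also have "- (s - (\<Sum>l<n. dwork_gamma_term 0 X l)) - r
      = - s - (\<Sum>l<n. dwork_gamma_term (CARD('p) - 1) (X + 1) l)"
    unfolding dwork_gamma_term_telescope_0 r_def[symmetric] by (simp add: algebra_simps)
  finally show "vint (n div 4) (- s - (\<Sum>l<n. dwork_gamma_term (CARD('p) - 1) (X + 1) l))" .
qed simp

section \<open>Identification of Dwork's series with the gamma function\<close>

lemma padic_digit_decomp:
  fixes x :: "'p::prime_card padic_int"
  obtains a X where "a < CARD('p)" "x = padic_p * X - of_nat a"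
proof -
  obtain k where "padic_p ^ 1 dvd - x - of_nat k"
    by (rule padic_approx_nat)
  moreover have "padic_p dvd (of_nat (k div CARD('p) * CARD('p)) :: 'p padic_int)"
    unfolding padic_p_dvd_of_nat_iff by simp
  ultimately have "padic_p dvd - x - of_nat k + of_nat (k div CARD('p) * CARD('p))"
    by (metis dvd_add power_one_right)
  moreover have "(of_nat k :: 'p padic_int) = of_nat (k div CARD('p) * CARD('p)) + of_nat (k mod CARD('p))"
    by (metis div_mult_mod_eq of_nat_add)
  ultimately have "padic_p dvd - (x + of_nat (k mod CARD('p)))"
    by (simp add: algebra_simps)
  then obtain X where "x + of_nat (k mod CARD('p)) = padic_p * X"
    unfolding dvd_minus_iff by (elim dvdE)
  then have "x = padic_p * X - of_nat (k mod CARD('p))"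
    by (simp add: eq_diff_eq)
  moreover have "k mod CARD('p) < CARD('p)"
    by simp
  ultimately show thesis
    using that by blast
qed

lemma padic_digit_decomp_unique:
  fixes X Y :: "'p::prime_card padic_int"
  assumes "a < CARD('p)" "b < CARD('p)" "padic_p * X - of_nat a = padic_p * Y - of_nat b"
  shows "a = b \<and> X = Y"
proof -
  have "of_int (int a - int b) = padic_p * (X - Y)"
    using assms(3) by (simp add: algebra_simps)
  then have "padic_p ^ 1 dvd (of_int (int a - int b) :: 'p padic_int)"
    by (simp only: power_one_right dvd_triv_left)
  then have "int CARD('p) dvd int a - int b"
    unfolding padic_p_dvd_of_int_iff by simp
  moreover have "\<bar>int a - int b\<bar> < int CARD('p)"
    using assms(1,2) by linarith
  ultimately have "a = b"
    using dvd_imp_le_int[of "int a - int b" "int CARD('p)"] by force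
  then show ?thesis
    using assms(3) by simp
qed

text \<open>Dwork's expansion turned into a definition; \<open>a\<close> and \<open>X\<close> may
  stay under the quantifier because \<open>x\<close> determines both.\<close>

definition dwork_gamma :: "'p::prime_card padic_int \<Rightarrow> 'p padic_int" where
  "dwork_gamma x = (THE y. \<exists>a X. a < CARD('p) \<and> x = padic_p * X - of_nat a \<and>
     has_psum (dwork_gamma_term a (padic_of_int X)) UNIV (padic_of_int y))"

lemma has_psum_dwork_gamma:
  fixes X :: "'p::prime_card padic_int"
  assumes p5: "5 \<le> CARD('p)" and a: "a < CARD('p)"
  shows "has_psum (dwork_gamma_term a (padic_of_int X)) UNIV
    (padic_of_int (dwork_gamma (padic_p * X - of_nat a)))"
proof -
  let ?P = "\<lambda>y. \<exists>b Y. b < CARD('p) \<and> padic_p * X - of_nat a = padic_p * Y - of_nat b \<and>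
     has_psum (dwork_gamma_term b (padic_of_int Y)) UNIV (padic_of_int y)"
  have v: "vint (l div 4) (dwork_gamma_term a (padic_of_int X) l)" for l
    by (intro vint_dwork_gamma_term p5 a) simp
  obtain s where s: "has_psum (dwork_gamma_term a (padic_of_int X)) UNIV s"
    using has_psum_nat_exists[OF _ v] by auto
  have "vint 0 s"
    using s by (rule has_psum_vint) (use v vint_mono in blast)
  then obtain y where y: "s = padic_of_int y"
    unfolding vint_zero_iff by blast
  have "?P y"
    using s a unfolding y by blast
  moreover have "z = y" if "?P z" for z
  proof -
    have "has_psum (dwork_gamma_term a (padic_of_int X)) UNIV (padic_of_int z)"
      using that padic_digit_decomp_unique[OF a] by metis
    then show ?thesis
      using has_psum_unique s unfolding y by fastforce
  qed
  ultimately have "dwork_gamma (padic_p * X - of_nat a) = y"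
    unfolding dwork_gamma_def by (rule the_equality)
  then show ?thesis
    using s unfolding y by simp
qed

lemma dwork_gamma_0 [simp]:
  assumes p5: "5 \<le> CARD('p::prime_card)"
  shows "dwork_gamma (0 :: 'p padic_int) = 1"
proof -
  have eq: "dwork_gamma_term 0 0 = (\<lambda>l. if l = 0 then 1 else 0 :: 'p padic)"
    by (auto simp: dwork_gamma_term_def fun_eq_iff pochhammer_0_left)
  have "has_psum (\<lambda>l. if l = 0 then 1 else 0 :: 'p padic) {0 :: nat} 1"
    using has_psum_finite[of "{0 :: nat}" "\<lambda>l. if l = 0 then 1 else 0 :: 'p padic"] by simp
  then have "has_psum (dwork_gamma_term 0 (0 :: 'p padic)) UNIV 1"
    unfolding eq by (subst (asm) has_psum_neutral[of _ UNIV]) auto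
  moreover have "has_psum (dwork_gamma_term 0 (0 :: 'p padic)) UNIV (padic_of_int (dwork_gamma 0))"
    using has_psum_dwork_gamma[OF p5, of 0 0] by simp
  ultimately have "padic_of_int (dwork_gamma (0 :: 'p padic_int)) = padic_of_int 1"
    using has_psum_unique by fastforce
  then show ?thesis
    unfolding padic_of_int_eq_iff .
qed

text \<open>The digit \<open>a\<close> is 0 exactly when \<open>p\<close> divides \<open>x\<close>,
  so the two telescoping identities are the two cases.\<close>

lemma dwork_gamma_plus1:
  fixes x :: "'p::prime_card padic_int"
  assumes p5: "5 \<le> CARD('p)"
  shows "dwork_gamma (x + 1) = (if padic_p dvd x then - 1 else - x) * dwork_gamma x"
proof -
  obtain a X where a: "a < CARD('p)" and x: "x = padic_p * X - of_nat a"
    by (rule padic_digit_decomp)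
  have dvd: "padic_p dvd x \<longleftrightarrow> a = 0"
  proof -
    have "padic_p dvd x \<longleftrightarrow> CARD('p) dvd a"
      unfolding x by (simp add: dvd_diff_right_iff padic_p_dvd_of_nat_iff)
    then show ?thesis
      using a by (auto dest: dvd_imp_le)
  qed
  note s = has_psum_dwork_gamma[OF p5 a, of X]
  have X: "vint 0 (padic_of_int X)"
    by simp
  show ?thesis
  proof (cases "a = 0")
    case False
    have "x + 1 = padic_p * X - of_nat (a - 1)"
      using False by (simp add: x)
    moreover have "a - 1 < CARD('p)"
      using a by simp
    ultimately have 1: "has_psum (dwork_gamma_term (a - 1) (padic_of_int X)) UNIV (padic_of_int (dwork_gamma (x + 1)))"
      using has_psum_dwork_gamma[OF p5, of "a - 1" X] by simp
    have "padic_of_int (dwork_gamma (x + 1))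
        = (of_nat a - prime_padic * padic_of_int X) * padic_of_int (dwork_gamma x)"
      using False by (intro has_psum_unique[OF 1] has_psum_dwork_gamma_term_pred p5 a X s[folded x]) simp
    also have "\<dots> = padic_of_int (- x * dwork_gamma x)"
      by (simp add: x padic_of_int_mult padic_of_int_diff padic_of_int_minus algebra_simps)
    finally show ?thesis
      using False dvd by simp
  next
    case True
    have x1: "x + 1 = padic_p * (X + 1) - of_nat (CARD('p) - 1)"
      using True by (simp add: x algebra_simps of_nat_diff)
    have "CARD('p) - 1 < CARD('p)"
      by simp
    then have 1: "has_psum (dwork_gamma_term (CARD('p) - 1) (padic_of_int X + 1)) UNIV
        (padic_of_int (dwork_gamma (x + 1)))"
      unfolding x1 using has_psum_dwork_gamma[OF p5, of "CARD('p) - 1" "X + 1"]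
      by (simp only: padic_of_int_add padic_of_int_1)
    have "padic_of_int (dwork_gamma (x + 1)) = - padic_of_int (dwork_gamma x)"
      by (intro has_psum_unique[OF 1] has_psum_dwork_gamma_term_0 p5 X) (use s[folded x] True in simp)
    also have "\<dots> = padic_of_int (- dwork_gamma x)"
      by (simp add: padic_of_int_minus)
    finally show ?thesis
      using True dvd by simp
  qed
qed

lemma pochhammer_padic_cong:
  fixes X Y :: "'p::prime_card padic_int"
  assumes "padic_p ^ n dvd Y - X"
  shows "padic_p ^ n dvd pochhammer Y l - pochhammer X l"
proof (induction l)
  case (Suc l)
  have "pochhammer Y (Suc l) - pochhammer X (Suc l)
      = (pochhammer Y l - pochhammer X l) * (Y + of_nat l) + pochhammer X l * (Y - X)"
    by (simp add: pochhammer_Suc algebra_simps)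
  then show ?case
    using Suc assms by simp
qed simp

text \<open>Congruent arguments have the same digit \<open>a\<close>, and the series is integral in
  \<open>X\<close>. One power of \<open>p\<close> is lost because \<open>X\<close> arises from
  \<open>x + a\<close> by division by \<open>p\<close>.\<close>

lemma dwork_gamma_cong:
  fixes x y :: "'p::prime_card padic_int"
  assumes p5: "5 \<le> CARD('p)" and "padic_p ^ Suc n dvd y - x"
  shows "padic_p ^ n dvd dwork_gamma y - dwork_gamma x"
proof -
  obtain a X where a: "a < CARD('p)" and x: "x = padic_p * X - of_nat a"
    by (rule padic_digit_decomp)
  obtain z where "y - x = padic_p ^ Suc n * z"
    using assms(2) by (elim dvdE)
  then have y: "y = padic_p * (X + padic_p ^ n * z) - of_nat a"
    by (simp add: x algebra_simps)
  let ?Y = "X + padic_p ^ n * z"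
  have "vint n (padic_of_int (dwork_gamma y) - padic_of_int (dwork_gamma x))"
  proof (rule has_psum_vint[OF has_psum_diff])
    show "has_psum (dwork_gamma_term a (padic_of_int ?Y)) UNIV (padic_of_int (dwork_gamma y))"
      unfolding y by (rule has_psum_dwork_gamma[OF p5 a])
    show "has_psum (dwork_gamma_term a (padic_of_int X)) UNIV (padic_of_int (dwork_gamma x))"
      unfolding x by (rule has_psum_dwork_gamma[OF p5 a])
    fix l
    have "padic_p ^ n dvd pochhammer ?Y l - pochhammer X l"
      by (rule pochhammer_padic_cong) simp
    then have "vint n (padic_of_int (pochhammer ?Y l - pochhammer X l))"
      unfolding vint_of_int_iff .
    moreover have "vint 0 (prime_padic ^ l * dwork_coeff (a + CARD('p) * l) * 1 :: 'p padic)"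
      by (rule vint_mono[OF vint_dwork_coeff[OF p5]]) (use a in simp_all)
    ultimately have "vint n (prime_padic ^ l * dwork_coeff (a + CARD('p) * l) * 1 *
        padic_of_int (pochhammer ?Y l - pochhammer X l))"
      by (rule vint_mult_right[rotated])
    then show "vint n (dwork_gamma_term a (padic_of_int ?Y) l - dwork_gamma_term a (padic_of_int X) l)"
      by (simp only: dwork_gamma_term_def padic_of_int_diff padic_of_int_pochhammer right_diff_distrib mult_1_right)
  qed
  then have "vint n (padic_of_int (dwork_gamma y - dwork_gamma x))"
    unfolding padic_of_int_diff .
  then show ?thesis
    unfolding vint_of_int_iff .
qed

lemma dwork_gamma_of_nat:
  assumes p5: "5 \<le> CARD('p::prime_card)" and "0 < n"
  shows "dwork_gamma (of_nat n :: 'p padic_int)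
    = (- 1) ^ n * (\<Prod>j | 0 < j \<and> j < n \<and> \<not> CARD('p) dvd j. of_nat j)"
  using \<open>0 < n\<close>
proof (induction n)
  case (Suc n)
  show ?case
  proof (cases "n = 0")
    case True
    then have S: "{j. 0 < j \<and> j < Suc n \<and> \<not> CARD('p) dvd j} = {}"
      by auto
    show ?thesis
      unfolding S using dwork_gamma_plus1[OF p5, of 0] True by (simp add: p5)
  next
    case False
    have "dwork_gamma (of_nat n + 1 :: 'p padic_int)
        = (if CARD('p) dvd n then - 1 else - of_nat n) * dwork_gamma (of_nat n)"
      using dwork_gamma_plus1[OF p5, of "of_nat n"] by (simp only: padic_p_dvd_of_nat_iff)
    moreover have "{j. 0 < j \<and> j < Suc n \<and> \<not> CARD('p) dvd j}
        = (if CARD('p) dvd n then {} else {n}) \<union> {j. 0 < j \<and> j < n \<and> \<not> CARD('p) dvd j}"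
      using False by (auto simp: less_Suc_eq)
    ultimately show ?thesis
      using Suc.IH False by (simp add: add.commute)
  qed
qed simp

lemma prime_elem_dvd_prodE:
  assumes "prime_elem p" "p dvd prod f A"
  obtains a where "a \<in> A" "p dvd f a"
  using assms(2)
proof (induction A arbitrary: thesis rule: infinite_finite_induct)
  case (insert a A)
  then consider "p dvd f a" | "p dvd prod f A"
    using prime_elem_dvd_mult_iff[OF assms(1)] by auto
  then show ?case
    using insert by cases blast+
qed (use prime_elem_not_unit[OF assms(1)] in auto)

lemma dvd_minus_commute: "(a :: 'a :: comm_ring_1) dvd x - y \<longleftrightarrow> a dvd y - x"
  using dvd_minus_iff[of a "x - y"] by simp

text \<open>Reduced to a natural argument, where the value is up to sign a product of numbers prime
  to \<open>p\<close>. The approximation is modulo \<open>p ^ 2\<close> because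
  \<open>dwork_gamma_cong\<close> loses one power.\<close>

lemma dwork_gamma_unit:
  fixes x :: "'p::prime_card padic_int"
  assumes p5: "5 \<le> CARD('p)"
  shows "\<not> padic_p dvd dwork_gamma x"
proof
  assume x: "padic_p dvd dwork_gamma x"
  obtain n where n: "padic_p ^ Suc 1 dvd x - of_nat n"
    by (rule padic_approx_nat)
  have "padic_p ^ 1 dvd dwork_gamma x - dwork_gamma (of_nat n)"
    by (rule dwork_gamma_cong[OF p5 n])
  then have "padic_p dvd dwork_gamma x - dwork_gamma (of_nat n)"
    by simp
  then have d: "padic_p dvd dwork_gamma (of_nat n :: 'p padic_int)"
    using x dvd_diff[of padic_p "dwork_gamma x" "dwork_gamma x - dwork_gamma (of_nat n)"] by simp
  have not_unit: "\<not> padic_p dvd (1 :: 'p padic_int)"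
    using padic_p_dvd_of_nat_iff[of 1, where 'p = 'p] CARD_gt_1[where 'p = 'p] by simp
  show False
  proof (cases "n = 0")
    case True
    then show False
      using d not_unit p5 by simp
  next
    case False
    let ?S = "{j. 0 < j \<and> j < n \<and> \<not> CARD('p) dvd j}"
    from False have n0: "0 < n"
      by simp
    have "padic_p dvd (\<Prod>j\<in>?S. of_nat j :: 'p padic_int)"
      using d unfolding dwork_gamma_of_nat[OF p5 n0] by (cases "even n") simp_all
    then obtain j where "j \<in> ?S" "padic_p dvd (of_nat j :: 'p padic_int)"
      by (rule prime_elem_dvd_prodE[OF prime_elem_padic_p])
    then show False
      by (simp add: padic_p_dvd_of_nat_iff)
  qed
qed

text \<open>Resolves the description in the definition: Dwork's series gives existence, density of
  the natural numbers gives uniqueness.\<close>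

lemma padic_Gamma_eq_dwork_gamma:
  assumes p5: "5 \<le> CARD('p::prime_card)"
  shows "padic_Gamma = (dwork_gamma :: 'p padic_int \<Rightarrow> 'p padic_int)"
  unfolding padic_Gamma_def
proof (rule the_equality)
  have "continuous_on UNIV (dwork_gamma :: 'p padic_int \<Rightarrow> 'p padic_int)"
    unfolding padic_continuous_iff using dwork_gamma_cong[OF p5] by blast
  then show "(\<forall>x. (dwork_gamma :: 'p padic_int \<Rightarrow> 'p padic_int) x dvd 1) \<and> continuous_on UNIV (dwork_gamma :: 'p padic_int \<Rightarrow> 'p padic_int)
      \<and> dwork_gamma (0 :: 'p padic_int) = 1 \<and> (\<forall>n>0. dwork_gamma (of_nat n :: 'p padic_int)
        = (- 1) ^ n * (\<Prod>j | 0 < j \<and> j < n \<and> \<not> CARD('p) dvd j. of_nat j))"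
    using dwork_gamma_unit[OF p5] dwork_gamma_of_nat[OF p5] p5 by (simp add: padic_unit_iff)
next
  fix f :: "'p padic_int \<Rightarrow> 'p padic_int"
  assume f: "(\<forall>x. f x dvd 1) \<and> continuous_on UNIV f \<and> f 0 = 1 \<and>
     (\<forall>n>0. f (of_nat n) = (- 1) ^ n * (\<Prod>j | 0 < j \<and> j < n \<and> \<not> CARD('p) dvd j. of_nat j))"
  have nat: "f (of_nat n) = dwork_gamma (of_nat n)" for n
    using f dwork_gamma_of_nat[OF p5, of n] p5 by (cases "n = 0") simp_all
  show "f = dwork_gamma"
  proof
    fix x
    show "f x = dwork_gamma x"
    proof (rule padic_int_eqI_dvd)
      fix N
      have "continuous_on UNIV f"
        using f by simp
      then obtain M where M: "\<And>y. padic_p ^ M dvd y - x \<Longrightarrow> padic_p ^ N dvd f y - f x"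
        unfolding padic_continuous_iff by blast
      obtain n where n: "padic_p ^ (M + Suc N) dvd x - of_nat n"
        by (rule padic_approx_nat)
      then have "padic_p ^ M dvd of_nat n - x"
        unfolding dvd_minus_commute[of _ "of_nat n" x] by (rule power_le_dvd) simp
      then have 1: "padic_p ^ N dvd f (of_nat n) - f x"
        by (rule M)
      have "padic_p ^ Suc N dvd of_nat n - x"
        using n unfolding dvd_minus_commute[of _ "of_nat n" x] by (rule power_le_dvd) simp
      then have 2: "padic_p ^ N dvd dwork_gamma (of_nat n) - dwork_gamma x"
        by (rule dwork_gamma_cong[OF p5])
      show "padic_p ^ N dvd f x - dwork_gamma x"
        using dvd_diff[OF 2 1] by (simp add: nat)
    qed
  qed
qed

section \<open>The trace formula\<close>

text \<open>Let \<pi>^(p - 1) = -p. The splitting function is the sum of \<open>h n\<close> \<pi>^n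
  x^n. Multiplying by x^(-a) and summing over the (p - 1)-th roots of unity x keeps the n congruent
  to a modulo p - 1. For 0 \<le> a < p - 1 the Gauss sum is therefore (p - 1) \<pi>^a times the sum
  of these terms, and no \<pi> is left in the terms themselves.\<close>

definition dwork_gauss_term :: "nat \<Rightarrow> nat \<Rightarrow> 'p::prime_card padic" where
  "dwork_gauss_term a k = (- prime_padic) ^ k * dwork_coeff (a + (CARD('p) - 1) * k)"

definition dwork_gauss :: "nat \<Rightarrow> 'p::prime_card padic" where
  "dwork_gauss a = (THE s. has_psum (dwork_gauss_term a) UNIV s)"

lemma vint_minus_power_dwork_coeff:
  assumes "5 \<le> CARD('p::prime_card)" and "n div CARD('p) \<le> i"
  shows "vint (i div 4) ((- prime_padic) ^ i * dwork_coeff n :: 'p padic)"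
proof -
  have "vint (i div 4) (prime_padic ^ i * dwork_coeff n :: 'p padic)"
    by (rule vint_dwork_fps_1[OF assms])
  then show ?thesis
    unfolding power_minus[of prime_padic] by (cases "even i") (simp_all add: vint_minus)
qed

lemma vint_dwork_gauss_term:
  assumes "5 \<le> CARD('p::prime_card)" and "a < CARD('p)"
  shows "vint (k div 4) (dwork_gauss_term a k :: 'p padic)"
proof -
  have "a + (CARD('p) - 1) * k < Suc k * CARD('p)"
    using assms(2) by (cases "CARD('p)") auto
  then have "(a + (CARD('p) - 1) * k) div CARD('p) \<le> k"
    by (simp add: less_mult_imp_div_less less_Suc_eq_le[symmetric])
  then show ?thesis
    unfolding dwork_gauss_term_def by (rule vint_minus_power_dwork_coeff[OF assms(1)])
qed

lemma has_psum_dwork_gauss: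
  assumes "5 \<le> CARD('p::prime_card)" and "a < CARD('p)"
  shows "has_psum (dwork_gauss_term a :: nat \<Rightarrow> 'p padic) UNIV (dwork_gauss a)"
proof -
  obtain s where s: "has_psum (dwork_gauss_term a :: nat \<Rightarrow> 'p padic) UNIV s"
    using has_psum_nat_exists[OF _ vint_dwork_gauss_term[OF assms]] by auto
  then have "dwork_gauss a = s"
    unfolding dwork_gauss_def by (intro the_equality has_psum_unique)
  then show ?thesis
    using s by simp
qed

text \<open>
  The matrix of the operator \<open>\<psi> \<circ> z\<^sup>-\<^sup>a exp (z + z\<^sup>p / p)\<close>, where \<open>\<psi>\<close> sends \<open>z ^ (p n)\<close> to
  \<open>z ^ n\<close> and kills the other powers, in the variable \<open>\<pi> z\<close> with \<open>\<pi> ^ (p - 1) = - p\<close>. It satisfies \<open>A D = p D A\<close> for the twisted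
  derivation \<open>D z ^ i = (i + \<alpha>) z ^ i + z ^ (i + 1)\<close>, whose cokernel is spanned by \<open>1\<close>. Hence the trace of
  \<open>A\<close> (a Gauss sum) times \<open>1 - p\<close> is the class of \<open>A 1\<close> in the cokernel (a value of the gamma function).
\<close>

definition dwork_matrix :: "nat \<Rightarrow> nat \<Rightarrow> nat \<Rightarrow> 'p::prime_card padic" where
  "dwork_matrix a l i =
    (if i \<le> a + CARD('p) * l then (- prime_padic) ^ l * dwork_coeff (a + CARD('p) * l - i) else 0)"

lemma vint_dwork_matrix:
  assumes "5 \<le> CARD('p::prime_card)" and "a < CARD('p)"
  shows "vint (l div 4) (dwork_matrix a l i :: 'p padic)"
proof (cases "i \<le> a + CARD('p) * l")
  case True
  have "(a + CARD('p) * l - i) div CARD('p) \<le> (a + CARD('p) * l) div CARD('p)"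
    by (intro div_le_mono) simp
  also have "\<dots> = l"
    using assms(2) by simp
  finally show ?thesis
    unfolding dwork_matrix_def using True by (simp add: vint_minus_power_dwork_coeff assms(1))
qed (simp add: dwork_matrix_def)

text \<open>The coefficient of z^l in A D z^j = p D A z^j. It is the recurrence of \<open>h\<close>
  at n = a + p l - j, because \<alpha> = a / (p - 1) gives n = p (l + \<alpha>) - (j +
  \<alpha>).\<close>

lemma dwork_matrix_commute:
  fixes \<alpha> :: "'p::prime_card padic"
  assumes a: "a < CARD('p)" and \<alpha>: "(prime_padic - 1) * \<alpha> = of_nat a"
  shows "(of_nat j + \<alpha>) * dwork_matrix a l j + dwork_matrix a l (Suc j)
    = prime_padic * ((of_nat l + \<alpha>) * dwork_matrix a l j + (if l = 0 then 0 else dwork_matrix a (l - 1) j))"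
proof (cases "j \<le> a + CARD('p) * l")
  case True
  let ?p = "CARD('p)"
  define n where "n = a + ?p * l - j"
  have n: "of_nat n = prime_padic * (of_nat l + \<alpha>) - (of_nat j + \<alpha> :: 'p padic)"
    using True \<alpha> by (simp add: n_def of_nat_diff algebra_simps)
  have m0: "dwork_matrix a l j = ((- prime_padic) ^ l * dwork_coeff n :: 'p padic)"
    using True by (simp add: dwork_matrix_def n_def)
  have m1: "dwork_matrix a l (Suc j) = ((- prime_padic) ^ l * (if n = 0 then 0 else dwork_coeff (n - 1)) :: 'p padic)"
    using True by (auto simp: dwork_matrix_def n_def)
  have m2: "prime_padic * (if l = 0 then 0 else dwork_matrix a (l - 1) j)
      = - ((- prime_padic) ^ l * (if ?p \<le> n then dwork_coeff (n - ?p) else 0) :: 'p padic)"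
  proof (cases l)
    case 0
    then show ?thesis
      using a by (simp add: n_def)
  next
    case (Suc l')
    have "j \<le> a + ?p * l' \<longleftrightarrow> ?p \<le> n" "?p \<le> n \<Longrightarrow> a + ?p * l' - j = n - ?p"
      using True by (auto simp: n_def Suc)
    then show ?thesis
      by (simp add: dwork_matrix_def Suc)
  qed
  have "of_nat n * dwork_matrix a l j
      = (- prime_padic) ^ l * (of_nat n * dwork_coeff n :: 'p padic)"
    unfolding m0 by (simp only: ac_simps)
  also have "\<dots> = dwork_matrix a l (Suc j) - prime_padic * (if l = 0 then 0 else dwork_matrix a (l - 1) j)"
    unfolding dwork_coeff_rec m1 m2 distrib_left by (simp only: diff_minus_eq_add)
  finally show ?thesis
    unfolding n by (simp only: left_diff_distrib distrib_left) (simp add: algebra_simps)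
next
  case False
  moreover from this have "\<not> j \<le> a + CARD('p) * (l - 1)"
    by (cases l) auto
  ultimately show ?thesis
    by (simp add: dwork_matrix_def)
qed

text \<open>Let S z^k be the sum over j < k of (-1)^(k - 1 - j) (\<alpha> + j + 1)...(\<alpha> + k -
  1) z^j. Then D S z^k = z^k - (-1)^k \<alpha> (\<alpha> + 1)...(\<alpha> + k - 1) and S D = 1. The
  first identity splits trace A into the gamma series and trace (A D S) = p trace (D A S); the
  second makes trace (D A S) = trace (A S D) = trace A. For partial sums the cyclic exchange leaves
  a boundary term, the last sum of the statement.\<close>

lemma dwork_trace_formula:
  fixes \<alpha> :: "'p::prime_card padic"
  assumes a: "a < CARD('p)" and \<alpha>: "(prime_padic - 1) * \<alpha> = of_nat a"
  shows "(1 - prime_padic) * (\<Sum>k<n. dwork_gauss_term a k) = (\<Sum>k<n. dwork_gamma_term a \<alpha> k)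
    - prime_padic * (\<Sum>j<n. dwork_matrix a (n - 1) j * ((- 1) ^ (n - 1 - j) * pochhammer (\<alpha> + of_nat j + 1) (n - 1 - j)))"
proof -
  define A :: "nat \<Rightarrow> nat \<Rightarrow> 'p padic" where "A = dwork_matrix a"
  \<comment> \<open>The matrix of S. The rules \<open>s_Suc_right\<close> and \<open>s_diag\<close>
    below express S D = 1.\<close>
  define s :: "nat \<Rightarrow> nat \<Rightarrow> 'p padic"
    where "s j k = (- 1) ^ (k - 1 - j) * pochhammer (\<alpha> + of_nat j + 1) (k - 1 - j)" for j k
  define B where "B k = (\<Sum>j<k. A (k - 1) j * s j k)" for k
  have diag: "A k k = dwork_gauss_term a k" for k
  proof -
    obtain q where q: "CARD('p) = Suc q"
      by (rule CARD_eq_SucE)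
    have "a + CARD('p) * k - k = a + (CARD('p) - 1) * k" "k \<le> a + CARD('p) * k"
      unfolding q by simp_all
    then show ?thesis
      by (simp add: A_def dwork_matrix_def dwork_gauss_term_def)
  qed
  have col: "A k 0 * ((- 1) ^ k * pochhammer \<alpha> k) = dwork_gamma_term a \<alpha> k" for k
  proof -
    have "(- 1) ^ k * (- prime_padic) ^ k = (prime_padic ^ k :: 'p padic)"
      by (simp flip: power_mult_distrib)
    then show ?thesis
      unfolding A_def dwork_matrix_def dwork_gamma_term_def by (simp add: mult.assoc mult.left_commute)
  qed
  have s_Suc_right: "s j (Suc k) = - (of_nat k + \<alpha>) * s j k" if jk: "j < k" for j k
  proof -
    obtain m where m: "k = Suc (j + m)"
      using less_imp_Suc_add[OF jk] by blast
    show ?thesis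
      by (simp add: s_def m pochhammer_Suc algebra_simps)
  qed
  have s_diag: "s j (Suc j) = 1" for j
    by (simp add: s_def)
  have s_Suc_left: "s j k = - (of_nat (Suc j) + \<alpha>) * s (Suc j) k" if jk: "Suc j < k" for j k
  proof -
    obtain m where m: "k = Suc (Suc j + m)"
      using less_imp_Suc_add[OF jk] by blast
    show ?thesis
      by (simp add: s_def m pochhammer_rec algebra_simps)
  qed
  \<comment> \<open>Modulo the image of D, the power z^k is congruent to \<open>c i k\<close> times
    z^i, for i \<le> k.\<close>
  define c where "c i k = (if i = 0 then (- 1) ^ k * pochhammer \<alpha> k else s (i - 1) k)" for i k
  have c_eq: "c i k = - (of_nat i + \<alpha>) * s i k" if ik: "i < k" for i k
  proof (cases i)
    case 0
    obtain m where m: "k = Suc m"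
      using ik 0 by (cases k) auto
    show ?thesis
      by (simp add: c_def s_def 0 m pochhammer_rec add.commute)
  next
    case (Suc i')
    then show ?thesis
      using s_Suc_left[of i' k] ik by (simp add: c_def)
  qed
  \<comment> \<open>Descending from z^k to a constant by multiples of D z^j, read in row
    \<open>k\<close> after applying A; \<open>i = k\<close> is the case of interest.\<close>
  have partial: "A k i * c i k = A k 0 * c 0 k + (\<Sum>j<i. ((of_nat j + \<alpha>) * A k j + A k (Suc j)) * s j k)"
    if "i \<le> k" for i k
    using that
  proof (induction i)
    case (Suc i)
    have "A k i * c i k + ((of_nat i + \<alpha>) * A k i + A k (Suc i)) * s i k = A k (Suc i) * s i k"
      using Suc.prems by (simp add: c_eq algebra_simps)
    then show ?case
      using Suc by (simp add: c_def[of "Suc i"] algebra_simps)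
  qed simp
  have c_diag: "c k k = 1" for k
    by (cases k) (simp_all add: c_def s_diag)
  have step: "(1 - prime_padic) * dwork_gauss_term a k
      = dwork_gamma_term a \<alpha> k - prime_padic * (B (Suc k) - B k)" for k
  proof -
    have Bk: "B k = (\<Sum>j<k. (if k = 0 then 0 else A (k - 1) j) * s j k)"
      unfolding B_def by (intro sum.cong) auto
    have "(\<Sum>j<k. (of_nat k + \<alpha>) * A k j * s j k) = - (\<Sum>j<k. A k j * s j (Suc k))"
      unfolding sum_negf[symmetric] by (intro sum.cong) (simp_all add: s_Suc_right algebra_simps)
    then have S: "(\<Sum>j<k. (of_nat k + \<alpha>) * A k j * s j k) = A k k - B (Suc k)"
      by (simp add: B_def s_diag)
    have "A k k = dwork_gamma_term a \<alpha> k
        + (\<Sum>j<k. prime_padic * ((of_nat k + \<alpha>) * A k j + (if k = 0 then 0 else A (k - 1) j)) * s j k)"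
      using partial[of k k] unfolding c_diag A_def dwork_matrix_commute[OF a \<alpha>]
      by (simp add: c_def col[unfolded A_def])
    also have "\<dots> = dwork_gamma_term a \<alpha> k + prime_padic * (A k k - B (Suc k) + B k)"
      unfolding S[symmetric] Bk by (simp add: sum_distrib_left sum.distrib algebra_simps)
    finally show ?thesis
      unfolding diag by (simp add: algebra_simps)
  qed
  have B0: "B 0 = 0"
    by (simp add: B_def)
  have "(1 - prime_padic) * (\<Sum>k<n. dwork_gauss_term a k) = (\<Sum>k<n. (1 - prime_padic) * dwork_gauss_term a k)"
    by (rule sum_distrib_left)
  also have "\<dots> = (\<Sum>k<n. dwork_gamma_term a \<alpha> k - prime_padic * (B (Suc k) - B k))"
    by (simp only: step)
  also have "\<dots> = (\<Sum>k<n. dwork_gamma_term a \<alpha> k) - prime_padic * (\<Sum>k<n. B (Suc k) - B k)"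
    by (simp only: sum_subtractf[of _ "\<lambda>k. prime_padic * (B (Suc k) - B k)"] sum_distrib_left)
  also have "(\<Sum>k<n. B (Suc k) - B k) = B n"
    by (simp only: sum_lessThan_telescope B0 diff_zero)
  finally show ?thesis
    unfolding B_def s_def A_def .
qed

text \<open>The point x = a / (p - 1) is fixed by X \<mapsto> p X - a, so Dwork's expansion with X =
  x computes the gamma value at x itself, and its series is the one in the trace formula.\<close>

lemma padic_Gamma_eq_dwork_gauss:
  fixes x :: "'p::prime_card padic_int"
  assumes p5: "5 \<le> CARD('p)" and a: "a < CARD('p)" and x: "(padic_p - 1) * x = of_nat a"
  shows "padic_of_int (padic_Gamma x) = (1 - prime_padic) * dwork_gauss a"
proof -
  let ?\<alpha> = "padic_of_int x"
  have "padic_p * x - of_nat a = x"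
    unfolding x[symmetric] by (simp add: algebra_simps)
  then have G: "has_psum (dwork_gamma_term a ?\<alpha>) UNIV (padic_of_int (padic_Gamma x))"
    using has_psum_dwork_gamma[OF p5 a, of x] by (simp add: padic_Gamma_eq_dwork_gamma[OF p5])
  have \<alpha>: "(prime_padic - 1) * ?\<alpha> = of_nat a"
    using arg_cong[OF x, of padic_of_int] by (simp add: padic_of_int_mult padic_of_int_diff)
  have "has_psum (dwork_gamma_term a ?\<alpha>) UNIV ((1 - prime_padic) * dwork_gauss a)"
  proof (rule has_psum_natI[of 4])
    fix n
    show "vint (n div 4) (dwork_gamma_term a ?\<alpha> n)"
      by (intro vint_dwork_gamma_term p5 a) simp
    define R where "R = (\<Sum>j<n. dwork_matrix a (n - 1) j *
      ((- 1) ^ (n - 1 - j) * pochhammer (?\<alpha> + of_nat j + 1) (n - 1 - j)))"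
    have unit: "vint 0 ((- 1) ^ m * pochhammer (?\<alpha> + of_nat j + 1) m)" for m j
      by (intro vint_mult_right vint_power vint_minus vint_pochhammer vint_add vint_1 vint_of_nat vint_padic_of_int)
    have "vint ((n - 1) div 4) R"
      unfolding R_def by (intro vint_sum vint_mult_left vint_dwork_matrix p5 a unit)
    \<comment> \<open>The boundary term involves row \<open>n - 1\<close> of the matrix; the factor
      \<open>p\<close> in front makes up for the missing index.\<close>
    then have "vint (1 + (n - 1) div 4) (prime_padic * R)"
      using vint_prime_power[of 1, where 'p = 'p] by (intro vint_mult) simp_all
    then have 1: "vint (n div 4) (prime_padic * R)"
      by (rule vint_mono) linarith
    have "vint 0 (1 - prime_padic :: 'p padic)"
      by (intro vint_diff vint_1 vint_of_nat)
    moreover have "vint (n div 4) (dwork_gauss a - (\<Sum>k<n. dwork_gauss_term a k) :: 'p padic)"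
      by (rule has_psum_natD[OF has_psum_dwork_gauss[OF p5 a]]) (rule vint_dwork_gauss_term[OF p5 a])
    ultimately have "vint (n div 4) ((1 - prime_padic) * (dwork_gauss a - (\<Sum>k<n. dwork_gauss_term a k)) :: 'p padic)"
      by (rule vint_mult_right)
    then have "vint (n div 4) ((1 - prime_padic) * (dwork_gauss a - (\<Sum>k<n. dwork_gauss_term a k)) - prime_padic * R)"
      using 1 by (rule vint_diff)
    then show "vint (n div 4) ((1 - prime_padic) * dwork_gauss a - (\<Sum>k<n. dwork_gamma_term a ?\<alpha> k))"
      unfolding right_diff_distrib dwork_trace_formula[OF a \<alpha>] R_def[symmetric] by (simp add: algebra_simps)
  qed simp
  with G show ?thesis
    by (rule has_psum_unique)
qed

section \<open>The Teichmueller character\<close>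

text \<open>In x^p - y^p = (x - y) (x^(p - 1) + ... + y^(p - 1)) the second factor is congruent to p
  y^(p - 1), hence to 0, modulo \<open>p\<close>.\<close>

lemma padic_power_prime_cong:
  fixes x y :: "'p::prime_card padic_int"
  assumes "padic_p ^ Suc n dvd x - y"
  shows "padic_p ^ Suc (Suc n) dvd x ^ CARD('p) - y ^ CARD('p)"
proof -
  obtain q where q: "CARD('p) = Suc q"
    by (rule CARD_eq_SucE)
  have xy: "padic_p dvd x - y"
    using assms by (rule dvd_trans[rotated]) simp
  have "padic_p dvd x ^ i * y ^ (q - i) - y ^ q" if "i < Suc q" for i
  proof -
    have "y ^ q = y ^ i * y ^ (q - i)"
      using that by (simp flip: power_add)
    then have "x ^ i * y ^ (q - i) - y ^ q = (x ^ i - y ^ i) * y ^ (q - i)"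
      by (simp only: left_diff_distrib)
    moreover have "x - y dvd x ^ i - y ^ i"
      using diff_power_eq_sum[of x "i - 1" y] by (cases i) simp_all
    ultimately show ?thesis
      using dvd_mult2[OF dvd_trans[OF xy]] by simp
  qed
  then have "padic_p dvd (\<Sum>i<Suc q. x ^ i * y ^ (q - i) - y ^ q)"
    by (intro dvd_sum) simp
  then have "padic_p dvd (\<Sum>i<Suc q. x ^ i * y ^ (q - i)) - of_nat (Suc q) * y ^ q"
    by (simp only: sum_subtractf sum_constant card_lessThan)
  then have "padic_p dvd (\<Sum>i<Suc q. x ^ i * y ^ (q - i)) - padic_p * y ^ q + padic_p * y ^ q"
    unfolding q by (rule dvd_add) (rule dvd_triv_left)
  then have "padic_p dvd (\<Sum>i<Suc q. x ^ i * y ^ (q - i))"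
    by (simp only: diff_add_cancel)
  then have "padic_p ^ Suc n * padic_p dvd (x - y) * (\<Sum>i<Suc q. x ^ i * y ^ (q - i))"
    by (rule mult_dvd_mono[OF assms])
  then show ?thesis
    by (simp only: diff_power_eq_sum[symmetric] power_Suc[of _ "Suc n"] mult.commute q)
qed

section \<open>Reduction modulo \<open>p\<close> and lifting of roots of unity\<close>

lemma of_int_mod_ring_eq_0_iff:
  "(of_int k :: 'p::prime_card mod_ring) = 0 \<longleftrightarrow> (padic_p :: 'p padic_int) dvd of_int k"
  using padic_p_dvd_of_int_iff[of 1 k, where 'p = 'p] by (simp add: of_int_eq_0_iff_char_dvd)

lemma of_int_to_int_mod_ring [simp]: "of_int (to_int_mod_ring a) = (a :: 'p::prime_card mod_ring)"
  by (simp add: of_int_of_int_mod_ring)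

definition reduces :: "'p::prime_card padic_int \<Rightarrow> 'p mod_ring \<Rightarrow> bool" where
  "reduces x a \<longleftrightarrow> padic_p dvd x - of_int (to_int_mod_ring a)"

lemma reduces_iff: "of_int k = a \<Longrightarrow> reduces x a \<longleftrightarrow> padic_p dvd x - of_int k"
  for a :: "'p::prime_card mod_ring"
proof -
  assume "of_int k = a"
  then have "of_int (k - to_int_mod_ring a) = (0 :: 'p mod_ring)"
    by simp
  then have "(padic_p :: 'p padic_int) dvd of_int (k - to_int_mod_ring a)"
    unfolding of_int_mod_ring_eq_0_iff .
  then have d: "(padic_p :: 'p padic_int) dvd of_int k - of_int (to_int_mod_ring a)"
    by simp
  show ?thesis
    unfolding reduces_def
  proof
    assume "padic_p dvd x - of_int k"
    then have "padic_p dvd (x - of_int k) + (of_int k - of_int (to_int_mod_ring a))"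
      using d by (rule dvd_add)
    then show "padic_p dvd x - of_int (to_int_mod_ring a)"
      by simp
  next
    assume "padic_p dvd x - of_int (to_int_mod_ring a)"
    then have "padic_p dvd (x - of_int (to_int_mod_ring a)) - (of_int k - of_int (to_int_mod_ring a))"
      using d by (rule dvd_diff)
    then show "padic_p dvd x - of_int k"
      by simp
  qed
qed

lemma reduces_add:
  assumes "reduces x a" "reduces y b"
  shows "reduces (x + y) (a + b)"
proof -
  have "padic_p dvd (x - of_int (to_int_mod_ring a)) + (y - of_int (to_int_mod_ring b))"
    using assms unfolding reduces_def by (rule dvd_add)
  then have "padic_p dvd (x + y) - of_int (to_int_mod_ring a + to_int_mod_ring b)"
    by (simp add: algebra_simps)
  then show ?thesis
    by (subst reduces_iff[of "to_int_mod_ring a + to_int_mod_ring b"]) simp_all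
qed

lemma reduces_mult:
  assumes "reduces x a" "reduces y b"
  shows "reduces (x * y) (a * b)"
proof -
  have "padic_p dvd (x - of_int (to_int_mod_ring a)) * y
      + of_int (to_int_mod_ring a) * (y - of_int (to_int_mod_ring b))"
    using assms unfolding reduces_def by (intro dvd_add dvd_mult dvd_mult2)
  then have "padic_p dvd (x * y) - of_int (to_int_mod_ring a * to_int_mod_ring b)"
    by (simp add: algebra_simps)
  then show ?thesis
    by (subst reduces_iff[of "to_int_mod_ring a * to_int_mod_ring b"]) simp_all
qed

lemma reduces_of_int: "reduces (of_int k) (of_int k)"
  by (subst reduces_iff[OF refl]) simp

lemma reduces_1: "reduces 1 1"
  using reduces_of_int[of 1] by simp

lemma reduces_unique:
  fixes a b :: "'p::prime_card mod_ring"
  assumes "reduces x a" "reduces x b"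
  shows "a = b"
proof -
  have "(padic_p :: 'p padic_int) dvd (x - of_int (to_int_mod_ring b)) - (x - of_int (to_int_mod_ring a))"
    using assms(2,1) unfolding reduces_def by (rule dvd_diff)
  then have "(padic_p :: 'p padic_int) dvd of_int (to_int_mod_ring a - to_int_mod_ring b)"
    by simp
  then have "(of_int (to_int_mod_ring a - to_int_mod_ring b) :: 'p mod_ring) = 0"
    unfolding of_int_mod_ring_eq_0_iff .
  then show ?thesis
    by simp
qed

text \<open>Both roots are fixed by the p-th power map, which improves every congruence between them
  by one power of \<open>p\<close>.\<close>

lemma padic_root_of_unity_unique:
  fixes z w :: "'p::prime_card padic_int"
  assumes "z ^ (CARD('p) - 1) = 1" "w ^ (CARD('p) - 1) = 1" "padic_p dvd z - w"
  shows "z = w"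
proof (rule padic_int_eqI_dvd)
  obtain q where q: "CARD('p) = Suc q"
    by (rule CARD_eq_SucE)
  have pow: "z ^ CARD('p) = z" "w ^ CARD('p) = w"
    using assms(1,2) unfolding q by simp_all
  have k: "padic_p ^ Suc n dvd z - w" for n
  proof (induction n)
    case 0
    show ?case
      using assms(3) by simp
  next
    case (Suc n)
    show ?case
      using padic_power_prime_cong[OF Suc] unfolding pow .
  qed
  show "padic_p ^ n dvd z - w" for n
    using k[of n] by (rule power_le_dvd) simp
qed

text \<open>The root is the limit of \<open>k ^ (p ^ n)\<close>: Fermat's theorem gives the first
  congruence and p-th powers improve it.\<close>

lemma padic_root_of_unity_exists:
  assumes "\<not> CARD('p::prime_card) dvd k"
  shows "\<exists>z :: 'p padic_int. z ^ (CARD('p) - 1) = 1 \<and> padic_p dvd z - of_nat k"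
proof -
  let ?p = "CARD('p)"
  define s :: "nat \<Rightarrow> 'p padic_int" where "s n = of_nat k ^ (?p ^ n)" for n
  have s_Suc: "s (Suc n) = s n ^ ?p" for n
    unfolding s_def power_Suc2 by (rule power_mult)
  obtain q where q: "?p = Suc q"
    by (rule CARD_eq_SucE)
  have "[k ^ q = 1] (mod ?p)"
    using fermat_theorem[OF prime_card[where 'a = 'p] assms] q by simp
  then have "[k * k ^ q = k * 1] (mod ?p)"
    by (rule cong_scalar_left)
  then have "[int (k ^ ?p) = int k] (mod int ?p)"
    unfolding q cong_int_iff by simp
  then have "int ?p ^ 1 dvd int (k ^ ?p) - int k"
    by (simp add: cong_iff_dvd_diff)
  then have "(padic_p :: 'p padic_int) ^ 1 dvd of_int (int (k ^ ?p) - int k)"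
    unfolding padic_p_dvd_of_int_iff .
  then have 0: "padic_p ^ Suc 0 dvd s (Suc 0) - s 0"
    by (simp add: s_def)
  have step: "padic_p ^ Suc n dvd s (Suc n) - s n" for n
  proof (induction n)
    case (Suc n)
    show ?case
      using padic_power_prime_cong[OF Suc] unfolding s_Suc .
  qed (rule 0)
  have "padic_p ^ n dvd s (Suc n) - s n" for n
    using step[of n] by (rule power_le_dvd) simp
  from padic_complete[of s, OF this] obtain z where z: "\<And>n. padic_p ^ n dvd z - s n"
    by metis
  have "z ^ ?p = z"
  proof (rule padic_int_eqI_dvd)
    fix n
    have "padic_p ^ Suc (Suc n) dvd z ^ ?p - s (Suc (Suc n))"
      using padic_power_prime_cong[OF z[of "Suc n"]] unfolding s_Suc .
    then have "padic_p ^ Suc (Suc n) dvd (z ^ ?p - s (Suc (Suc n))) - (z - s (Suc (Suc n)))"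
      using z by (rule dvd_diff)
    then have "padic_p ^ Suc (Suc n) dvd z ^ ?p - z"
      by simp
    then show "padic_p ^ n dvd z ^ ?p - z"
      by (rule power_le_dvd) simp
  qed
  then have "z * (z ^ (?p - 1) - 1) = 0"
    using q by (simp add: right_diff_distrib)
  moreover have zk: "padic_p dvd z - of_nat k"
  proof -
    have "padic_p dvd (z - s 1) + (s 1 - s 0)"
      using z[of 1] 0 by (intro dvd_add) simp_all
    then show ?thesis
      by (simp add: s_def)
  qed
  moreover have "z \<noteq> 0"
  proof
    assume "z = 0"
    then have "(padic_p :: 'p padic_int) dvd of_nat k"
      using zk by simp
    then show False
      using assms unfolding padic_p_dvd_of_nat_iff by simp
  qed
  ultimately show ?thesis
    by (intro exI[of _ z]) simp
qed

lemma
  fixes a :: "'p::prime_card mod_ring"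
  assumes "a \<noteq> 0"
  shows teichmueller_power_card: "teichmueller a ^ (CARD('p) - 1) = 1"
    and reduces_teichmueller: "reduces (teichmueller a) a"
proof -
  let ?k = "nat (to_int_mod_ring a)"
  have k: "int ?k = to_int_mod_ring a"
  proof -
    have "to_int_mod_ring a \<in> {0..<int CARD('p)}"
      unfolding range_to_int_mod_ring[symmetric] by (rule rangeI)
    then show ?thesis
      by simp
  qed
  have k': "(of_nat ?k :: 'p padic_int) = of_int (to_int_mod_ring a)"
    using of_int_of_nat_eq[of ?k, where 'a = "'p padic_int"] unfolding k by (rule sym)
  have "\<not> CARD('p) dvd ?k"
  proof
    assume "CARD('p) dvd ?k"
    then have "int CARD('p) dvd int ?k"
      by (simp only: of_nat_dvd_iff)
    then have "int CARD('p) dvd to_int_mod_ring a"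
      unfolding k .
    then show False
      using assms of_int_eq_0_iff_char_dvd[of "to_int_mod_ring a", where 'a = "'p mod_ring"] by simp
  qed
  then have "\<exists>z :: 'p padic_int. z ^ (CARD('p) - 1) = 1 \<and> padic_p dvd z - of_nat ?k"
    by (rule padic_root_of_unity_exists)
  then have "\<exists>z :: 'p padic_int. z ^ (CARD('p) - 1) = 1 \<and> padic_p dvd z - of_int (to_int_mod_ring a)"
    unfolding k' .
  then have "\<exists>!z :: 'p padic_int. z ^ (CARD('p) - 1) = 1 \<and> padic_p dvd z - of_int (to_int_mod_ring a)"
  proof (rule ex_ex1I)
    fix z w :: "'p padic_int"
    assume z: "z ^ (CARD('p) - 1) = 1 \<and> padic_p dvd z - of_int (to_int_mod_ring a)"
      and w: "w ^ (CARD('p) - 1) = 1 \<and> padic_p dvd w - of_int (to_int_mod_ring a)"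
    have "padic_p dvd (z - of_int (to_int_mod_ring a)) - (w - of_int (to_int_mod_ring a))"
      by (rule dvd_diff[OF conjunct2[OF z] conjunct2[OF w]])
    then have "padic_p dvd z - w"
      unfolding diff_diff_eq2 diff_add_cancel .
    then show "z = w"
      by (rule padic_root_of_unity_unique[OF conjunct1[OF z] conjunct1[OF w]])
  qed
  from theI'[OF this] show "teichmueller a ^ (CARD('p) - 1) = 1" "reduces (teichmueller a) a"
    unfolding teichmueller_def reduces_def by (rule conjunct1, rule conjunct2)
qed

lemma teichmueller_eqI:
  fixes a :: "'p::prime_card mod_ring"
  assumes "a \<noteq> 0" "z ^ (CARD('p) - 1) = 1" "reduces z a"
  shows "teichmueller a = z"
proof (rule padic_root_of_unity_unique[OF teichmueller_power_card[OF assms(1)] assms(2)])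
  have "padic_p dvd (teichmueller a - of_int (to_int_mod_ring a)) - (z - of_int (to_int_mod_ring a))"
    using reduces_teichmueller[OF assms(1)] assms(3) unfolding reduces_def by (rule dvd_diff)
  then show "padic_p dvd teichmueller a - z"
    unfolding diff_diff_eq2 diff_add_cancel .
qed

lemma teichmueller_1 [simp]: "teichmueller 1 = 1"
  by (rule teichmueller_eqI) (simp_all add: reduces_1)

lemma teichmueller_mult:
  "a \<noteq> 0 \<Longrightarrow> b \<noteq> 0 \<Longrightarrow> teichmueller (a * b) = teichmueller a * teichmueller b"
  by (rule teichmueller_eqI)
    (simp_all add: power_mult_distrib teichmueller_power_card reduces_mult reduces_teichmueller
      del: One_nat_def)

lemma teichmueller_power: "a \<noteq> 0 \<Longrightarrow> teichmueller (a ^ n) = teichmueller a ^ n"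
  by (induction n) (simp_all add: teichmueller_mult)

lemma teichmueller_inj: "a \<noteq> 0 \<Longrightarrow> b \<noteq> 0 \<Longrightarrow> teichmueller a = teichmueller b \<longleftrightarrow> a = b"
  by (rule iffI, rule reduces_unique[OF reduces_teichmueller]) (simp_all add: reduces_teichmueller)

lemma teichmueller_minus_1:
  assumes "2 < CARD('p::prime_card)"
  shows "teichmueller (- 1 :: 'p mod_ring) = - 1"
proof (rule teichmueller_eqI)
  have "odd CARD('p)"
    by (rule prime_odd_nat[OF prime_card assms])
  then have "even (CARD('p) - 1)"
    by simp
  then show "(- 1 :: 'p padic_int) ^ (CARD('p) - 1) = 1"
    by (rule neg_one_even_power)
  show "reduces (- 1) (- 1 :: 'p mod_ring)"
    using reduces_of_int[of "- 1"] by (simp only: of_int_minus of_int_1)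
  show "(- 1 :: 'p mod_ring) \<noteq> 0"
    by (simp only: neg_equal_0_iff_equal one_neq_zero not_False_eq_True)
qed

section \<open>Orthogonality of the powers of the lift\<close>

lemma mod_ring_power_card_minus_1:
  fixes g :: "'p::prime_card mod_ring"
  assumes "g \<noteq> 0"
  shows "g ^ (CARD('p) - 1) = 1"
  using teichmueller_inj[of "g ^ (CARD('p) - 1)" 1] teichmueller_power[OF assms]
    teichmueller_power_card[OF assms] assms by simp

text \<open>The exponent reduced modulo \<open>p - 1\<close> is positive and smaller than the number
  of units, so the corresponding polynomial X^r - 1 cannot vanish at all of them.\<close>

lemma mod_ring_power_neq_1:
  assumes "\<not> CARD('p::prime_card) - 1 dvd k"
  shows "\<exists>g :: 'p mod_ring. g \<noteq> 0 \<and> g ^ k \<noteq> 1"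
proof (rule ccontr)
  let ?q = "CARD('p) - 1" and ?r = "k mod (CARD('p) - 1)"
  assume contra: "\<not> (\<exists>g :: 'p mod_ring. g \<noteq> 0 \<and> g ^ k \<noteq> 1)"
  have q: "?q > 0"
    using CARD_gt_1(1)[where 'p = 'p] by linarith
  have "?r \<noteq> 0"
    using assms by (simp add: dvd_eq_mod_eq_0)
  define f :: "'p mod_ring poly" where "f = monom 1 ?r - 1"
  have root: "poly f g = 0" if "g \<noteq> 0" for g
  proof -
    have "g ^ k = g ^ (?q * (k div ?q) + ?r)"
      by simp
    also have "\<dots> = g ^ ?r"
      unfolding power_add power_mult mod_ring_power_card_minus_1[OF that] by simp
    finally show ?thesis
      using contra that by (auto simp: f_def poly_monom)
  qed
  have "f \<noteq> 0"
  proof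
    assume "f = 0"
    then have "coeff f ?r = 0"
      by simp
    then show False
      using \<open>?r \<noteq> 0\<close> by (simp add: f_def)
  qed
  then have "card {g. poly f g = 0} \<le> degree f"
    by (rule card_poly_roots_bound)
  also have "degree f \<le> ?r"
    unfolding f_def by (intro degree_diff_le degree_monom_le) simp
  also have "?r < ?q"
    using q by simp
  also have "?q = card (UNIV - {0 :: 'p mod_ring})"
    by (simp add: card_Diff_singleton)
  also have "\<dots> \<le> card {g. poly f g = 0}"
    using root by (intro card_mono) auto
  finally show False
    by simp
qed

lemma sum_teichmueller_powers:
  "(\<Sum>u | u \<noteq> (0 :: 'p::prime_card mod_ring). padic_of_int (teichmueller u) ^ k)
    = (if CARD('p) - 1 dvd k then of_nat (CARD('p) - 1) else 0)"
proof -
  let ?U = "{u :: 'p mod_ring. u \<noteq> 0}" and ?S = "\<Sum>u | u \<noteq> (0 :: 'p mod_ring). teichmueller u ^ k"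
  have card: "card ?U = CARD('p) - 1"
  proof -
    have "?U = UNIV - {0}"
      by auto
    then show ?thesis
      by (simp add: card_Diff_singleton)
  qed
  have "?S = (if CARD('p) - 1 dvd k then of_nat (CARD('p) - 1) else 0)"
  proof (cases "CARD('p) - 1 dvd k")
    case True
    then obtain m where m: "k = (CARD('p) - 1) * m" ..
    have "teichmueller u ^ k = 1" if "u \<in> ?U" for u :: "'p mod_ring"
    proof -
      have "teichmueller u ^ (CARD('p) - 1) = 1"
        using that by (intro teichmueller_power_card) simp
      then show ?thesis
        unfolding m power_mult by (simp only: power_one)
    qed
    then have "?S = (\<Sum>u\<in>?U. 1)"
      by (intro sum.cong) auto
    then show ?thesis
      using True card by simp
  next
    case False
    then obtain g :: "'p mod_ring" where g: "g \<noteq> 0" "g ^ k \<noteq> 1"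
      using mod_ring_power_neq_1[where 'p = 'p] by blast
    have "?S = (\<Sum>u\<in>?U. teichmueller (g * u) ^ k)"
      by (rule sum.reindex_bij_witness[of _ "\<lambda>u. g * u" "\<lambda>u. u / g"]) (use g in auto)
    also have "\<dots> = (\<Sum>u\<in>?U. teichmueller g ^ k * teichmueller u ^ k)"
      using g by (intro sum.cong) (simp_all add: teichmueller_mult power_mult_distrib)
    also have "\<dots> = teichmueller (g ^ k) * ?S"
      using g by (simp add: sum_distrib_left teichmueller_power)
    finally have "(teichmueller (g ^ k) - 1) * ?S = 0"
      by (simp add: left_diff_distrib)
    moreover have "teichmueller (g ^ k) \<noteq> 1"
      using g teichmueller_inj[of "g ^ k" 1] by simp
    ultimately show ?thesis
      using False by simp
  qed
  then have "padic_of_int ?S = padic_of_int (if CARD('p) - 1 dvd k then of_nat (CARD('p) - 1) else 0)"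
    by (rule arg_cong)
  then show ?thesis
    unfolding padic_of_int_sum padic_of_int_power by (simp only: if_distrib[of padic_of_int] padic_of_int_of_nat padic_of_int_0)
qed

lemma sum_root_of_unity_powers:
  fixes z :: "'p::prime_card padic"
  assumes "z ^ n = 1"
  shows "(\<Sum>j<n. z ^ j) = (if z = 1 then of_nat n else 0)"
  using assms by (simp add: sum_gp_strict)

text \<open>
  Replacing \<open>v\<close> by \<open>v + p s\<close> multiplies the series by \<open>exp (p s (z + z\<^sup>p / p))\<close>, which converges at the
  root \<open>z\<close> of \<open>z + z\<^sup>p / p\<close> where the sums \<open>\<Sum>k. (-p)\<^sup>k f (a + (p - 1) k)\<close> evaluate the series.
\<close>

lemma has_psum_dwork_fps_shift:
  fixes v s S :: "'p::prime_card padic"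
  assumes p5: "5 \<le> CARD('p)" and a: "a < CARD('p) - 1" and s: "vint 0 s"
    and v: "v ^ (CARD('p) - 1) = 1" "vint 0 v"
    and S: "has_psum (\<lambda>i. (- prime_padic) ^ i * dwork_fps v $ (a + (CARD('p) - 1) * i)) UNIV S"
  shows "has_psum (\<lambda>i. (- prime_padic) ^ i * dwork_fps (v + prime_padic * s) $ (a + (CARD('p) - 1) * i)) UNIV S"
proof -
  let ?p = "CARD('p)"
  define q where "q = ?p - 1"
  have q: "?p = Suc q"
    using CARD_gt_1(2)[where 'p = 'p] by (simp add: q_def)
  define \<delta> where "\<delta> = prime_padic * s"
  \<comment> \<open>Expand exp (\<delta> (z + z^p / p)) into \<delta>^k / k! z^k (1 + z^q / p)^k.
    The evaluation puts z^q = -p. Here \<open>\<psi> k i\<close> is the part of z^k times the series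
    for \<open>v\<close>, and \<open>\<Phi>\<close> selects the j-th binomial term, for which z^(q
    j) / p^j becomes (-1)^j.\<close>
  define \<psi> where "\<psi> k i = (- prime_padic) ^ i * (\<delta> ^ k / fact k) *
    (if k \<le> a + q * i then dwork_fps v $ (a + q * i - k) else 0)" for k i
  define \<Phi> where "\<Phi> x j = (- 1) ^ j * of_nat (fst x choose j) * \<psi> (fst x) (snd x)" for x and j :: nat
  define \<Omega> where "\<Omega> = (SIGMA x : UNIV \<times> (UNIV :: nat set). {..fst x :: nat})"

  have \<delta>_pow: "vint (k - k div 4) (\<delta> ^ k / fact k)" for k
  proof -
    obtain u e where u: "\<not> ?p dvd u" "4 * e \<le> k" "fact k = ?p ^ e * u"
      using fact_eq_small_prime_power_mult[OF prime_card p5] by blast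
    have "k = e + (k - e)"
      using u(2) by simp
    then have "prime_padic ^ k = (prime_padic ^ e * prime_padic ^ (k - e) :: 'p padic)"
      by (simp flip: power_add)
    moreover have "(fact k :: 'p padic) = prime_padic ^ e * of_nat u"
      using arg_cong[OF u(3), of "of_nat :: nat \<Rightarrow> 'p padic"] by simp
    ultimately have "\<delta> ^ k / fact k = prime_padic ^ (k - e) * s ^ k / of_nat u"
      by (simp add: \<delta>_def power_mult_distrib)
    moreover have "vint (k - e) \<dots>"
      by (intro vint_divide_of_nat vint_mult_left vint_prime_power vint_power s u)
    moreover have "k - k div 4 \<le> k - e"
      using u(2) by linarith
    ultimately show ?thesis
      by (metis vint_mono)
  qed
  have vint_\<psi>: "vint (k - k div 4 + i div 4) (\<psi> k i)" for k i
  proof (cases "k \<le> a + q * i")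
    case True
    have "a + q * i - k \<le> a + q * i"
      by simp
    also have "\<dots> < Suc i * ?p"
      using a by (simp add: q algebra_simps)
    finally have "a + q * i - k < Suc i * ?p" .
    then have "(a + q * i - k) div ?p \<le> i"
      by (simp add: less_mult_imp_div_less flip: less_Suc_eq_le)
    then have "vint (i div 4) ((- prime_padic) ^ i * dwork_coeff (a + q * i - k) * v ^ (a + q * i - k))"
      by (intro vint_mult_left vint_minus_power_dwork_coeff p5 vint_power v)
    from vint_mult[OF \<delta>_pow this, of k] show ?thesis
      using True by (simp add: \<psi>_def dwork_fps_scale[OF v(1)] ac_simps)
  qed (simp add: \<psi>_def)
  have vint_\<Phi>: "vint n (\<Phi> (k, i) j)" if "n \<le> k - k div 4 + i div 4" for n k i j
  proof -
    have "vint 0 ((- 1) ^ j * of_nat (k choose j) :: 'p padic)"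
      by (intro vint_mult_left vint_power vint_minus vint_1 vint_of_nat)
    then show ?thesis
      unfolding \<Phi>_def fst_conv snd_conv by (rule vint_mult_right[OF _ vint_mono[OF vint_\<psi> that]])
  qed

  \<comment> \<open>Summability over all triples (k, i, j) at once permits the two regroupings that
    follow.\<close>
  obtain S' where S': "has_psum (\<lambda>(x, j). \<Phi> x j) \<Omega> S'"
  proof -
    have "\<exists>S'. has_psum (\<lambda>(x, j). \<Phi> x j) \<Omega> S'"
    proof (rule has_psum_exists)
      show "vint 0 ((\<lambda>(x, j). \<Phi> x j) \<omega>)" for \<omega>
        by (cases \<omega>) (auto intro: vint_\<Phi>)
      fix n
      show "finite {\<omega> \<in> \<Omega>. \<not> vint n ((\<lambda>(x, j). \<Phi> x j) \<omega>)}"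
      proof (rule finite_subset)
        show "finite (SIGMA x : {..<2 * n} \<times> {..<4 * n}. {..fst x})"
          by (intro finite_SigmaI) auto
        show "{\<omega> \<in> \<Omega>. \<not> vint n ((\<lambda>(x, j). \<Phi> x j) \<omega>)} \<subseteq> (SIGMA x : {..<2 * n} \<times> {..<4 * n}. {..fst x})"
        proof
          fix \<omega>
          assume \<omega>: "\<omega> \<in> {\<omega> \<in> \<Omega>. \<not> vint n ((\<lambda>(x, j). \<Phi> x j) \<omega>)}"
          obtain k i j where eq: "\<omega> = ((k, i), j)"
            by (metis prod.exhaust)
          have "\<not> n \<le> k - k div 4 + i div 4"
            using \<omega> vint_\<Phi>[of n k i j] by (auto simp: eq)
          then have "k < 2 * n" "i < 4 * n"
            by linarith+
          then show "\<omega> \<in> (SIGMA x : {..<2 * n} \<times> {..<4 * n}. {..fst x})"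
            using \<omega> by (auto simp: eq \<Omega>_def)
        qed
      qed
    qed
    then show thesis
      using that by blast
  qed

  have "has_psum (\<lambda>x. \<Sum>j\<le>fst x. \<Phi> x j) (UNIV \<times> UNIV) S'"
    using S' unfolding \<Omega>_def by (rule has_psum_SigmaD) (rule has_psum_finite, simp)
  \<comment> \<open>Summing over \<open>j\<close> first: the factor 1 + z^q / p vanishes at z^q =
    -p, so only k = 0 survives and the series for \<open>v\<close> is left.\<close>
  moreover have inner: "(\<Sum>j\<le>fst x. \<Phi> x j) = (if fst x = 0 then \<psi> 0 (snd x) else 0)" for x
  proof (cases "fst x = 0")
    case False
    have "(\<Sum>j\<le>fst x. \<Phi> x j) = (\<Sum>j\<le>fst x. (- 1) ^ j * of_nat (fst x choose j)) * \<psi> (fst x) (snd x)"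
      by (simp add: \<Phi>_def sum_distrib_right)
    then show ?thesis
      using False choose_alternating_sum[of "fst x", where 'a = "'p padic"] by simp
  qed (simp add: \<Phi>_def)
  ultimately have "has_psum (\<lambda>x :: nat \<times> nat. if fst x = 0 then \<psi> 0 (snd x) else 0) (UNIV \<times> UNIV) S'"
    by (simp only: inner)
  then have "has_psum (\<lambda>x :: nat \<times> nat. if fst x = 0 then \<psi> 0 (snd x) else 0) ({0} \<times> UNIV) S'"
    by (subst has_psum_neutral[of _ "UNIV \<times> UNIV"]) auto
  moreover have "bij_betw (Pair (0 :: nat)) UNIV ({0} \<times> (UNIV :: nat set))"
    by (auto simp: bij_betw_def inj_on_def)
  ultimately have "has_psum (\<lambda>i. if fst (0 :: nat, i) = 0 then \<psi> 0 (snd (0 :: nat, i)) else 0) UNIV S'"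
    by (subst has_psum_reindex)
  then have left: "has_psum (\<lambda>i. (- prime_padic) ^ i * dwork_fps v $ (a + q * i)) UNIV S'"
    by (simp add: \<psi>_def)

  \<comment> \<open>The other grouping collects total degree a + q i: the binomial term
    \<open>j\<close> raises the index from \<open>i - j\<close> to \<open>i\<close>. The set
    \<open>I\<close> leaves out the triples where \<open>\<psi>\<close> is 0 by its case
    distinction.\<close>
  define W where "W i = {(j, k). j \<le> i \<and> j \<le> k \<and> k \<le> a + q * (i - j)}" for i
  define I where "I = {x \<in> \<Omega>. fst (fst x) \<le> a + q * snd (fst x)}"
  have fin: "finite (W i)" for i
  proof (rule finite_subset)
    show "W i \<subseteq> {..i} \<times> {..a + q * i}"
      by (auto simp: W_def intro: order_trans add_left_mono mult_le_mono2 diff_le_self)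
  qed simp
  have "has_psum (\<lambda>(x, j). \<Phi> x j) I S'"
    by (rule iffD2[OF has_psum_neutral S']) (auto simp: I_def \<Phi>_def \<psi>_def)
  moreover have bij: "bij_betw (\<lambda>(i, (j, k)). ((k, i - j), j)) (Sigma UNIV W) I"
    by (rule bij_betw_byWitness[where f' = "\<lambda>((k, i), j). (i + j, (j, k))"])
      (auto simp: W_def I_def \<Omega>_def)
  ultimately have "has_psum (\<lambda>x. (\<lambda>(x, j). \<Phi> x j) ((\<lambda>(i, (j, k)). ((k, i - j), j)) x)) (Sigma UNIV W) S'"
    by (subst has_psum_reindex[OF bij])
  then have "has_psum (\<lambda>(i, y). (\<lambda>(j, k). \<Phi> (k, i - j) j) y) (Sigma UNIV W) S'"
    by (simp add: case_prod_unfold)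
  then have "has_psum (\<lambda>i. \<Sum>(j, k)\<in>W i. \<Phi> (k, i - j) j) UNIV S'"
    by (rule has_psum_SigmaD) (rule has_psum_finite[OF fin])
  moreover have "(\<Sum>(j, k)\<in>W i. \<Phi> (k, i - j) j) = (- prime_padic) ^ i * dwork_fps (v + \<delta>) $ (a + q * i)" for i
  proof -
    let ?n = "a + q * i"
    have \<delta>_p: "\<delta> / prime_padic = s"
      by (simp add: \<delta>_def)
    have "dwork_fps (v + \<delta>) $ ?n = (\<Sum>m\<le>?n. dwork_fps \<delta> $ m * dwork_fps v $ (?n - m))"
      unfolding add.commute[of v] dwork_fps_add fps_mult_nth atLeast0AtMost ..
    also have "\<dots> = (\<Sum>m\<le>?n. \<Sum>j\<le>m div ?p. \<delta> ^ (m - ?p * j) / fact (m - ?p * j) * (s ^ j / fact j)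
        * dwork_fps v $ (?n - m))"
      unfolding dwork_fps_nth[of \<delta>] \<delta>_p sum_distrib_right ..
    also have "\<dots> = (\<Sum>(m, j)\<in>(SIGMA m : {..?n}. {..m div ?p}). \<delta> ^ (m - ?p * j) / fact (m - ?p * j) * (s ^ j / fact j)
        * dwork_fps v $ (?n - m))"
      by (subst sum.Sigma) auto
    finally have "(- prime_padic) ^ i * dwork_fps (v + \<delta>) $ ?n =
        (\<Sum>(m, j)\<in>(SIGMA m : {..?n}. {..m div ?p}). (- prime_padic) ^ i *
          (\<delta> ^ (m - ?p * j) / fact (m - ?p * j) * (s ^ j / fact j) * dwork_fps v $ (?n - m)))"
      by (simp add: sum_distrib_left case_prod_unfold)
    \<comment> \<open>In the coefficient of z^m, \<open>j\<close> counts the factors z^p / p and m -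
      p j the factors z. Each of them carries one \<delta>, so k = m - q j.\<close>
    also have "\<dots> = (\<Sum>(j, k)\<in>W i. \<Phi> (k, i - j) j)"
    proof (rule sum.reindex_bij_witness[of _ "\<lambda>(j, k). (k + q * j, j)" "\<lambda>(m, j). (j, m - q * j)"])
      fix x
      assume "x \<in> (SIGMA m : {..?n}. {..m div ?p})"
      then obtain m j where x: "x = (m, j)" and m: "m \<le> ?n" and "j \<le> m div ?p"
        by auto
      then have j: "q * j + j \<le> m"
        by (simp add: less_eq_div_iff_mult_less_eq q mult.commute add.commute)
      have "q * j < q * Suc i"
        using j m a by (simp add: q)
      then have ji: "j \<le> i"
        by (simp only: mult_less_cancel1 less_Suc_eq_le)
      then obtain d where d: "i = j + d"
        using le_Suc_ex by blast
      define l where "l = m - q * j - j"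
      have l: "m = l + j + q * j"
        using j by (simp add: l_def)
      have idx: "m - ?p * j = l" "?n - m = a + q * d - (l + j)" "m - q * j = l + j" "i - j = d"
        by (simp_all add: l q d algebra_simps)
      have le: "l + j \<le> a + q * d"
        using m by (simp add: l d algebra_simps)
      show "(\<lambda>(j, k). (k + q * j, j)) ((\<lambda>(m, j). (j, m - q * j)) x) = x"
        by (simp add: x l)
      show "(\<lambda>(m, j). (j, m - q * j)) x \<in> W i"
        using le ji by (simp add: x W_def idx)
      have "of_nat ((l + j) choose j) / (fact (l + j) :: 'p padic) = 1 / (fact l * fact j)"
        by (simp add: binomial_fact ac_simps)
      then have A: "\<delta> ^ l / fact l * (s ^ j / fact j) * prime_padic ^ j
          = of_nat ((l + j) choose j) / fact (l + j) * \<delta> ^ (l + j)"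
        by (simp add: \<delta>_def power_add power_mult_distrib)
      have B: "(- prime_padic) ^ i = ((- 1) ^ j * (- prime_padic) ^ d * prime_padic ^ j :: 'p padic)"
        unfolding d power_add power_minus[of prime_padic j] by (simp only: ac_simps)
      have "(- prime_padic) ^ i * (\<delta> ^ l / fact l * (s ^ j / fact j))
          = (- 1) ^ j * (- prime_padic) ^ d * (\<delta> ^ l / fact l * (s ^ j / fact j) * prime_padic ^ j)"
        unfolding B by (simp only: ac_simps)
      also have "\<dots> = (- 1) ^ j * of_nat ((l + j) choose j) * ((- prime_padic) ^ d * (\<delta> ^ (l + j) / fact (l + j)))"
        unfolding A by (simp only: divide_inverse ac_simps)
      finally have E: "(- 1) ^ j * of_nat ((l + j) choose j) * ((- prime_padic) ^ d * (\<delta> ^ (l + j) / fact (l + j)))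
          = (- prime_padic) ^ i * (\<delta> ^ l / fact l * (s ^ j / fact j))" ..
      have "\<Phi> (l + j, d) j = (- 1) ^ j * of_nat ((l + j) choose j) * ((- prime_padic) ^ d * (\<delta> ^ (l + j) / fact (l + j))) *
          dwork_fps v $ (a + q * d - (l + j))"
        using le by (simp only: \<Phi>_def \<psi>_def fst_conv snd_conv if_True mult.assoc)
      then show "(\<lambda>(j, k). \<Phi> (k, i - j) j) ((\<lambda>(m, j). (j, m - q * j)) x) =
          (\<lambda>(m, j). (- prime_padic) ^ i * (\<delta> ^ (m - ?p * j) / fact (m - ?p * j) * (s ^ j / fact j)
            * dwork_fps v $ (?n - m))) x"
        unfolding E x prod.case idx by (simp only: mult.assoc)
    next
      fix y
      assume "y \<in> W i"
      then obtain j k where y: "y = (j, k)" and jk: "j \<le> i" "j \<le> k" "k \<le> a + q * (i - j)"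
        by (auto simp: W_def)
      show "(\<lambda>(m, j). (j, m - q * j)) ((\<lambda>(j, k). (k + q * j, j)) y) = y"
        by (simp add: y)
      have "q * i = q * (i - j) + q * j"
        using jk(1) by (simp flip: distrib_left)
      then have "k + q * j \<le> ?n"
        using jk(3) by linarith
      moreover have "j \<le> (k + q * j) div ?p"
        using jk by (simp add: less_eq_div_iff_mult_less_eq q)
      ultimately show "(\<lambda>(j, k). (k + q * j, j)) y \<in> (SIGMA m : {..?n}. {..m div ?p})"
        by (simp add: y)
    qed
    finally show ?thesis ..
  qed
  ultimately have "has_psum (\<lambda>i. (- prime_padic) ^ i * dwork_fps (v + \<delta>) $ (a + q * i)) UNIV S'"
    by simp
  moreover have "S = S'"
    using S left unfolding q_def[symmetric] by (rule has_psum_unique)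
  ultimately show ?thesis
    unfolding q_def \<delta>_def by simp
qed

section \<open>Jacobi sums\<close>

lemma has_psum_0: "has_psum (\<lambda>_. 0) I 0"
  by (auto simp: has_psum_def intro!: exI[of _ "{}"])

lemma has_psum_convolution:
  fixes f g :: "nat \<Rightarrow> 'p::prime_card padic"
  assumes "has_psum f UNIV s" "has_psum g UNIV t"
    and f: "\<And>i. vint 0 (f i)" and g: "\<And>j. vint 0 (g j)"
  shows "has_psum (\<lambda>i. \<Sum>j\<le>i. f j * g (i - j)) UNIV (s * t)"
proof -
  have bij: "bij_betw (\<lambda>(i, j). (j, i - j)) (SIGMA i : UNIV. {..i}) (UNIV \<times> (UNIV :: nat set))"
    by (rule bij_betw_byWitness[where f' = "\<lambda>(j, k). (j + k, j)"]) auto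
  have "has_psum (\<lambda>(i, j). f i * g j) (UNIV \<times> UNIV) (s * t)"
    using assms by (intro has_psum_mult)
  then have "has_psum (\<lambda>x. (\<lambda>(i, j). f i * g j) ((\<lambda>(i, j). (j, i - j)) x)) (SIGMA i : UNIV. {..i}) (s * t)"
    by (rule iffD2[OF has_psum_reindex[OF bij]])
  then have "has_psum (\<lambda>(i, j). f j * g (i - j)) (SIGMA i : UNIV. {..i}) (s * t)"
    by (simp add: case_prod_unfold)
  then show ?thesis
    by (rule has_psum_SigmaD) (rule has_psum_finite, simp)
qed

lemma has_psum_shift:
  fixes f :: "nat \<Rightarrow> 'p::prime_card padic"
  assumes "has_psum f UNIV s"
  shows "has_psum (\<lambda>i. if i = 0 then 0 else f (i - 1)) UNIV s"
proof -
  have bij: "bij_betw Suc UNIV {0<..}"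
    by (rule bij_betw_byWitness[where f' = "\<lambda>i. i - 1"]) auto
  have "has_psum (\<lambda>i. (\<lambda>i. if i = 0 then 0 else f (i - 1)) (Suc i)) UNIV s"
    using assms by simp
  then have "has_psum (\<lambda>i. if i = 0 then 0 else f (i - 1)) {0<..} s"
    by (rule has_psum_reindexI[OF _ bij])
  then show ?thesis
    by (rule iffD1[OF has_psum_neutral, rotated 2]) auto
qed

text \<open>The parameter 1 + \<tau>(u) is in general no root of unity, but it is congruent to
  \<tau>(1 + u) modulo \<open>p\<close>. The shift lemma shows that the evaluated series depends
  only on this residue, and at \<tau>(1 + u) the scaling rule applies.\<close>

lemma has_psum_dwork_fps_teichmueller:
  fixes u :: "'p::prime_card mod_ring"
  assumes p5: "5 \<le> CARD('p)" and a: "a < CARD('p) - 1" and u: "u \<noteq> 0" "1 + u \<noteq> 0"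
  shows "has_psum (\<lambda>i. (- prime_padic) ^ i *
      dwork_fps (1 + padic_of_int (teichmueller u)) $ (a + (CARD('p) - 1) * i)) UNIV
    (padic_of_int (teichmueller (1 + u)) ^ a * dwork_gauss a)"
proof -
  define v where "v = padic_of_int (teichmueller (1 + u))"
  have v: "v ^ (CARD('p) - 1) = 1"
    using arg_cong[OF teichmueller_power_card[OF u(2)], of padic_of_int]
    unfolding v_def padic_of_int_power padic_of_int_1 .
  have red: "reduces (1 + teichmueller u) (1 + u)" "reduces (teichmueller (1 + u)) (1 + u)"
    by (rule reduces_add[OF reduces_1 reduces_teichmueller[OF u(1)]]) (rule reduces_teichmueller[OF u(2)])
  have "padic_p dvd (1 + teichmueller u - of_int (to_int_mod_ring (1 + u)))
      - (teichmueller (1 + u) - of_int (to_int_mod_ring (1 + u)))"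
    using red unfolding reduces_def by (rule dvd_diff)
  then have "padic_p dvd 1 + teichmueller u - teichmueller (1 + u)"
    unfolding diff_diff_eq2 diff_add_cancel .
  then obtain s where "1 + teichmueller u - teichmueller (1 + u) = padic_p * s" ..
  then have "1 + teichmueller u = teichmueller (1 + u) + padic_p * s"
    by (simp add: diff_eq_eq)
  from arg_cong[OF this, of padic_of_int]
  have eq: "1 + padic_of_int (teichmueller u) = v + prime_padic * padic_of_int s"
    by (simp add: padic_of_int_add padic_of_int_mult v_def)
  have a': "a < CARD('p)"
    using a by linarith
  have "has_psum (\<lambda>i. v ^ a * dwork_gauss_term a i) UNIV (v ^ a * dwork_gauss a)"
    by (intro has_psum_cmult has_psum_dwork_gauss p5 a' vint_power) (simp add: v_def)
  moreover have "v ^ a * dwork_gauss_term a i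
      = (- prime_padic) ^ i * dwork_fps v $ (a + (CARD('p) - 1) * i)" for i
    unfolding dwork_fps_scale[OF v] dwork_gauss_term_def power_add power_mult v by simp
  ultimately have "has_psum (\<lambda>i. (- prime_padic) ^ i * dwork_fps v $ (a + (CARD('p) - 1) * i)) UNIV (v ^ a * dwork_gauss a)"
    by (simp only:)
  then have "has_psum (\<lambda>i. (- prime_padic) ^ i *
      dwork_fps (v + prime_padic * padic_of_int s) $ (a + (CARD('p) - 1) * i)) UNIV (v ^ a * dwork_gauss a)"
    by (rule has_psum_dwork_fps_shift[OF p5 a vint_padic_of_int v, rotated]) (simp add: v_def)
  then show ?thesis
    unfolding eq v_def .
qed

text \<open>The functional equation splits the series at 1 + \<tau>(u) into those at 1 and
  \<tau>(u); orthogonality then keeps the degrees \<open>k\<close> congruent to \<open>b\<close>.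
  The natural number \<open>q - b\<close> stands for the exponent -b.\<close>

lemma sum_units_dwork_fps:
  fixes q :: nat
  assumes b: "b < q" and q: "q = CARD('p::prime_card) - 1"
  shows "(\<Sum>u | u \<noteq> (0 :: 'p mod_ring). padic_of_int (teichmueller u) ^ (q - b) *
      ((- prime_padic) ^ i * dwork_fps (1 + padic_of_int (teichmueller u)) $ n))
    = of_nat q * (\<Sum>k | k \<le> n \<and> q dvd q - b + k. (- prime_padic) ^ i * (dwork_coeff k * dwork_coeff (n - k)))"
proof -
  let ?U = "{u :: 'p mod_ring. u \<noteq> 0}" and ?t = "\<lambda>u :: 'p mod_ring. padic_of_int (teichmueller u)"
  have nth: "dwork_fps (1 + ?t u) $ n = (\<Sum>k\<le>n. ?t u ^ k * dwork_coeff k * dwork_coeff (n - k))" if "u \<in> ?U" for u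
  proof -
    have "u \<noteq> 0"
      using that by simp
    from arg_cong[OF teichmueller_power_card[OF this], of padic_of_int]
    have "?t u ^ (CARD('p) - 1) = 1"
      unfolding padic_of_int_power padic_of_int_1 .
    then show ?thesis
      unfolding add.commute[of 1] dwork_fps_add fps_mult_nth atLeast0AtMost by (simp only: dwork_fps_scale)
  qed
  have "(\<Sum>u\<in>?U. ?t u ^ (q - b) * ((- prime_padic) ^ i * dwork_fps (1 + ?t u) $ n))
      = (\<Sum>u\<in>?U. \<Sum>k\<le>n. ?t u ^ (q - b + k) * ((- prime_padic) ^ i * (dwork_coeff k * dwork_coeff (n - k))))"
  proof (intro sum.cong refl)
    fix u
    assume u: "u \<in> ?U"
    show "?t u ^ (q - b) * ((- prime_padic) ^ i * dwork_fps (1 + ?t u) $ n)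
        = (\<Sum>k\<le>n. ?t u ^ (q - b + k) * ((- prime_padic) ^ i * (dwork_coeff k * dwork_coeff (n - k))))"
      unfolding nth[OF u] sum_distrib_left power_add by (intro sum.cong refl) (simp only: ac_simps)
  qed
  also have "\<dots> = (\<Sum>k\<le>n. (\<Sum>u\<in>?U. ?t u ^ (q - b + k)) * ((- prime_padic) ^ i * (dwork_coeff k * dwork_coeff (n - k))))"
    unfolding sum_distrib_right by (rule sum.swap)
  also have "\<dots> = (\<Sum>k\<le>n. if q dvd q - b + k then
      of_nat q * ((- prime_padic) ^ i * (dwork_coeff k * dwork_coeff (n - k))) else 0)"
    unfolding sum_teichmueller_powers q[symmetric] by (intro sum.cong) simp_all
  also have "\<dots> = (\<Sum>k | k \<le> n \<and> q dvd q - b + k.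
      of_nat q * ((- prime_padic) ^ i * (dwork_coeff k * dwork_coeff (n - k))))"
    by (rule sum.mono_neutral_cong_right) auto
  finally show ?thesis
    unfolding sum_distrib_left .
qed

lemma dvd_shifted_iff:
  fixes q b k :: nat
  assumes "b < q"
  shows "q dvd q - b + k \<longleftrightarrow> (\<exists>j. k = b + q * j)"
proof
  assume "q dvd q - b + k"
  then obtain m where m: "q - b + k = q * m" ..
  then obtain j where "m = Suc j"
    using assms by (cases m) auto
  then have "k = b + q * j"
    using m assms by simp
  then show "\<exists>j. k = b + q * j" ..
next
  assume "\<exists>j. k = b + q * j"
  then obtain j where "k = b + q * j" ..
  then have "q - b + k = q * Suc j"
    using assms by simp
  then show "q dvd q - b + k"
    by simp
qed

text \<open>With k = b + q j the complementary degree is (a - b) + q (i - j). If b > a it has to be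
  written as (a + q - b) + q (i - 1 - j), and this borrow costs one factor -p. It is the trace left
  by the power \<pi>^(p - 1).\<close>

lemma dwork_gauss_convolution:
  fixes q :: nat
  assumes p5: "5 \<le> CARD('p::prime_card)" and q: "q = CARD('p) - 1" and a: "a < q" and b: "b < q"
  shows "has_psum (\<lambda>i. \<Sum>k | k \<le> a + q * i \<and> q dvd q - b + k.
      (- prime_padic) ^ i * (dwork_coeff k * dwork_coeff (a + q * i - k))) UNIV
    (if b \<le> a then dwork_gauss b * dwork_gauss (a - b) :: 'p padic
     else - prime_padic * (dwork_gauss b * dwork_gauss (a + q - b)))"
proof -
  have conv: "has_psum (\<lambda>i. \<Sum>j\<le>i. dwork_gauss_term b j * dwork_gauss_term c (i - j)) UNIV
      (dwork_gauss b * dwork_gauss c :: 'p padic)" if "c < q" for c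
    using that b by (intro has_psum_convolution has_psum_dwork_gauss p5 vint_mono[OF vint_dwork_gauss_term[OF p5]])
      (simp_all add: q)
  show ?thesis
  proof (cases "b \<le> a")
    case True
    have "(\<Sum>k | k \<le> a + q * i \<and> q dvd q - b + k.
        (- prime_padic) ^ i * (dwork_coeff k * dwork_coeff (a + q * i - k)))
      = (\<Sum>j\<le>i. dwork_gauss_term b j * dwork_gauss_term (a - b) (i - j) :: 'p padic)" for i
    proof -
      have "b + q * j \<le> a + q * i \<longleftrightarrow> j \<le> i" for j
      proof
        assume "b + q * j \<le> a + q * i"
        then have "q * j < q * Suc i"
          using a by simp
        then show "j \<le> i"
          by (simp only: mult_less_cancel1 less_Suc_eq_le)
      qed (simp add: True add_mono)
      then have set: "{k. k \<le> a + q * i \<and> q dvd q - b + k} = (\<lambda>j. b + q * j) ` {..i}"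
        unfolding dvd_shifted_iff[OF b] by auto
      have "inj_on (\<lambda>j. b + q * j) {..i}"
        using b by (simp add: inj_on_def)
      moreover have "(- prime_padic) ^ i * (dwork_coeff (b + q * j) * dwork_coeff (a + q * i - (b + q * j)))
          = (dwork_gauss_term b j * dwork_gauss_term (a - b) (i - j) :: 'p padic)" if "j \<in> {..i}" for j
      proof -
        have "j \<le> i"
          using that by simp
        then obtain d where d: "i = j + d"
          using le_Suc_ex by blast
        have "a + q * i - (b + q * j) = a - b + q * d"
          using True by (simp add: d algebra_simps)
        then show ?thesis
          unfolding dwork_gauss_term_def q[symmetric] by (simp add: d power_add)
      qed
      ultimately show ?thesis
        unfolding set by (simp add: sum.reindex)
    qed
    moreover have "a - b < q"
      using a by simp
    ultimately show ?thesis
      using conv[of "a - b"] True by simp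
  next
    case False
    have "(\<Sum>k | k \<le> a + q * i \<and> q dvd q - b + k.
        (- prime_padic) ^ i * (dwork_coeff k * dwork_coeff (a + q * i - k)))
      = - prime_padic * (if i = 0 then 0 else
          (\<Sum>j\<le>i - 1. dwork_gauss_term b j * dwork_gauss_term (a + q - b) (i - 1 - j)) :: 'p padic)" for i
    proof (cases i)
      case 0
      have set: "{k. k \<le> a + q * i \<and> q dvd q - b + k} = {}"
        using False unfolding dvd_shifted_iff[OF b] by (auto simp: 0)
      show ?thesis
        unfolding set by (simp add: 0)
    next
      case (Suc i')
      have "b + q * j \<le> a + q * i \<longleftrightarrow> j \<le> i'" for j
      proof
        assume "b + q * j \<le> a + q * i"
        then have "q * j < q * i"
          using False by linarith
        then show "j \<le> i'"
          by (simp only: mult_less_cancel1 Suc less_Suc_eq_le)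
      next
        assume "j \<le> i'"
        then have "q * j \<le> q * i'"
          by simp
        then show "b + q * j \<le> a + q * i"
          unfolding Suc mult_Suc_right using b by linarith
      qed
      then have set: "{k. k \<le> a + q * i \<and> q dvd q - b + k} = (\<lambda>j. b + q * j) ` {..i'}"
        unfolding dvd_shifted_iff[OF b] by auto
      have "inj_on (\<lambda>j. b + q * j) {..i'}"
        using b by (simp add: inj_on_def)
      moreover have "(- prime_padic) ^ i * (dwork_coeff (b + q * j) * dwork_coeff (a + q * i - (b + q * j)))
          = - prime_padic * (dwork_gauss_term b j * dwork_gauss_term (a + q - b) (i' - j) :: 'p padic)"
        if "j \<in> {..i'}" for j
      proof -
        have "j \<le> i'"
          using that by simp
        then obtain d where d: "i' = j + d"
          using le_Suc_ex by blast
        have "a + q * i - (b + q * j) = a + q - b + q * d"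
          using b by (simp add: d Suc algebra_simps)
        then show ?thesis
          unfolding dwork_gauss_term_def q[symmetric] by (simp add: d Suc power_add)
      qed
      ultimately have "(\<Sum>k | k \<le> a + q * i \<and> q dvd q - b + k.
          (- prime_padic) ^ i * (dwork_coeff k * dwork_coeff (a + q * i - k)))
        = (\<Sum>j\<le>i'. - prime_padic * (dwork_gauss_term b j * dwork_gauss_term (a + q - b) (i' - j) :: 'p padic))"
        unfolding set by (subst sum.reindex) (simp_all only: o_def cong: sum.cong)
      then show ?thesis
        unfolding sum_distrib_left[symmetric] by (simp add: Suc)
    qed
    moreover have "a + q - b < q"
      using False b by linarith
    from has_psum_cmult[OF has_psum_shift[OF conv[OF this]], of "- prime_padic"]
    have "has_psum (\<lambda>i. - prime_padic * (if i = 0 then 0 else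
          (\<Sum>j\<le>i - 1. dwork_gauss_term b j * dwork_gauss_term (a + q - b) (i - 1 - j)))) UNIV
        (- prime_padic * (dwork_gauss b * dwork_gauss (a + q - b) :: 'p padic))"
      by (simp add: vint_minus)
    ultimately show ?thesis
      using False by simp
  qed
qed

text \<open>The classical relation between Jacobi and Gauss sums: the sum over \<open>u\<close> of
  \<tau>(u)^(-b) times the evaluated series at 1 + \<tau>(u) is computed termwise in
  \<open>u\<close>, and through the convolution.\<close>

lemma jacobi_sum_dwork_gauss:
  fixes q :: nat
  assumes p5: "5 \<le> CARD('p::prime_card)" and q: "q = CARD('p) - 1"
    and a: "0 < a" "a < q" and b: "b < q"
  shows "(\<Sum>u | u \<noteq> (0 :: 'p mod_ring) \<and> 1 + u \<noteq> 0.
      padic_of_int (teichmueller u) ^ (q - b) * padic_of_int (teichmueller (1 + u)) ^ a) * dwork_gauss a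
    = of_nat q * (if b \<le> a then dwork_gauss b * dwork_gauss (a - b)
        else - prime_padic * (dwork_gauss b * dwork_gauss (a + q - b)))"
proof -
  let ?U = "{u :: 'p mod_ring. u \<noteq> 0}" and ?t = "\<lambda>u :: 'p mod_ring. padic_of_int (teichmueller u)"
  let ?J = "if b \<le> a then dwork_gauss b * dwork_gauss (a - b) :: 'p padic
        else - prime_padic * (dwork_gauss b * dwork_gauss (a + q - b))"
  define s where "s u = (if 1 + u = 0 then 0 else ?t (1 + u) ^ a * dwork_gauss a)" for u
  have s: "has_psum (\<lambda>i. (- prime_padic) ^ i * dwork_fps (1 + ?t u) $ (a + q * i)) UNIV (s u)"
    if "u \<in> ?U" for u
  proof (cases "1 + u = 0")
    case True
    then have "u = - 1"
      by (simp add: add_eq_0_iff)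
    then have "1 + ?t u = 0"
      using teichmueller_minus_1[where 'p = 'p] p5 by (simp add: padic_of_int_minus)
    \<comment> \<open>At u = -1 the parameter is 0 and the series is the constant 1; its
      coefficients of degree a + q i vanish since a > 0.\<close>
    then have "(- prime_padic) ^ i * dwork_fps (1 + ?t u) $ (a + q * i) = 0" for i
      using a(1) by simp
    moreover have "s u = 0"
      using True by (simp add: s_def)
    ultimately show ?thesis
      by (simp only: has_psum_0)
  next
    case False
    then show ?thesis
      using that has_psum_dwork_fps_teichmueller[OF p5 a(2)[unfolded q], of u] by (simp add: s_def q)
  qed
  have "has_psum (\<lambda>i. \<Sum>u\<in>?U. ?t u ^ (q - b) * ((- prime_padic) ^ i * dwork_fps (1 + ?t u) $ (a + q * i))) UNIV
      (\<Sum>u\<in>?U. ?t u ^ (q - b) * s u)"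
    by (intro has_psum_sum has_psum_cmult s vint_power vint_padic_of_int)
  moreover have "has_psum (\<lambda>i. \<Sum>u\<in>?U. ?t u ^ (q - b) * ((- prime_padic) ^ i * dwork_fps (1 + ?t u) $ (a + q * i))) UNIV
      (of_nat q * ?J)"
    unfolding sum_units_dwork_fps[OF b q] by (intro has_psum_cmult dwork_gauss_convolution p5 q a b vint_of_nat)
  ultimately have "(\<Sum>u\<in>?U. ?t u ^ (q - b) * s u) = of_nat q * ?J"
    by (rule has_psum_unique)
  moreover have "(\<Sum>u\<in>?U. ?t u ^ (q - b) * s u)
      = (\<Sum>u | u \<noteq> 0 \<and> 1 + u \<noteq> 0. ?t u ^ (q - b) * ?t (1 + u) ^ a) * dwork_gauss a"
    unfolding sum_distrib_right by (rule sum.mono_neutral_cong_right) (auto simp: s_def mult.assoc)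
  ultimately show ?thesis
    by simp
qed

section \<open>The multiplication formula for the gamma function\<close>

lemma padic_Gamma_plus1:
  fixes x :: "'p::prime_card padic_int"
  assumes "5 \<le> CARD('p)"
  shows "padic_Gamma (x + 1) = (if padic_p dvd x then - 1 else - x) * padic_Gamma x"
  unfolding padic_Gamma_eq_dwork_gamma[OF assms] by (rule dwork_gamma_plus1[OF assms])

lemma padic_Gamma_unit:
  fixes x :: "'p::prime_card padic_int"
  assumes "5 \<le> CARD('p)"
  shows "\<not> padic_p dvd padic_Gamma x"
  unfolding padic_Gamma_eq_dwork_gamma[OF assms] by (rule dwork_gamma_unit[OF assms])

lemma padic_Gamma_nonzero:
  fixes x :: "'p::prime_card padic_int"
  assumes "5 \<le> CARD('p)"
  shows "padic_Gamma x \<noteq> 0"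
  using padic_Gamma_unit[OF assms, of x] by auto

lemma padic_Gamma_cong:
  fixes x y :: "'p::prime_card padic_int"
  assumes "5 \<le> CARD('p)" "padic_p ^ Suc n dvd y - x"
  shows "padic_p ^ n dvd padic_Gamma y - padic_Gamma x"
  unfolding padic_Gamma_eq_dwork_gamma[OF assms(1)] by (rule dwork_gamma_cong[OF assms])

lemma padic_Gamma_0 [simp]:
  assumes "5 \<le> CARD('p::prime_card)"
  shows "padic_Gamma (0 :: 'p padic_int) = 1"
  unfolding padic_Gamma_eq_dwork_gamma[OF assms] by (rule dwork_gamma_0[OF assms])

text \<open>The product side of Gauss's multiplication formula, with \<mu> in the role of 1 / m so
  that all arguments stay in the ring.\<close>

definition padic_Gamma_prod :: "nat \<Rightarrow> 'p::prime_card padic_int \<Rightarrow> 'p padic_int \<Rightarrow> 'p padic_int" where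
  "padic_Gamma_prod m \<mu> x = (\<Prod>h<m. padic_Gamma ((x + of_nat h) * \<mu>))"

text \<open>Replacing x by x + 1 moves every factor to the next one, so only the passage from
  \<Gamma>(x / m) to \<Gamma>(x / m + 1) remains.\<close>

lemma padic_Gamma_prod_plus1:
  fixes x \<mu> :: "'p::prime_card padic_int"
  assumes p5: "5 \<le> CARD('p)" and \<mu>: "of_nat m * \<mu> = 1"
  shows "padic_Gamma_prod m \<mu> (x + 1) = (if padic_p dvd x then - 1 else - (x * \<mu>)) * padic_Gamma_prod m \<mu> x"
proof -
  let ?g = "\<lambda>h. padic_Gamma ((x + of_nat h) * \<mu>)"
  have shift: "(\<Prod>h<m. ?g (Suc h)) = padic_Gamma_prod m \<mu> (x + 1)"
    unfolding padic_Gamma_prod_def by (simp add: add.assoc)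
  have "?g 0 * (\<Prod>h<m. ?g (Suc h)) = (\<Prod>h<Suc m. ?g h)"
    by (rule prod.lessThan_Suc_shift[symmetric])
  also have "\<dots> = padic_Gamma_prod m \<mu> x * ?g m"
    by (simp add: padic_Gamma_prod_def)
  finally have 1: "?g 0 * padic_Gamma_prod m \<mu> (x + 1) = padic_Gamma_prod m \<mu> x * ?g m"
    unfolding shift .
  have "(x + of_nat m) * \<mu> = x * \<mu> + 1"
    by (simp add: distrib_right \<mu>)
  moreover have "padic_p dvd x * \<mu> \<longleftrightarrow> padic_p dvd x"
  proof
    assume "padic_p dvd x * \<mu>"
    then have "padic_p dvd x * \<mu> * of_nat m"
      by (rule dvd_mult2)
    then show "padic_p dvd x"
      using \<mu> by (simp add: mult.assoc mult.commute[of \<mu>])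
  qed (rule dvd_mult2)
  ultimately have "?g m = (if padic_p dvd x then - 1 else - (x * \<mu>)) * ?g 0"
    using padic_Gamma_plus1[OF p5, of "x * \<mu>"] by simp
  then have "?g 0 * padic_Gamma_prod m \<mu> (x + 1)
      = ?g 0 * ((if padic_p dvd x then - 1 else - (x * \<mu>)) * padic_Gamma_prod m \<mu> x)"
    unfolding 1 by (simp only: ac_simps)
  then show ?thesis
    using padic_Gamma_nonzero[OF p5, of "(x + of_nat 0) * \<mu>"] by (simp only: mult_cancel_left simp_thms)
qed

text \<open>The product and the gamma function obey the same recurrence except that a step at n
  prime to \<open>p\<close> contributes n / m in place of n; the exponent of \<open>m\<close> counts
  these steps.\<close>

lemma padic_Gamma_prod_of_nat:
  fixes \<mu> :: "'p::prime_card padic_int"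
  assumes p5: "5 \<le> CARD('p)" and \<mu>: "of_nat m * \<mu> = 1"
  shows "padic_Gamma_prod m \<mu> (of_nat n) * of_nat m ^ card {i. i < n \<and> \<not> CARD('p) dvd i}
    = padic_Gamma_prod m \<mu> 0 * padic_Gamma (of_nat n)"
proof (induction n)
  case 0
  then show ?case
    using p5 by simp
next
  case (Suc n)
  let ?S = "\<lambda>n. {i. i < n \<and> \<not> CARD('p) dvd i}" and ?F = "padic_Gamma_prod m \<mu>"
  have F: "?F (of_nat (Suc n)) = (if CARD('p) dvd n then - 1 else - (of_nat n * \<mu>)) * ?F (of_nat n)"
    using padic_Gamma_prod_plus1[OF p5 \<mu>, of "of_nat n"] by (simp add: padic_p_dvd_of_nat_iff add.commute)
  have G: "padic_Gamma (of_nat (Suc n) :: 'p padic_int)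
      = (if CARD('p) dvd n then - 1 else - of_nat n) * padic_Gamma (of_nat n)"
    using padic_Gamma_plus1[OF p5, of "of_nat n"] by (simp add: padic_p_dvd_of_nat_iff add.commute)
  show ?case
  proof (cases "CARD('p) dvd n")
    case True
    then have S: "?S (Suc n) = ?S n"
      by (auto simp: less_Suc_eq)
    show ?thesis
      unfolding S F G using Suc.IH True by simp
  next
    case False
    then have "?S (Suc n) = insert n (?S n)"
      by (auto simp: less_Suc_eq)
    then have S: "card (?S (Suc n)) = Suc (card (?S n))"
      by simp
    have "- (of_nat n * \<mu>) * ?F (of_nat n) * of_nat m ^ Suc (card (?S n))
        = - of_nat n * (of_nat m * \<mu>) * (?F (of_nat n) * of_nat m ^ card (?S n))"
      by (simp add: ac_simps)
    also have "\<dots> = ?F 0 * (- of_nat n * padic_Gamma (of_nat n))"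
      unfolding Suc.IH \<mu> by (simp add: ac_simps)
    finally show ?thesis
      unfolding S F G using False by simp
  qed
qed

lemma padic_Gamma_prod_cong:
  fixes x y \<mu> :: "'p::prime_card padic_int"
  assumes p5: "5 \<le> CARD('p)" and xy: "padic_p ^ Suc n dvd y - x"
  shows "padic_p ^ n dvd padic_Gamma_prod m \<mu> y - padic_Gamma_prod m \<mu> x"
proof (induction m)
  case (Suc m)
  let ?g = "\<lambda>x. padic_Gamma ((x + of_nat m) * \<mu>)"
  have "(y + of_nat m) * \<mu> - (x + of_nat m) * \<mu> = (y - x) * \<mu>"
    by (simp add: algebra_simps)
  then have "padic_p ^ Suc n dvd (y + of_nat m) * \<mu> - (x + of_nat m) * \<mu>"
    using xy by (simp only: dvd_mult2)
  then have "padic_p ^ n dvd ?g y - ?g x"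
    by (rule padic_Gamma_cong[OF p5])
  then have "padic_p ^ n dvd (padic_Gamma_prod m \<mu> y - padic_Gamma_prod m \<mu> x) * ?g y
      + padic_Gamma_prod m \<mu> x * (?g y - ?g x)"
    using Suc by (intro dvd_add dvd_mult dvd_mult2)
  then show ?case
    by (simp add: padic_Gamma_prod_def algebra_simps)
qed (simp add: padic_Gamma_prod_def)

text \<open>These are the natural numbers \<open>p ^ N - j (p ^ N - 1) / (p - 1)\<close>, which tend to \<open>j / (p - 1)\<close>.\<close>

fun padic_approx_frac :: "nat \<Rightarrow> nat \<Rightarrow> nat \<Rightarrow> nat" where
  "padic_approx_frac p j 0 = 1"
| "padic_approx_frac p j (Suc N) = p * padic_approx_frac p j N - j"

lemma padic_approx_frac_pos:
  "j < p \<Longrightarrow> 0 < padic_approx_frac p j N"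
proof (induction N)
  case (Suc N)
  then have "p \<le> p * padic_approx_frac p j N"
    by simp
  then show ?case
    unfolding padic_approx_frac.simps using Suc.prems by linarith
qed simp

lemma padic_approx_frac_eq:
  assumes "j < p"
  shows "(p - 1) * padic_approx_frac p j N = p ^ N * (p - 1 - j) + j"
proof (induction N)
  case (Suc N)
  have "p \<le> p * padic_approx_frac p j N"
    using padic_approx_frac_pos[OF assms, of N] by simp
  then have le: "j \<le> p * padic_approx_frac p j N"
    using assms by linarith
  have "(p - 1) * padic_approx_frac p j (Suc N) + (p - 1) * j = p * ((p - 1) * padic_approx_frac p j N)"
    unfolding padic_approx_frac.simps distrib_left[symmetric] le_add_diff_inverse2[OF le] by (rule mult.left_commute)
  also have "\<dots> = p ^ Suc N * (p - 1 - j) + p * j"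
    unfolding Suc.IH by (simp add: algebra_simps)
  also have "p * j = (p - 1) * j + j"
    using assms by (cases p) auto
  finally show ?case
    by simp
qed (use assms in simp)

text \<open>The multiples of \<open>p\<close> below the next approximation are \<open>p * t\<close>
  with \<open>t\<close> below the current approximation n, which leaves (p - 1) n - j = p^N (p - 1 -
  j) numbers. That the count is p^N times a constant makes the corresponding power of
  \<open>m\<close> converge to a power of its Teichmueller lift.\<close>

lemma card_coprime_below_padic_approx_frac:
  assumes j: "j < p"
  shows "card {i. i < padic_approx_frac p j (Suc N) \<and> \<not> p dvd i} = p ^ N * (p - 1 - j)"
proof -
  let ?n = "padic_approx_frac p j N"
  define M where "M = padic_approx_frac p j (Suc N)"
  have M: "M = p * ?n - j"
    by (simp add: M_def)
  have iff: "p * t < M \<longleftrightarrow> t < ?n" for t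
  proof
    assume "t < ?n"
    then have "p * Suc t \<le> p * ?n"
      by (intro mult_le_mono2) simp
    then show "p * t < M"
      unfolding M mult_Suc_right using j by linarith
  next
    assume "p * t < M"
    then have "p * t < p * ?n"
      unfolding M by linarith
    then show "t < ?n"
      by (simp only: mult_less_cancel1)
  qed
  have set: "{i. i < M \<and> \<not> p dvd i} = {..<M} - (\<lambda>t. p * t) ` {..<?n}"
    and sub: "(\<lambda>t. p * t) ` {..<?n} \<subseteq> {..<M}"
    by (auto simp: iff dvd_def)
  have "card {i. i < M \<and> \<not> p dvd i} = M - ?n"
    unfolding set using j by (subst card_Diff_subset[OF _ sub]) (simp_all add: card_image inj_on_def)
  moreover have "M = (p - 1) * ?n + ?n - j"
    unfolding M using j by (cases p) simp_all
  ultimately show ?thesis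
    using padic_approx_frac_eq[OF j, of N] unfolding M_def by simp
qed

lemma teichmueller_of_nat_cong:
  assumes "\<not> CARD('p::prime_card) dvd m"
  shows "padic_p ^ Suc N dvd (of_nat m :: 'p padic_int) ^ (CARD('p) ^ N) - teichmueller (of_nat m)"
proof (induction N)
  case 0
  have "(of_nat m :: 'p mod_ring) \<noteq> 0"
    using assms of_nat_0_mod_ring_dvd by blast
  then have "reduces (teichmueller (of_nat m) :: 'p padic_int) (of_nat m)"
    by (rule reduces_teichmueller)
  then have "padic_p dvd teichmueller (of_nat m) - (of_int (int m) :: 'p padic_int)"
    by (subst (asm) reduces_iff[of "int m"]) simp_all
  then show ?case
    unfolding dvd_minus_commute[of _ "teichmueller _"] by simp
next
  case (Suc N)
  have nz: "(of_nat m :: 'p mod_ring) \<noteq> 0"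
    using assms of_nat_0_mod_ring_dvd by blast
  obtain q where q: "CARD('p) = Suc q"
    by (rule CARD_eq_SucE)
  have "teichmueller (of_nat m :: 'p mod_ring) ^ CARD('p) = teichmueller (of_nat m)"
    using teichmueller_power_card[OF nz] unfolding q by simp
  then show ?case
    using padic_power_prime_cong[OF Suc] unfolding power_mult[symmetric] power_Suc2[symmetric] by simp
qed

text \<open>Continuity carries the formula from the natural approximations to x = j / (p - 1); along
  them the extra factor is m^(p^N (p - 1 - j)), whose limit is the power of the Teichmueller
  lift.\<close>

lemma padic_Gamma_multiplication:
  fixes x \<mu> :: "'p::prime_card padic_int"
  assumes p5: "5 \<le> CARD('p)" and \<mu>: "of_nat m * \<mu> = 1" and m: "\<not> CARD('p) dvd m"
    and j: "j < CARD('p)" and x: "(padic_p - 1) * x = of_nat j"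
  shows "padic_Gamma_prod m \<mu> x * teichmueller (of_nat m) ^ (CARD('p) - 1 - j)
    = padic_Gamma_prod m \<mu> 0 * padic_Gamma x"
proof (rule padic_int_eqI_dvd)
  fix N
  let ?p = "CARD('p)" and ?F = "padic_Gamma_prod m \<mu>" and ?t = "teichmueller (of_nat m) :: 'p padic_int"
  define n where "n = padic_approx_frac ?p j (Suc N)"
  define e where "e = ?p - 1 - j"
  have xn: "padic_p ^ Suc N dvd x - of_nat n"
  proof (rule padic_p_power_dvd_cancel)
    show "\<not> padic_p dvd (padic_p - 1 :: 'p padic_int)"
      using padic_p_dvd_of_nat_iff[of 1, where 'p = 'p] CARD_gt_1(1)[where 'p = 'p]
        dvd_diff_right_iff[of padic_p "padic_p :: 'p padic_int" 1] by simp
    have "(of_nat ((?p - 1) * n) :: 'p padic_int) = of_nat (?p ^ Suc N * e + j)"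
      unfolding n_def e_def padic_approx_frac_eq[OF j] ..
    then have "(padic_p - 1) * of_nat n = (padic_p ^ Suc N * of_nat e + of_nat j :: 'p padic_int)"
      by (simp add:)
    then have "(padic_p - 1) * (x - of_nat n) = padic_p ^ Suc N * (- of_nat e)"
      unfolding right_diff_distrib x by simp
    then show "padic_p ^ Suc N dvd (padic_p - 1) * (x - of_nat n)"
      by simp
  qed
  have 1: "padic_p ^ N dvd ?F x - ?F (of_nat n)" "padic_p ^ N dvd padic_Gamma x - padic_Gamma (of_nat n)"
    by (rule padic_Gamma_prod_cong[OF p5 xn] padic_Gamma_cong[OF p5 xn])+
  have "padic_p ^ Suc N dvd (of_nat m ^ (?p ^ N)) ^ e - ?t ^ e"
  proof (rule dvd_trans[OF teichmueller_of_nat_cong[OF m]])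
    show "of_nat m ^ ?p ^ N - ?t dvd (of_nat m ^ ?p ^ N) ^ e - ?t ^ e"
      using diff_power_eq_sum[of "of_nat m ^ ?p ^ N :: 'p padic_int" "e - 1" ?t] by (cases e) simp_all
  qed
  then have 2: "padic_p ^ N dvd of_nat m ^ (?p ^ N * e) - ?t ^ e"
    unfolding power_mult by (rule power_le_dvd) simp
  have "?F (of_nat n) * of_nat m ^ (?p ^ N * e) = ?F 0 * padic_Gamma (of_nat n)"
    using padic_Gamma_prod_of_nat[OF p5 \<mu>, of n]
    unfolding n_def card_coprime_below_padic_approx_frac[OF j] e_def .
  then have "?F x * ?t ^ e - ?F 0 * padic_Gamma x
      = (?F x - ?F (of_nat n)) * ?t ^ e - ?F (of_nat n) * (of_nat m ^ (?p ^ N * e) - ?t ^ e)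
        - ?F 0 * (padic_Gamma x - padic_Gamma (of_nat n))"
    by (simp add: algebra_simps)
  also have "padic_p ^ N dvd \<dots>"
    by (rule dvd_diff[OF dvd_diff[OF dvd_mult2[OF 1(1)] dvd_mult[OF 2]] dvd_mult[OF 1(2)]])
  finally show "padic_p ^ N dvd ?F x * ?t ^ (?p - 1 - j) - ?F 0 * padic_Gamma x"
    unfolding e_def .
qed

section \<open>Gamma values at rational arguments\<close>

lemma padic_int_of_rat_eqI:
  fixes x :: "'p::prime_card padic_int"
  assumes d: "d \<noteq> 0" and r: "r = of_int n / of_int d" and x: "of_int d * x = of_int n"
  shows "padic_int_of_rat r = x"
proof -
  obtain n' d' where q: "quotient_of r = (n', d')"
    by fastforce
  have d': "d' > 0" and r': "r = of_int n' / of_int d'"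
    using quotient_of_denom_pos[OF q] quotient_of_div[OF q] by auto
  have "(of_int (n * d') :: rat) = of_int (n' * d)"
    using r r' d d' by (simp add: frac_eq_eq)
  then have nd: "n * d' = n' * d"
    unfolding of_int_eq_iff .
  have "of_int d * (of_int d' * x) = (of_int (n * d') :: 'p padic_int)"
    using x by (simp add: ac_simps)
  then have "of_int d * (of_int d' * x) = of_int d * (of_int n' :: 'p padic_int)"
    unfolding nd by (simp add: ac_simps)
  then have x': "of_int d' * x = of_int n'"
    using d by simp
  show ?thesis
    unfolding padic_int_of_rat_def q fst_conv snd_conv
  proof (rule the_equality)
    show "of_int d' * x = of_int n'"
      by (rule x')
    fix y :: "'p padic_int"
    assume "of_int d' * y = of_int n'"
    then have "of_int d' * y = of_int d' * x"
      unfolding x' .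
    then show "y = x"
      using d' by simp
  qed
qed

lemma Gamma_rat_eqI:
  fixes x :: "'p::prime_card padic_int"
  assumes "d \<noteq> 0" "r = of_int n / of_int d" "of_int d * x = of_int n"
  shows "Gamma_rat r = padic_of_int (padic_Gamma x)"
  unfolding Gamma_rat_def padic_int_of_rat_eqI[OF assms] ..

lemma padic_inverse_of_nat:
  assumes "\<not> CARD('p::prime_card) dvd m"
  obtains \<mu> :: "'p::prime_card padic_int" where "of_nat m * \<mu> = 1"
proof -
  have "(of_nat m :: 'p padic_int) dvd 1"
    using assms by (simp add: padic_unit_iff padic_p_dvd_of_nat_iff)
  then show thesis
    using that by (metis dvdE)
qed

lemma Gamma_rat_multiplication:
  assumes p5: "5 \<le> CARD('p::prime_card)" and m: "\<not> CARD('p) dvd m" and j: "j < CARD('p)"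
  shows "(\<Prod>h<m. Gamma_rat ((of_nat j / of_nat (CARD('p) - 1) + of_nat h) / of_nat m) :: 'p padic)
      * padic_of_int (teichmueller (of_nat m)) ^ (CARD('p) - 1 - j)
    = (\<Prod>h<m. Gamma_rat (of_nat h / of_nat m)) * Gamma_rat (of_nat j / of_nat (CARD('p) - 1))"
    and Gamma_rat_eq_dwork_gauss:
      "Gamma_rat (of_nat j / of_nat (CARD('p) - 1)) = (1 - prime_padic) * (dwork_gauss j :: 'p padic)"
proof -
  let ?q = "CARD('p) - 1"
  have q: "?q > 0" "\<not> CARD('p) dvd ?q"
    using p5 by (auto dest: dvd_imp_le)
  have m0: "m \<noteq> 0"
    using m by (intro notI) simp
  obtain \<mu> :: "'p padic_int" where \<mu>: "of_nat m * \<mu> = 1"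
    by (rule padic_inverse_of_nat[OF m])
  obtain \<nu> :: "'p padic_int" where \<nu>: "of_nat ?q * \<nu> = 1"
    by (rule padic_inverse_of_nat[OF q(2)])
  define x where "x = of_nat j * \<nu>"
  have qx: "of_nat ?q * x = of_nat j"
    unfolding x_def mult.left_commute[of "of_nat ?q"] \<nu> by simp
  then have x: "(padic_p - 1) * x = of_nat j"
    by (simp add:)
  have 1: "Gamma_rat (of_nat j / of_nat ?q) = padic_of_int (padic_Gamma x)"
    by (rule Gamma_rat_eqI[of "int ?q" _ "int j"]) (use q(1) qx in simp_all)
  then show "Gamma_rat (of_nat j / of_nat ?q) = (1 - prime_padic) * (dwork_gauss j :: 'p padic)"
    using padic_Gamma_eq_dwork_gauss[OF p5 j x] by simp
  have 2: "Gamma_rat (of_nat h / of_nat m) = padic_of_int (padic_Gamma ((0 + of_nat h) * \<mu>))" for h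
    by (rule Gamma_rat_eqI[of "int m" _ "int h"]) (use m0 \<mu> in \<open>simp_all add: mult.left_commute\<close>)
  have 3: "Gamma_rat ((of_nat j / of_nat ?q + of_nat h) / of_nat m)
      = padic_of_int (padic_Gamma ((x + of_nat h) * \<mu>))" for h
  proof (rule Gamma_rat_eqI[of "int (?q * m)" _ "int (j + ?q * h)"])
    show "int (?q * m) \<noteq> 0"
      using q(1) m0 by simp
    show "(of_nat j / of_nat ?q + of_nat h) / of_nat m = (of_int (int (j + ?q * h)) / of_int (int (?q * m)) :: rat)"
      using q(1) m0 by (simp add: field_simps del:)
    have "of_nat (?q * m) * ((x + of_nat h) * \<mu>) = (of_nat ?q * x + of_nat ?q * of_nat h) * (of_nat m * \<mu>)"
      by (simp only: of_nat_mult distrib_left ac_simps)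
    then show "of_int (int (?q * m)) * ((x + of_nat h) * \<mu>) = of_int (int (j + ?q * h))"
      unfolding qx \<mu> of_int_of_nat_eq by (simp only: of_nat_add of_nat_mult mult_1_right)
  qed
  have "padic_of_int (padic_Gamma_prod m \<mu> x * teichmueller (of_nat m) ^ (?q - j))
      = padic_of_int (padic_Gamma_prod m \<mu> 0 * padic_Gamma x)"
    unfolding padic_Gamma_multiplication[OF p5 \<mu> m j x] ..
  then show "(\<Prod>h<m. Gamma_rat ((of_nat j / of_nat ?q + of_nat h) / of_nat m) :: 'p padic)
      * padic_of_int (teichmueller (of_nat m)) ^ (?q - j)
    = (\<Prod>h<m. Gamma_rat (of_nat h / of_nat m)) * Gamma_rat (of_nat j / of_nat ?q)"
    unfolding 1 2 3 padic_Gamma_prod_def padic_of_int_mult padic_of_int_power padic_of_int_prod .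
qed

section \<open>The hypergeometric series\<close>

abbreviation tau :: "'p::prime_card mod_ring \<Rightarrow> 'p padic" where
  "tau u \<equiv> padic_of_int (teichmueller u)"

lemma tau_power_card:
  fixes u :: "'p::prime_card mod_ring"
  assumes "u \<noteq> 0"
  shows "tau u ^ (CARD('p) - 1) = 1"
  using arg_cong[OF teichmueller_power_card[OF assms], of padic_of_int]
  unfolding padic_of_int_power padic_of_int_1 .

lemma tau_nonzero:
  fixes u :: "'p::prime_card mod_ring"
  assumes "u \<noteq> 0"
  shows "tau u \<noteq> 0"
proof
  assume "tau u = 0"
  then have "(0 :: 'p padic) ^ (CARD('p) - 1) = 1"
    using tau_power_card[OF assms] by simp
  moreover have "CARD('p) - 1 > 0"
    using CARD_gt_1(1)[where 'p = 'p] by linarith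
  ultimately show False
    by (simp add: power_0_left)
qed

lemma tau_mult: "a \<noteq> 0 \<Longrightarrow> b \<noteq> 0 \<Longrightarrow> tau (a * b) = tau a * tau b"
  by (simp add: teichmueller_mult padic_of_int_mult)

lemma tau_power: "a \<noteq> 0 \<Longrightarrow> tau (a ^ n) = tau a ^ n"
  by (simp add: teichmueller_power padic_of_int_power)

lemma tau_divide:
  assumes "a \<noteq> 0" "b \<noteq> 0"
  shows "tau (a / b) = tau a / tau b"
proof -
  have "tau (a / b) * tau b = tau (a / b * b)"
    using assms by (intro tau_mult[symmetric]) simp_all
  then show ?thesis
    using assms tau_nonzero[OF assms(2)] by (simp add: field_simps)
qed

lemma tau_eq_1_iff: "a \<noteq> 0 \<Longrightarrow> tau a = 1 \<longleftrightarrow> a = 1"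
  using teichmueller_inj[of a 1] padic_of_int_eq_iff[of "teichmueller a" 1] by simp

lemma mod_ring_small_of_nat_nonzero:
  assumes "0 < n" "n < CARD('p::prime_card)"
  shows "(of_nat n :: 'p mod_ring) \<noteq> 0"
  using of_nat_0_mod_ring_dvd[of n, where 'a = 'p] nat_dvd_not_less[OF assms] by blast

lemma mod_ring_numeral_nonzero:
  assumes "5 \<le> CARD('p::prime_card)"
  shows "(2 :: 'p mod_ring) \<noteq> 0" "(3 :: 'p mod_ring) \<noteq> 0" "(4 :: 'p mod_ring) \<noteq> 0" "(27 :: 'p mod_ring) \<noteq> 0"
proof -
  show 2: "(2 :: 'p mod_ring) \<noteq> 0" and 3: "(3 :: 'p mod_ring) \<noteq> 0"
    using mod_ring_small_of_nat_nonzero[of 2, where 'p = 'p] mod_ring_small_of_nat_nonzero[of 3, where 'p = 'p] assms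
    by simp_all
  show "(4 :: 'p mod_ring) \<noteq> 0" "(27 :: 'p mod_ring) \<noteq> 0"
    using power_not_zero[OF 2, of 2] power_not_zero[OF 3, of 3] by simp_all
qed

lemma Gamma_rat_nonzero:
  assumes "5 \<le> CARD('p::prime_card)"
  shows "(Gamma_rat r :: 'p padic) \<noteq> 0"
  using padic_Gamma_nonzero[OF assms] by (simp add: Gamma_rat_def)

lemma Gamma_rat_0:
  assumes "5 \<le> CARD('p::prime_card)"
  shows "(Gamma_rat 0 :: 'p padic) = 1"
  using Gamma_rat_eqI[of 1 0 0 "0 :: 'p padic_int"] assms by simp

lemma
  fixes Q :: rat
  assumes j: "0 < j" "j < q" and Q: "Q = of_nat j / of_nat q"
  shows unit_interval_index: "0 < Q" "Q < 1"
    and floor_index: "\<lfloor>1/3 - Q\<rfloor> = (if 3 * j \<le> q then 0 else - 1)"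
      "\<lfloor>2/3 - Q\<rfloor> = (if 3 * j \<le> 2 * q then 0 else - 1)"
      "\<lfloor>1/2 + Q\<rfloor> = (if 2 * j < q then 0 else 1)" "\<lfloor>Q - 1/2\<rfloor> = (if 2 * j < q then - 1 else 0)"
proof -
  have K: "(of_nat q :: rat) > 0"
    using j by simp
  show Q01: "0 < Q" "Q < 1"
    using j K by (simp_all add: Q)
  have "Q \<le> 1/3 \<longleftrightarrow> (of_nat (3 * j) :: rat) \<le> of_nat q"
    "Q \<le> 2/3 \<longleftrightarrow> (of_nat (3 * j) :: rat) \<le> of_nat (2 * q)"
    "Q < 1/2 \<longleftrightarrow> (of_nat (2 * j) :: rat) < of_nat q"
    using K by (auto simp: Q field_simps)
  then have iff: "3 * j \<le> q \<longleftrightarrow> Q \<le> 1/3" "3 * j \<le> 2 * q \<longleftrightarrow> Q \<le> 2/3" "2 * j < q \<longleftrightarrow> Q < 1/2"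
    unfolding of_nat_le_iff of_nat_less_iff by simp_all
  show "\<lfloor>1/3 - Q\<rfloor> = (if 3 * j \<le> q then 0 else - 1)" "\<lfloor>2/3 - Q\<rfloor> = (if 3 * j \<le> 2 * q then 0 else - 1)"
    "\<lfloor>1/2 + Q\<rfloor> = (if 2 * j < q then 0 else 1)" "\<lfloor>Q - 1/2\<rfloor> = (if 2 * j < q then - 1 else 0)"
    unfolding iff using Q01 by (auto intro!: floor_unique)
qed

text \<open>The residues of \<open>2 j\<close> and \<open>-3 j\<close> modulo \<open>q\<close>, for \<open>0 < j < q\<close>.\<close>

definition double_index :: "nat \<Rightarrow> nat \<Rightarrow> nat" where
  "double_index q j = (if 2 * j < q then 2 * j else 2 * j - q)"

definition minus_triple_index :: "nat \<Rightarrow> nat \<Rightarrow> nat" where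
  "minus_triple_index q j =
    (if 3 * j \<le> q then q - 3 * j else if 3 * j \<le> 2 * q then 2 * q - 3 * j else 3 * q - 3 * j)"

text \<open>With x = \<open>minus_triple_index q j / q\<close>, the three arguments on the left are
  x / 3, (x + 1) / 3 and (x + 2) / 3, in an order that depends on the position of Q relative to 1/3
  and 2/3. The exponents of \<tau>(3) agree up to multiples of \<open>q\<close>.\<close>

lemma Gamma_rat_triple:
  fixes q j :: nat and Q :: rat
  assumes p5: "5 \<le> CARD('p::prime_card)" and q: "q = CARD('p) - 1" and j: "0 < j" "j < q"
    and Q: "Q = of_nat j / of_nat q"
  shows "Gamma_rat (frac (1/3 - Q)) * Gamma_rat (frac (2/3 - Q)) * Gamma_rat (of_nat (q - j) / of_nat q)
      * tau (3 :: 'p mod_ring) ^ (3 * j)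
    = Gamma_rat (1/3) * Gamma_rat (2/3) * Gamma_rat (of_nat (minus_triple_index q j) / of_nat q)"
proof -
  let ?G = "Gamma_rat :: rat \<Rightarrow> 'p padic" and ?K = "of_nat q :: rat"
  let ?k = "minus_triple_index q j"
  have "\<not> CARD('p) dvd 3"
    using p5 by (auto dest: dvd_imp_le)
  moreover have k: "?k < CARD('p)"
    using j q p5 by (auto simp: minus_triple_index_def)
  ultimately have mult: "(\<Prod>h<3. ?G ((of_nat ?k / ?K + of_nat h) / 3)) * tau 3 ^ (q - ?k)
      = (\<Prod>h<3. ?G (of_nat h / 3)) * ?G (of_nat ?k / ?K)"
    using Gamma_rat_multiplication[OF p5, of 3 ?k] unfolding q by simp
  have K: "?K > 0"
    using j by simp
  have t: "tau (3 :: 'p mod_ring) ^ q = 1"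
    unfolding q by (rule tau_power_card[OF mod_ring_numeral_nonzero(2)[OF p5]])
  have prod3: "(\<Prod>h<3. f h) = f 0 * f 1 * (f 2 :: 'p padic)" for f :: "nat \<Rightarrow> 'p padic"
    by (simp add: eval_nat_numeral)
  have jq: "of_nat (q - j) / ?K = 1 - Q"
    using j K by (simp add: Q field_simps)
  have fracs: "frac (1/3 - Q) = 1/3 - Q - of_int \<lfloor>1/3 - Q\<rfloor>" "frac (2/3 - Q) = 2/3 - Q - of_int \<lfloor>2/3 - Q\<rfloor>"
    by (simp_all add: frac_def)
  consider "3 * j \<le> q" | "q < 3 * j" "3 * j \<le> 2 * q" | "2 * q < 3 * j"
    by linarith
  then have "?G (frac (1/3 - Q)) * ?G (frac (2/3 - Q)) * ?G (1 - Q)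
      = ?G (of_nat ?k / ?K / 3) * ?G ((of_nat ?k / ?K + 1) / 3) * ?G ((of_nat ?k / ?K + 2) / 3)
    \<and> tau (3 :: 'p mod_ring) ^ (3 * j) = tau 3 ^ (q - ?k)"
  proof cases
    case 1
    then have kK: "of_nat ?k / ?K = 1 - 3 * Q"
      using K by (simp add: minus_triple_index_def Q field_simps)
    have fl: "\<lfloor>1/3 - Q\<rfloor> = 0" "\<lfloor>2/3 - Q\<rfloor> = 0"
      using 1 by (simp_all add: floor_index[OF j Q])
    have args: "(1 - 3 * Q) / 3 = 1/3 - Q - of_int 0" "(1 - 3 * Q + 1) / 3 = 2/3 - Q - of_int 0"
      "(1 - 3 * Q + 2) / 3 = 1 - Q"
      by (simp_all add: field_simps)
    have "q - ?k = 3 * j"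
      using 1 by (simp add: minus_triple_index_def)
    then show ?thesis
      unfolding fracs fl kK args by (intro conjI) (simp_all only:)
  next
    case 2
    then have kK: "of_nat ?k / ?K = 2 - 3 * Q"
      using K by (simp add: minus_triple_index_def Q field_simps)
    have fl: "\<lfloor>1/3 - Q\<rfloor> = - 1" "\<lfloor>2/3 - Q\<rfloor> = 0"
      using 2 by (simp_all add: floor_index[OF j Q])
    have args: "(2 - 3 * Q) / 3 = 2/3 - Q - of_int 0" "(2 - 3 * Q + 1) / 3 = 1 - Q"
      "(2 - 3 * Q + 2) / 3 = 1/3 - Q - of_int (- 1)"
      by (simp_all add: field_simps)
    have "3 * j = (q - ?k) + q"
      using 2 j by (simp add: minus_triple_index_def)
    then have "tau (3 :: 'p mod_ring) ^ (3 * j) = tau 3 ^ (q - ?k)"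
      by (simp only: power_add t mult_1_right)
    then show ?thesis
      unfolding fracs fl kK args by (intro conjI) (simp_all only: ac_simps)
  next
    case 3
    then have kK: "of_nat ?k / ?K = 3 - 3 * Q"
      using K j by (simp add: minus_triple_index_def Q field_simps)
    have fl: "\<lfloor>1/3 - Q\<rfloor> = - 1" "\<lfloor>2/3 - Q\<rfloor> = - 1"
      using 3 by (simp_all add: floor_index[OF j Q])
    have args: "(3 - 3 * Q) / 3 = 1 - Q" "(3 - 3 * Q + 1) / 3 = 1/3 - Q - of_int (- 1)"
      "(3 - 3 * Q + 2) / 3 = 2/3 - Q - of_int (- 1)"
      by (simp_all add: field_simps)
    have "3 * j = (q - ?k) + q * 2"
      using 3 j by (simp add: minus_triple_index_def)
    then have "tau (3 :: 'p mod_ring) ^ (3 * j) = tau 3 ^ (q - ?k)"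
      by (simp only: power_add power_mult t mult_1_right power_one)
    then show ?thesis
      unfolding fracs fl kK args by (intro conjI) (simp_all only: ac_simps)
  qed
  then show ?thesis
    using mult Gamma_rat_0[OF p5] unfolding jq prod3 by simp
qed

text \<open>With x = \<open>double_index q j / q\<close>, the two arguments on the left are x / 2
  and (x + 1) / 2, in an order that depends on whether Q < 1/2.\<close>

lemma Gamma_rat_double:
  fixes q j :: nat and Q :: rat
  assumes p5: "5 \<le> CARD('p::prime_card)" and q: "q = CARD('p) - 1" and j: "0 < j" "j < q"
    and Q: "Q = of_nat j / of_nat q"
  shows "Gamma_rat Q * Gamma_rat (frac (Q - 1/2))
    = Gamma_rat (1/2) * Gamma_rat (of_nat (double_index q j) / of_nat q) * tau (2 :: 'p mod_ring) ^ (2 * j)"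
proof -
  let ?G = "Gamma_rat :: rat \<Rightarrow> 'p padic" and ?K = "of_nat q :: rat"
  let ?k = "double_index q j"
  have "\<not> CARD('p) dvd 2"
    using p5 by (auto dest: dvd_imp_le)
  moreover have k: "?k < CARD('p)"
    using j q p5 by (auto simp: double_index_def)
  ultimately have mult: "(\<Prod>h<2. ?G ((of_nat ?k / ?K + of_nat h) / 2)) * tau 2 ^ (q - ?k)
      = (\<Prod>h<2. ?G (of_nat h / 2)) * ?G (of_nat ?k / ?K)"
    using Gamma_rat_multiplication[OF p5, of 2 ?k] unfolding q by simp
  have K: "?K > 0"
    using j by simp
  note 2 = mod_ring_numeral_nonzero(1)[OF p5]
  have prod2: "(\<Prod>h<2. f h) = f 0 * (f 1 :: 'p padic)" for f :: "nat \<Rightarrow> 'p padic"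
    by (simp add: eval_nat_numeral)
  have fracs: "frac (Q - 1/2) = Q - 1/2 - of_int \<lfloor>Q - 1/2\<rfloor>"
    by (simp add: frac_def)
  have "?G Q * ?G (frac (Q - 1/2)) = ?G (of_nat ?k / ?K / 2) * ?G ((of_nat ?k / ?K + 1) / 2)
    \<and> tau (2 :: 'p mod_ring) ^ (q - ?k) * tau 2 ^ (2 * j) = 1"
  proof (cases "2 * j < q")
    case True
    then have kK: "of_nat ?k / ?K = 2 * Q"
      by (simp add: double_index_def Q)
    have fl: "\<lfloor>Q - 1/2\<rfloor> = - 1"
      using True by (simp add: floor_index[OF j Q])
    have args: "2 * Q / 2 = Q" "(2 * Q + 1) / 2 = Q - 1/2 - of_int (- 1)"
      by (simp_all add: field_simps)
    have "q - ?k + 2 * j = q"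
      using True by (simp add: double_index_def)
    then have "tau (2 :: 'p mod_ring) ^ (q - ?k) * tau 2 ^ (2 * j) = 1"
      using tau_power_card[OF 2] by (simp add: q flip: power_add)
    then show ?thesis
      unfolding fracs fl kK args by (intro conjI) (simp_all only: ac_simps)
  next
    case False
    then have kK: "of_nat ?k / ?K = 2 * Q - 1"
      using K by (simp add: double_index_def Q field_simps)
    have fl: "\<lfloor>Q - 1/2\<rfloor> = 0"
      using False by (simp add: floor_index[OF j Q])
    have args: "(2 * Q - 1) / 2 = Q - 1/2 - of_int 0" "(2 * Q - 1 + 1) / 2 = Q"
      by (simp_all add: field_simps)
    have "q - ?k + 2 * j = q * 2"
      using False j by (simp add: double_index_def)
    then have "tau (2 :: 'p mod_ring) ^ (q - ?k) * tau 2 ^ (2 * j) = (tau 2 ^ q) ^ 2"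
      by (simp only: power_add[symmetric] power_mult[symmetric])
    then have "tau (2 :: 'p mod_ring) ^ (q - ?k) * tau 2 ^ (2 * j) = 1"
      using tau_power_card[OF 2] by (simp add: q)
    then show ?thesis
      unfolding fracs fl kK args by (intro conjI) (simp_all only: ac_simps)
  qed
  then have A: "?G Q * ?G (frac (Q - 1/2)) = ?G (of_nat ?k / ?K / 2) * ?G ((of_nat ?k / ?K + 1) / 2)"
    and B: "tau (2 :: 'p mod_ring) ^ (q - ?k) * tau 2 ^ (2 * j) = 1"
    by simp_all
  have "?G Q * ?G (frac (Q - 1/2)) * tau 2 ^ (q - ?k) = ?G (1/2) * ?G (of_nat ?k / ?K)"
    using mult Gamma_rat_0[OF p5] unfolding A prod2 by simp
  then have "?G Q * ?G (frac (Q - 1/2)) * (tau 2 ^ (q - ?k) * tau 2 ^ (2 * j))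
      = ?G (1/2) * ?G (of_nat ?k / ?K) * tau 2 ^ (2 * j)"
    by (simp only: mult.assoc[symmetric])
  then show ?thesis
    unfolding B by simp
qed

text \<open>The floors of the series detect the borrow in the Jacobi sum with a = q - j and b
  congruent to 2 j: the exponent of -p is 0 or 1 accordingly. The remaining Gauss index a - b is
  congruent to -3 j.\<close>

lemma hypergeometric_exponent:
  fixes q j :: nat and Q :: rat
  assumes j: "0 < j" "j < q" and Q: "Q = of_nat j / of_nat q"
  shows "- \<lfloor>1/3 - Q\<rfloor> - \<lfloor>Q\<rfloor> + (- \<lfloor>2/3 - Q\<rfloor> - \<lfloor>1/2 + Q\<rfloor>) = (if double_index q j \<le> q - j then 0 else 1)"
    and "(if double_index q j \<le> q - j then q - j - double_index q j else q - j + q - double_index q j)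
      = minus_triple_index q j"
proof -
  have floor_Q: "\<lfloor>Q\<rfloor> = 0"
    using unit_interval_index[OF j Q] by (intro floor_unique) simp_all
  show "- \<lfloor>1/3 - Q\<rfloor> - \<lfloor>Q\<rfloor> + (- \<lfloor>2/3 - Q\<rfloor> - \<lfloor>1/2 + Q\<rfloor>) = (if double_index q j \<le> q - j then 0 else 1)"
    unfolding floor_Q floor_index[OF j Q] double_index_def using j by auto
  show "(if double_index q j \<le> q - j then q - j - double_index q j else q - j + q - double_index q j)
      = minus_triple_index q j"
    unfolding double_index_def minus_triple_index_def using j by auto
qed

text \<open>The Jacobi sum of \<tau>^(-2 j) and \<tau>^(-j), with each Gauss series multiplied by 1
  - p to become a gamma value. The factor \<open>q\<close> supplies the missing 1 - p up to sign,
  whence the minus sign.\<close>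

lemma jacobi_sum_Gamma_rat:
  fixes q j :: nat
  assumes p5: "5 \<le> CARD('p::prime_card)" and q: "q = CARD('p) - 1" and j: "0 < j" "j < q"
  shows "(\<Sum>u | u \<noteq> (0 :: 'p mod_ring) \<and> 1 + u \<noteq> 0. inverse (tau u ^ 2 * tau (1 + u)) ^ j)
      * Gamma_rat (of_nat (q - j) / of_nat q)
    = - (if double_index q j \<le> q - j then 1 else - prime_padic)
      * Gamma_rat (of_nat (double_index q j) / of_nat q) * Gamma_rat (of_nat (minus_triple_index q j) / of_nat q)"
proof -
  let ?b = "double_index q j" and ?c = "minus_triple_index q j"
  let ?S = "\<Sum>u | u \<noteq> (0 :: 'p mod_ring) \<and> 1 + u \<noteq> 0. inverse (tau u ^ 2 * tau (1 + u)) ^ j"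
  define c :: "'p padic" where "c = (if ?b \<le> q - j then 1 else - prime_padic)"
  have b: "?b < q" and b': "q - ?b + 2 * j = q * (if 2 * j < q then 1 else 2)"
    using j by (auto simp: double_index_def)
  have lt: "q - j < CARD('p)" "?b < CARD('p)" "?c < CARD('p)"
    using j q p5 by (auto simp: double_index_def minus_triple_index_def)
  have g: "Gamma_rat (of_nat k / of_nat q) = (1 - prime_padic) * (dwork_gauss k :: 'p padic)" if "k < CARD('p)" for k
    unfolding q using p5 _ that by (rule Gamma_rat_eq_dwork_gauss[of 1]) (use p5 in simp)
  have "tau u ^ (q - ?b) * tau (1 + u) ^ (q - j) = inverse (tau u ^ 2 * tau (1 + u)) ^ j"
    if "u \<noteq> 0" "1 + u \<noteq> 0" for u :: "'p mod_ring"
  proof -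
    have t: "tau u ^ q = 1" "tau (1 + u) ^ q = 1"
      using that unfolding q by (simp_all only: tau_power_card not_False_eq_True)
    have A: "tau u ^ (q - ?b) * (tau u ^ 2) ^ j = 1"
      unfolding power_mult[symmetric] power_add[symmetric] b' by (simp add: power_mult t)
    have B: "tau (1 + u) ^ (q - j) * tau (1 + u) ^ j = 1"
      using j t(2) by (simp flip: power_add)
    have "(tau u ^ (q - ?b) * tau (1 + u) ^ (q - j)) * (tau u ^ 2 * tau (1 + u)) ^ j
        = (tau u ^ (q - ?b) * (tau u ^ 2) ^ j) * (tau (1 + u) ^ (q - j) * tau (1 + u) ^ j)"
      by (simp only: power_mult_distrib ac_simps)
    then have "(tau u ^ (q - ?b) * tau (1 + u) ^ (q - j)) * (tau u ^ 2 * tau (1 + u)) ^ j = 1"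
      unfolding A B by simp
    then have "(tau u ^ 2 * tau (1 + u)) ^ j * (tau u ^ (q - ?b) * tau (1 + u) ^ (q - j)) = 1"
      by (simp only: mult.commute)
    then show ?thesis
      unfolding power_inverse by (rule inverse_unique[symmetric])
  qed
  then have S: "?S = (\<Sum>u | u \<noteq> (0 :: 'p mod_ring) \<and> 1 + u \<noteq> 0. tau u ^ (q - ?b) * tau (1 + u) ^ (q - j))"
    by (intro sum.cong) simp_all
  have "?S * dwork_gauss (q - j) = of_nat q * (if ?b \<le> q - j then dwork_gauss ?b * dwork_gauss (q - j - ?b)
        else - prime_padic * (dwork_gauss ?b * dwork_gauss (q - j + q - ?b)))"
    unfolding S using j by (intro jacobi_sum_dwork_gauss p5 q b) simp_all
  also have "\<dots> = of_nat q * (c * (dwork_gauss ?b * dwork_gauss ?c))"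
    using hypergeometric_exponent(2)[OF j refl] by (simp add: c_def split: if_splits)
  also have "of_nat q = (prime_padic - 1 :: 'p padic)"
    unfolding q by simp
  finally have J: "?S * dwork_gauss (q - j) = (prime_padic - 1) * (c * (dwork_gauss ?b * dwork_gauss ?c))" .
  have "?S * ((1 - prime_padic) * dwork_gauss (q - j))
      = (1 - prime_padic) * ((prime_padic - 1) * (c * (dwork_gauss ?b * dwork_gauss ?c)))"
    unfolding J[symmetric] by (simp only: ac_simps)
  also have "\<dots> = - c * ((1 - prime_padic) * dwork_gauss ?b) * ((1 - prime_padic) * dwork_gauss ?c)"
    by (simp add: algebra_simps)
  finally show ?thesis
    unfolding g[OF lt(1)] g[OF lt(2)] g[OF lt(3)] c_def .
qed

section \<open>The terms of the series as Jacobi sums\<close>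

definition hypergeometric_term :: "nat \<Rightarrow> 'p::prime_card mod_ring \<Rightarrow> 'p padic" where
  "hypergeometric_term j t = (let Q = of_nat j / of_nat (CARD('p) - 1) in
     teichmueller_bar_power j t *
     ((- prime_padic) powi (- \<lfloor>1/3 - Q\<rfloor> - \<lfloor>Q\<rfloor>) * (Gamma_rat (frac (1/3 - Q)) / Gamma_rat (1/3)) * (Gamma_rat (frac Q) / Gamma_rat 0) *
     ((- prime_padic) powi (- \<lfloor>2/3 - Q\<rfloor> - \<lfloor>1/2 + Q\<rfloor>) * (Gamma_rat (frac (2/3 - Q)) / Gamma_rat (2/3)) * (Gamma_rat (frac (Q - 1/2)) / Gamma_rat (1/2)))))"

lemma hypergeometric_G_eq_sum:
  "hypergeometric_G [1/3, 2/3] [0, 1/2] (t :: 'p::prime_card mod_ring)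
    = - 1 / of_nat (CARD('p) - 1) * (\<Sum>j<CARD('p) - 1. hypergeometric_term j t)"
proof -
  have p: "{0..CARD('p) - 2} = {..<CARD('p) - 1}"
    using CARD_gt_1(1)[where 'p = 'p] by auto
  have K: "(of_nat CARD('p) - 1 :: rat) = of_nat (CARD('p) - 1)" "(of_nat CARD('p) - 1 :: 'p padic) = of_nat (CARD('p) - 1)"
    by simp_all
  have fr: "frac (1/3 :: rat) = 1/3" "frac (2/3 :: rat) = 2/3" "frac (- (1/2) :: rat) = 1/2" "frac (- 0 :: rat) = 0"
    by (rule iffD2[OF frac_unique_iff], simp)+
  have prod2: "(\<Prod>h<2. f h) = f 0 * (f 1 :: 'p padic)" for f :: "nat \<Rightarrow> 'p padic"
    by (simp add: eval_nat_numeral)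
  have len: "length [1/3, 2/3 :: rat] = 2"
    by simp
  have nths: "[1/3, 2/3 :: rat] ! 0 = 1/3" "[1/3, 2/3 :: rat] ! 1 = 2/3" "[0, 1/2 :: rat] ! 0 = 0" "[0, 1/2 :: rat] ! 1 = 1/2"
    by simp_all
  have args: "- 0 + Q = Q" "0 + Q = Q" "- (1/2) + Q = Q - 1/2" for Q :: rat
    by simp_all
  have even: "(- 1 :: 'p padic) ^ (j * 2) = 1" for j
    by simp
  show ?thesis
    unfolding hypergeometric_G_def Let_def len prod2 nths K p fr args hypergeometric_term_def even mult_1_left
    ..
qed

lemma hypergeometric_term_0:
  fixes t :: "'p::prime_card mod_ring"
  assumes p5: "5 \<le> CARD('p)" and t: "t \<noteq> 0"
  shows "hypergeometric_term 0 t = 1"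
proof -
  have fl: "\<lfloor>1/3 :: rat\<rfloor> = 0" "\<lfloor>2/3 :: rat\<rfloor> = 0" "\<lfloor>1/2 :: rat\<rfloor> = 0"
    by (rule floor_unique; simp)+
  have fr: "frac (1/3 :: rat) = 1/3" "frac (2/3 :: rat) = 2/3" "frac (- (1/2) :: rat) = 1/2" "frac (0 :: rat) = 0"
    by (rule iffD2[OF frac_unique_iff], simp)+
  show ?thesis
    using t by (simp add: hypergeometric_term_def teichmueller_bar_power_def fl fr Gamma_rat_nonzero[OF p5])
qed

lemma hypergeometric_term_simplify:
  fixes x :: "'a :: field"
  assumes x: "x * ga * T\<^sub>3 = d * gc" and y: "y = e * gb * T\<^sub>2"
    and nz: "ga \<noteq> 0" "T\<^sub>3 \<noteq> 0" "d \<noteq> 0" "e \<noteq> 0" "T \<noteq> 0"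
  shows "inverse T * c * (x * y / (d * e)) = c * gb * gc / ga * (T\<^sub>2 / (T\<^sub>3 * T))"
proof -
  have "x = d * gc / (ga * T\<^sub>3)"
    using x nz by (simp add: eq_divide_eq mult.assoc)
  then show ?thesis
    unfolding y using nz by (simp add: field_simps)
qed

text \<open>The triple and double formulas reduce the gamma quotients to the three values in the
  Jacobi sum. They leave the powers \<tau>(2)^(2 j) / \<tau>(3)^(3 j), which combine with
  \<tau>(t)^(-j) to \<tau>(4 / (27 t))^j; this is the origin of the constant 4/27 and of the
  substitution for \<open>t\<close>.\<close>

lemma hypergeometric_term_eq:
  fixes t u\<^sub>0 :: "'p::prime_card mod_ring"
  assumes p5: "5 \<le> CARD('p)" and u0: "u\<^sub>0 \<noteq> 0" and t: "t = - (4 / (27 * u\<^sub>0))"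
    and j: "0 < j" "j < CARD('p) - 1"
  shows "hypergeometric_term j t
    = - (\<Sum>u | u \<noteq> 0 \<and> 1 + u \<noteq> 0. tau (- u\<^sub>0 / (u ^ 2 * (1 + u))) ^ j)"
proof -
  define q where "q = CARD('p) - 1"
  define Q :: rat where "Q = of_nat j / of_nat q"
  have jq: "j < q"
    using j by (simp add: q_def)
  let ?G = "Gamma_rat :: rat \<Rightarrow> 'p padic"
  define ga gb gc where "ga = ?G (of_nat (q - j) / of_nat q)" and "gb = ?G (of_nat (double_index q j) / of_nat q)"
    and "gc = ?G (of_nat (minus_triple_index q j) / of_nat q)"
  define c :: "'p padic" where "c = (if double_index q j \<le> q - j then 1 else - prime_padic)"
  define S where "S = (\<Sum>u | u \<noteq> (0 :: 'p mod_ring) \<and> 1 + u \<noteq> 0. inverse (tau u ^ 2 * tau (1 + u)) ^ j)"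
  note nz = mod_ring_numeral_nonzero[OF p5]
  have t0: "t \<noteq> 0"
    unfolding t using nz u0 by simp
  have "- u\<^sub>0 * (27 * t) = 4"
    unfolding t using nz u0 by simp
  then have u0_eq: "- u\<^sub>0 = 2 ^ 2 / (3 ^ 3 * t)"
    by (subst eq_divide_eq) (use nz t0 in simp)
  have tau_u0: "tau (- u\<^sub>0) = tau 2 ^ 2 / (tau 3 ^ 3 * tau t)"
  proof -
    have "tau (- u\<^sub>0) = tau (2 ^ 2) / tau (3 ^ 3 * t)"
      unfolding u0_eq by (rule tau_divide) (use nz t0 in simp_all)
    also have "tau (3 ^ 3 * t) = tau (3 ^ 3) * tau t"
      by (rule tau_mult) (use nz t0 in simp_all)
    finally show ?thesis
      unfolding tau_power[OF nz(1)] tau_power[OF nz(2)] .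
  qed
  have J: "S * ga = - c * gb * gc"
    unfolding S_def ga_def gb_def gc_def c_def by (rule jacobi_sum_Gamma_rat[OF p5 q_def j(1) jq])
  have F3: "?G (frac (1/3 - Q)) * ?G (frac (2/3 - Q)) * ga * tau 3 ^ (3 * j) = ?G (1/3) * ?G (2/3) * gc"
    unfolding ga_def gc_def by (rule Gamma_rat_triple[OF p5 q_def j(1) jq Q_def])
  have F2: "?G Q * ?G (frac (Q - 1/2)) = ?G (1/2) * gb * tau 2 ^ (2 * j)"
    unfolding gb_def by (rule Gamma_rat_double[OF p5 q_def j(1) jq Q_def])
  have "(- prime_padic) powi (- \<lfloor>1/3 - Q\<rfloor> - \<lfloor>Q\<rfloor>) * (- prime_padic) powi (- \<lfloor>2/3 - Q\<rfloor> - \<lfloor>1/2 + Q\<rfloor>)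
      = ((- prime_padic) powi (- \<lfloor>1/3 - Q\<rfloor> - \<lfloor>Q\<rfloor> + (- \<lfloor>2/3 - Q\<rfloor> - \<lfloor>1/2 + Q\<rfloor>)) :: 'p padic)"
    by (rule power_int_add[symmetric]) simp
  also have "\<dots> = c"
    unfolding hypergeometric_exponent(1)[OF j(1) jq Q_def] c_def by simp
  finally have pow: "(- prime_padic) powi (- \<lfloor>1/3 - Q\<rfloor> - \<lfloor>Q\<rfloor>) * (- prime_padic) powi (- \<lfloor>2/3 - Q\<rfloor> - \<lfloor>1/2 + Q\<rfloor>) = c" .
  have frQ: "frac Q = Q"
    using j jq by (simp add: frac_eq Q_def)
  have nzG: "?G r \<noteq> 0" for r
    by (rule Gamma_rat_nonzero[OF p5])
  have nzt: "tau (2 :: 'p mod_ring) \<noteq> 0" "tau (3 :: 'p mod_ring) \<noteq> 0" "tau t \<noteq> 0"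
    using nz t0 by (simp_all add: tau_nonzero del: padic_of_int_eq_0_iff)
  have ga: "ga \<noteq> 0"
    unfolding ga_def by (rule nzG)
  have "hypergeometric_term j t = inverse (tau t) ^ j * ((- prime_padic) powi (- \<lfloor>1/3 - Q\<rfloor> - \<lfloor>Q\<rfloor>) *
      (- prime_padic) powi (- \<lfloor>2/3 - Q\<rfloor> - \<lfloor>1/2 + Q\<rfloor>)) *
      ((?G (frac (1/3 - Q)) * ?G (frac (2/3 - Q))) * (?G Q * ?G (frac (Q - 1/2))) / (?G (1/3) * ?G (2/3) * ?G (1/2)))"
    unfolding hypergeometric_term_def Let_def q_def[symmetric] Q_def[symmetric] frQ Gamma_rat_0[OF p5]
    by (simp only: teichmueller_bar_power_def t0 if_False inverse_1 divide_inverse inverse_mult_distrib mult_1_left mult_1_right ac_simps)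
  also have "\<dots> = c * gb * gc / ga * (tau 2 ^ (2 * j) / (tau 3 ^ (3 * j) * tau t ^ j))"
    unfolding pow power_inverse
    by (rule hypergeometric_term_simplify[OF F3 F2 ga]) (simp_all only: mult_eq_0_iff power_eq_0_iff nzG nzt simp_thms)
  also have "(c * gb * gc) / ga = - S"
    using J ga by (simp add: divide_eq_eq)
  also have "tau 2 ^ (2 * j) / (tau 3 ^ (3 * j) * tau t ^ j) = tau (- u\<^sub>0) ^ j"
    unfolding tau_u0 power_mult by (simp only: power_divide power_mult_distrib)
  finally have "hypergeometric_term j t = - (S * tau (- u\<^sub>0) ^ j)"
    by simp
  also have "S * tau (- u\<^sub>0) ^ j = (\<Sum>u | u \<noteq> 0 \<and> 1 + u \<noteq> 0. tau (- u\<^sub>0 / (u ^ 2 * (1 + u))) ^ j)"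
    unfolding S_def sum_distrib_right
  proof (rule sum.cong[OF refl])
    fix u :: "'p mod_ring"
    assume u: "u \<in> {u. u \<noteq> 0 \<and> 1 + u \<noteq> 0}"
    then have "tau (- u\<^sub>0 / (u ^ 2 * (1 + u))) = tau (- u\<^sub>0) / (tau u ^ 2 * tau (1 + u))"
      using u0 by (simp only: tau_divide tau_mult tau_power mem_Collect_eq mult_eq_0_iff power_eq_0_iff neg_equal_0_iff_equal simp_thms)
    then show "inverse (tau u ^ 2 * tau (1 + u)) ^ j * tau (- u\<^sub>0) ^ j = tau (- u\<^sub>0 / (u ^ 2 * (1 + u))) ^ j"
      by (simp only: divide_inverse power_mult_distrib mult.commute)
  qed
  finally show ?thesis .
qed

text \<open>Fourier inversion over all \<open>j < q\<close> would give -q N for N solutions. The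
  true term at j = 0 is 1, whereas the formula for j > 0 would give -(q - 1) there, as two of the p
  values of \<open>u\<close> are excluded. So the sum is q - q N, and the factor -1 / q turns it
  into N - 1.\<close>

lemma hypergeometric_G_eq_card:
  fixes t u\<^sub>0 :: "'p::prime_card mod_ring"
  assumes p5: "5 \<le> CARD('p)" and u0: "u\<^sub>0 \<noteq> 0" and t: "t = - (4 / (27 * u\<^sub>0))"
  shows "hypergeometric_G [1/3, 2/3] [0, 1/2] t = of_nat (card {w. w ^ 3 - w ^ 2 = u\<^sub>0}) - 1"
proof -
  define q where "q = CARD('p) - 1"
  let ?U = "{u :: 'p mod_ring. u \<noteq> 0 \<and> 1 + u \<noteq> 0}" and ?z = "\<lambda>u. - u\<^sub>0 / (u ^ 2 * (1 + u))"
  have q: "0 < q"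
    using p5 by (simp add: q_def)
  note nz = mod_ring_numeral_nonzero[OF p5]
  have t0: "t \<noteq> 0"
    unfolding t using nz u0 by simp
  have z0: "?z u \<noteq> 0" if "u \<in> ?U" for u
    using that u0 by simp
  have cardU: "card ?U + 1 = q"
  proof -
    have U: "?U = UNIV - {0, - 1}"
      by (auto simp: add_eq_0_iff)
    have "card ?U = CARD('p) - 2"
      unfolding U by (simp add: card_Diff_subset)
    then show ?thesis
      using p5 by (simp add: q_def)
  qed
  have "(\<Sum>j<q. hypergeometric_term j t) = 1 + (\<Sum>j\<in>{1..<q}. hypergeometric_term j t)"
    using q hypergeometric_term_0[OF p5 t0] by (simp add: lessThan_atLeast0 sum.atLeast_Suc_lessThan)
  also have "(\<Sum>j\<in>{1..<q}. hypergeometric_term j t) = (\<Sum>j\<in>{1..<q}. - (\<Sum>u\<in>?U. tau (?z u) ^ j))"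
    by (intro sum.cong refl hypergeometric_term_eq[OF p5 u0 t]) (simp_all add: q_def)
  also have "\<dots> = of_nat (card ?U) - (\<Sum>j<q. \<Sum>u\<in>?U. tau (?z u) ^ j)"
    using q by (simp add: lessThan_atLeast0 sum.atLeast_Suc_lessThan[of 0 q] sum_negf)
  also have "(\<Sum>j<q. \<Sum>u\<in>?U. tau (?z u) ^ j) = (\<Sum>u\<in>?U. \<Sum>j<q. tau (?z u) ^ j)"
    by (rule sum.swap)
  also have "\<dots> = (\<Sum>u\<in>?U. if ?z u = 1 then of_nat q else 0)"
  proof (rule sum.cong[OF refl])
    fix u
    assume "u \<in> ?U"
    then have z: "?z u \<noteq> 0"
      by (rule z0)
    have "(\<Sum>j<q. tau (?z u) ^ j) = (if tau (?z u) = 1 then of_nat q else 0)"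
      unfolding q_def by (rule sum_root_of_unity_powers[OF tau_power_card[OF z]])
    then show "(\<Sum>j<q. tau (?z u) ^ j) = (if ?z u = 1 then of_nat q else 0)"
      unfolding tau_eq_1_iff[OF z] .
  qed
  also have "\<dots> = (\<Sum>u | u \<in> ?U \<and> ?z u = 1. of_nat q)"
    by (rule sum.mono_neutral_cong_right) auto
  also have "\<dots> = of_nat q * of_nat (card {u. u \<in> ?U \<and> ?z u = 1})"
    by simp
  \<comment> \<open>The substitution w = -u turns u^2 (1 + u) = -u_0 into the cubic; u = 0 and u =
    -1 are no solutions since u_0 is nonzero.\<close>
  also have "card {u. u \<in> ?U \<and> ?z u = 1} = card {w. w ^ 3 - w ^ 2 = u\<^sub>0}"
  proof (rule bij_betw_same_card[of uminus], rule bij_betw_byWitness[where f' = uminus])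
    show "uminus ` {u. u \<in> ?U \<and> ?z u = 1} \<subseteq> {w. w ^ 3 - w ^ 2 = u\<^sub>0}"
    proof
      fix w
      assume "w \<in> uminus ` {u. u \<in> ?U \<and> ?z u = 1}"
      then obtain u where u: "w = - u" "u \<noteq> 0" "1 + u \<noteq> 0" "?z u = 1"
        by blast
      define X where "X = u ^ 2 * (1 + u)"
      have "X \<noteq> 0"
        using u(2,3) by (simp add: X_def)
      then have "- u\<^sub>0 = - u\<^sub>0 / X * X"
        by simp
      also have "\<dots> = X"
        unfolding X_def u(4) by simp
      finally have "u\<^sub>0 = - X"
        by (simp only: minus_equation_iff)
      moreover have "w ^ 3 - w ^ 2 = - X"
        unfolding u(1) X_def by (simp add: algebra_simps power2_eq_square power3_eq_cube)
      ultimately show "w \<in> {w. w ^ 3 - w ^ 2 = u\<^sub>0}"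
        by simp
    qed
    show "uminus ` {w. w ^ 3 - w ^ 2 = u\<^sub>0} \<subseteq> {u. u \<in> ?U \<and> ?z u = 1}"
    proof
      fix u
      assume "u \<in> uminus ` {w. w ^ 3 - w ^ 2 = u\<^sub>0}"
      then obtain w where w: "u = - w" "w ^ 3 - w ^ 2 = u\<^sub>0"
        by auto
      have eq: "- u\<^sub>0 = u ^ 2 * (1 + u)"
        unfolding w(2)[symmetric] w(1) by (simp add: algebra_simps power2_eq_square power3_eq_cube)
      then have "u \<noteq> 0" "1 + u \<noteq> 0"
        using u0 by auto
      then show "u \<in> {u. u \<in> ?U \<and> ?z u = 1}"
        unfolding eq by simp
    qed
  qed simp_all
  finally have sum: "(\<Sum>j<q. hypergeometric_term j t)
      = 1 + (of_nat (card ?U) - of_nat q * of_nat (card {w. w ^ 3 - w ^ 2 = u\<^sub>0}))" .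
  have "1 + of_nat (card ?U) = (of_nat q :: 'p padic)"
    unfolding cardU[symmetric] by simp
  then have "(\<Sum>j<q. hypergeometric_term j t) = of_nat q * (1 - of_nat (card {w. w ^ 3 - w ^ 2 = u\<^sub>0}))"
    unfolding sum by (simp add: algebra_simps)
  then show ?thesis
    unfolding hypergeometric_G_eq_sum q_def[symmetric] using q by simp
qed

text \<open>By Vieta x, y, z are the roots of w^3 - w^2 = x y z. Solutions are counted without
  multiplicity, hence the cardinality of the set.\<close>

lemma hypergeometric_G_cubic:
  fixes x y z :: "'p::prime_card mod_ring"
  assumes p5: "5 \<le> CARD('p)" and "x * y * z \<noteq> 0"
    and e1: "x + y + z = 1" and e2: "x * y + y * z + z * x = 0"
  shows "hypergeometric_G [1/3, 2/3] [0, 1/2] (- (4 / (27 * (x * y * z)))) = of_nat (card {x, y, z}) - 1"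
proof -
  have "w ^ 3 - w ^ 2 - x * y * z = (w - x) * (w - y) * (w - z)" for w
  proof -
    have "(w - x) * (w - y) * (w - z) = w ^ 3 - (x + y + z) * w ^ 2 + (x * y + y * z + z * x) * w - x * y * z"
      by (simp add: algebra_simps power2_eq_square power3_eq_cube)
    then show ?thesis
      unfolding e1 e2 by simp
  qed
  then have "w ^ 3 - w ^ 2 = x * y * z \<longleftrightarrow> (w - x) * (w - y) * (w - z) = 0" for w
    by (metis eq_iff_diff_eq_0)
  then have "w ^ 3 - w ^ 2 = x * y * z \<longleftrightarrow> w \<in> {x, y, z}" for w
    by simp
  then have "{w. w ^ 3 - w ^ 2 = x * y * z} = {x, y, z}"
    by blast
  then show ?thesis
    using hypergeometric_G_eq_card[OF p5 assms(2) refl] by simp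
qed

theorem theorem5p2:
  fixes a b c :: "'p::prime_card mod_ring" and A :: nat
  assumes "CARD('p) \<ge> 5"
    and "a \<noteq> 0" and "b \<noteq> 0" and "c \<noteq> 0"
    and "distinct [a, b, c] \<Longrightarrow> A = 2"
    and "card {a, b, c} = 2 \<Longrightarrow> A = 1"
  shows "(a + b + c = 0 \<and> a * b + b * c + c * a \<noteq> 0 \<longrightarrow>
           hypergeometric_G [1/3, 2/3] [0, 1/2]
             (- (4 * (a * b + b * c + c * a) ^ 3 / (27 * a ^ 2 * b ^ 2 * c ^ 2))) = of_nat A) \<and>
         (a * b + b * c + c * a = 0 \<and> a + b + c \<noteq> 0 \<longrightarrow>
           hypergeometric_G [1/3, 2/3] [0, 1/2]
             (- (4 * (a + b + c) ^ 3 / (27 * a * b * c))) = of_nat A)"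
proof -
  note 3 = mod_ring_numeral_nonzero(2)[OF assms(1)]
  have card: "(of_nat (card {a, b, c}) - 1 :: 'p padic) = of_nat A" if "\<not> (a = b \<and> b = c)"
  proof (cases "distinct [a, b, c]")
    case True
    then have "card {a, b, c} = 3"
      by simp
    then show ?thesis
      using assms(5)[OF True] by simp
  next
    case False
    then have two: "card {a, b, c} = 2"
      using that by (auto simp: card_insert_if)
    then show ?thesis
      using assms(6) by simp
  qed
  show ?thesis
  proof (intro conjI impI; elim conjE)
    define Q where "Q = a * b + b * c + c * a"
    assume 0: "a + b + c = 0" and "a * b + b * c + c * a \<noteq> 0"
    then have Q: "Q \<noteq> 0"
      by (simp add: Q_def)
    have ne: "\<not> (a = b \<and> b = c)"
    proof
      assume "a = b \<and> b = c"
      then have "3 * a = 0"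
        using 0 by (simp add: algebra_simps)
      then show False
        using 3 assms(2) by simp
    qed
    \<comment> \<open>The inverses of a, b, c scaled by a b c / Q to have sum 1. Passing to inverses
      turns a + b + c = 0 into the vanishing of the second elementary symmetric function.\<close>
    let ?x = "b * c / Q" and ?y = "c * a / Q" and ?z = "a * b / Q"
    have e1: "?x + ?y + ?z = 1"
      using Q by (simp add: Q_def add_ac flip: add_divide_distrib)
    have "?x * ?y + ?y * ?z + ?z * ?x = a * b * c * (a + b + c) / Q ^ 2"
      by (simp add: power2_eq_square algebra_simps flip: add_divide_distrib)
    then have e2: "?x * ?y + ?y * ?z + ?z * ?x = 0"
      unfolding 0 by simp
    have arg: "4 / (27 * (?x * ?y * ?z)) = 4 * Q ^ 3 / (27 * a ^ 2 * b ^ 2 * c ^ 2)"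
      using Q by (simp add: power2_eq_square power3_eq_cube ac_simps)
    have "{?x, ?y, ?z} = (\<lambda>r. a * b * c / (Q * r)) ` {a, b, c}"
      using assms(2-4) by (auto simp: field_simps)
    moreover have "inj_on (\<lambda>r. a * b * c / (Q * r)) {a, b, c}"
      using assms(2-4) Q by (auto simp: inj_on_def field_simps)
    ultimately have cards: "card {?x, ?y, ?z} = card {a, b, c}"
      by (simp only: card_image)
    have "?x * ?y * ?z \<noteq> 0"
      using assms(2-4) Q by simp
    from hypergeometric_G_cubic[OF assms(1) this e1 e2]
    have "hypergeometric_G [1/3, 2/3] [0, 1/2] (- (4 * Q ^ 3 / (27 * a ^ 2 * b ^ 2 * c ^ 2))) = of_nat A"
      unfolding cards card[OF ne] arg .
    then show "hypergeometric_G [1/3, 2/3] [0, 1/2]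
        (- (4 * (a * b + b * c + c * a) ^ 3 / (27 * a ^ 2 * b ^ 2 * c ^ 2))) = of_nat A"
      unfolding Q_def .
  next
    define s where "s = a + b + c"
    assume 0: "a * b + b * c + c * a = 0" and "a + b + c \<noteq> 0"
    then have s: "s \<noteq> 0"
      by (simp add: s_def)
    have ne: "\<not> (a = b \<and> b = c)"
    proof
      assume "a = b \<and> b = c"
      then have "3 * (a * a) = 0"
        using 0 by (simp add: algebra_simps)
      then show False
        using 3 assms(2) by simp
    qed
    \<comment> \<open>Here the second symmetric function already vanishes, so scaling the sum to 1
      is enough.\<close>
    let ?x = "a / s" and ?y = "b / s" and ?z = "c / s"
    have e1: "?x + ?y + ?z = 1"
      using s by (simp add: s_def flip: add_divide_distrib)
    have "?x * ?y + ?y * ?z + ?z * ?x = (a * b + b * c + c * a) / s ^ 2"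
      by (simp add: power2_eq_square flip: add_divide_distrib)
    then have e2: "?x * ?y + ?y * ?z + ?z * ?x = 0"
      unfolding 0 by simp
    have arg: "4 / (27 * (?x * ?y * ?z)) = 4 * s ^ 3 / (27 * a * b * c)"
      using s by (simp add: power3_eq_cube ac_simps)
    have "{?x, ?y, ?z} = (\<lambda>r. r / s) ` {a, b, c}"
      by auto
    moreover have "inj_on (\<lambda>r. r / s) {a, b, c}"
      using s by (auto simp: inj_on_def)
    ultimately have cards: "card {?x, ?y, ?z} = card {a, b, c}"
      by (simp only: card_image)
    have "?x * ?y * ?z \<noteq> 0"
      using assms(2-4) s by simp
    from hypergeometric_G_cubic[OF assms(1) this e1 e2]
    have "hypergeometric_G [1/3, 2/3] [0, 1/2] (- (4 * s ^ 3 / (27 * a * b * c))) = of_nat A"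
      unfolding cards card[OF ne] arg .
    then show "hypergeometric_G [1/3, 2/3] [0, 1/2] (- (4 * (a + b + c) ^ 3 / (27 * a * b * c))) = of_nat A"
      unfolding s_def .
  qed
qed

end
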